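(* Let $(\mathcal P_t)_{t\ge0}$ be a decohering QMS on $\mathcal B(\mathcal H)$ which is reversible, and assume that for some $2<p\le\infty$ there exist $t_p,M_p>0$ such that $\|\mathcal P_{t_p}(X)\|_{(2,p),\mathcal N}\le M_p\|X\|_{2,\sigma_{\mathrm{Tr}}}$ for all positive semidefinite $X$. Then $\mathrm{LSI}_{2,\mathcal N}\big(\frac{p\,t_p}{p-2},\frac{p}{p-2}\ln M_p\big)$ holds (with $\frac{p}{p-2}:=1$ when $p=\infty$).
   Context: $\mathcal H$ finite-dimensional of dimension $d_{\mathcal H}$; QMS $\mathcal P_t=e^{t\mathcal L}$ (unital completely positive maps), decohering = has a full-rank invariant state; $\mathcal N$ its decoherence-free algebra ($X$ with $\mathcal P_t(X^*X)=\mathcal P_t(X)^*\mathcal P_t(X)$, $\mathcal P_t(XX^* )=\mathcal P_t(X)\mathcal P_t(X)^*$ for all $t$), $E_{\mathcal N}$ the unique conditional expectation onto $\mathcal N$ with $\mathcal P_t(X-E_{\mathcal N}[X])\to0$, $E_{\mathcal N*}$ its predual, $\sigma_{\mathrm{Tr}}=E_{\mathcal N*}(\mathbb I/d_{\mathcal H})$. $\Gamma^s(X)=\sigma_{\mathrm{Tr}}^{s/2}X\sigma_{\mathrm{Tr}}^{s/2}$, $\|X\|_{p,\sigma_{\mathrm{Tr}}}=\|\Gamma^{1/p}(X)\|_p$ (Schatten), $\langle X,Y\rangle_{\sigma_{\mathrm{Tr}}}=\mathrm{Tr}[\sigma_{\mathrm{Tr}}^{1/2}X^*\sigma_{\mathrm{Tr}}^{1/2}Y]$;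 reversible means $\mathcal L$ is self-adjoint for this inner product. For $1\le a\le b\le\infty$, $1/r=1/a-1/b$: $\|X\|_{(a,b),\mathcal N}=\inf\{\|A\|_{2r,\sigma_{\mathrm{Tr}}}\|B\|_{2r,\sigma_{\mathrm{Tr}}}\|Y\|_{b,\sigma_{\mathrm{Tr}}}:A,B\in\mathcal N,X=AYB\}$. $\mathcal E_{2,\mathcal L}(X)=-\langle X,\mathcal L X\rangle_{\sigma_{\mathrm{Tr}}}$; with $Z=\Gamma^{1/2}(X)$, $\mathrm{Ent}_{2,\mathcal N}(X)=\mathrm{Tr}[Z^2(\ln Z-\frac12\ln E_{\mathcal N}[\sigma_{\mathrm{Tr}}^{-1/2}Z^2\sigma_{\mathrm{Tr}}^{-1/2}]-\frac12\ln\sigma_{\mathrm{Tr}})]$. $\mathrm{LSI}_{2,\mathcal N}(c,d)$: $\mathrm{Ent}_{2,\mathcal N}(X)\le c\,\mathcal E_{2,\mathcal L}(X)+d\|X\|^2_{2,\sigma_{\mathrm{Tr}}}$ for all $X>0$. *)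

theory Defs
  imports "Jordan_Normal_Form.Matrix" "HOL-Library.Extended_Real"
begin

definition adj :: "complex mat \<Rightarrow> complex mat" where
  "adj A = mat (dim_col A) (dim_row A) (\<lambda>(i,j). cnj (A $$ (j,i)))"

definition tr :: "complex mat \<Rightarrow> complex" where
  "tr A = (\<Sum>i<dim_row A. A $$ (i,i))"

definition cinner :: "complex vec \<Rightarrow> complex vec \<Rightarrow> complex" where
  "cinner v w = (\<Sum>i<dim_vec v. cnj (v $ i) * w $ i)"

definition vnorm :: "complex vec \<Rightarrow> real" where
  "vnorm v = sqrt (\<Sum>i<dim_vec v. (cmod (v $ i))\<^sup>2)"

definition psd :: "nat \<Rightarrow> complex mat \<Rightarrow> bool" where
  "psd n A \<longleftrightarrow> A \<in> carrier_mat n n \<and> A = adj A \<and>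
     (\<forall>v\<in>carrier_vec n. Im (cinner v (A *\<^sub>v v)) = 0 \<and> 0 \<le> Re (cinner v (A *\<^sub>v v)))"

definition pd :: "nat \<Rightarrow> complex mat \<Rightarrow> bool" where
  "pd n A \<longleftrightarrow> psd n A \<and> (\<forall>v\<in>carrier_vec n. v \<noteq> 0\<^sub>v n \<longrightarrow> 0 < Re (cinner v (A *\<^sub>v v)))"

definition unitary :: "nat \<Rightarrow> complex mat \<Rightarrow> bool" where
  "unitary n U \<longleftrightarrow> U \<in> carrier_mat n n \<and> adj U * U = 1\<^sub>m n"

definition spec_decomp :: "complex mat \<Rightarrow> complex mat \<times> (nat \<Rightarrow> real) \<Rightarrow> bool" where
  "spec_decomp A p \<longleftrightarrow> unitary (dim_row A) (fst p) \<and>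
     A = fst p * mat_diag (dim_row A) (\<lambda>i. complex_of_real (snd p i)) * adj (fst p)"

definition mfun :: "(real \<Rightarrow> real) \<Rightarrow> complex mat \<Rightarrow> complex mat" where
  "mfun f A = (let p = (SOME p. spec_decomp A p)
     in fst p * mat_diag (dim_row A) (\<lambda>i. complex_of_real (f (snd p i))) * adj (fst p))"

definition mpow :: "real \<Rightarrow> complex mat \<Rightarrow> complex mat" where
  "mpow s A = mfun (\<lambda>x. x powr s) A"

definition mln :: "complex mat \<Rightarrow> complex mat" where
  "mln A = mfun ln A"

definition mabs :: "complex mat \<Rightarrow> complex mat" where
  "mabs X = mpow (1/2) (adj X * X)"

definition opnorm :: "complex mat \<Rightarrow> real" where
  "opnorm X = Sup {vnorm (X *\<^sub>v v) | v. v \<in> carrier_vec (dim_col X) \<and> vnorm v \<le> 1}"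

definition schatten :: "ereal \<Rightarrow> complex mat \<Rightarrow> real" where
  "schatten p X = (if p = \<infinity> then opnorm X
     else (Re (tr (mpow (real_of_ereal p) (mabs X)))) powr (1 / real_of_ereal p))"

definition einv :: "ereal \<Rightarrow> real" where
  "einv p = (if p = \<infinity> then 0 else 1 / real_of_ereal p)"

definition lin_map :: "nat \<Rightarrow> (complex mat \<Rightarrow> complex mat) \<Rightarrow> bool" where
  "lin_map n \<Phi> \<longleftrightarrow> (\<forall>X\<in>carrier_mat n n. \<Phi> X \<in> carrier_mat n n) \<and>
     (\<forall>X\<in>carrier_mat n n. \<forall>Y\<in>carrier_mat n n. \<forall>c. \<Phi> (c \<cdot>\<^sub>m X + Y) = c \<cdot>\<^sub>m \<Phi> X + \<Phi> Y)"

definition blockmat :: "nat \<Rightarrow> nat \<Rightarrow> (nat \<Rightarrow> nat \<Rightarrow> complex mat) \<Rightarrow> complex mat" where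
  "blockmat m n B = mat (m*n) (m*n) (\<lambda>(i,j). B (i div n) (j div n) $$ (i mod n, j mod n))"

definition cp_map :: "nat \<Rightarrow> (complex mat \<Rightarrow> complex mat) \<Rightarrow> bool" where
  "cp_map n \<Phi> \<longleftrightarrow> (\<forall>m B. (\<forall>i<m. \<forall>j<m. B i j \<in> carrier_mat n n) \<longrightarrow>
     psd (m*n) (blockmat m n B) \<longrightarrow> psd (m*n) (blockmat m n (\<lambda>i j. \<Phi> (B i j))))"

definition ucp :: "nat \<Rightarrow> (complex mat \<Rightarrow> complex mat) \<Rightarrow> bool" where
  "ucp n \<Phi> \<longleftrightarrow> lin_map n \<Phi> \<and> \<Phi> (1\<^sub>m n) = 1\<^sub>m n \<and> cp_map n \<Phi>"

definition sg :: "(complex mat \<Rightarrow> complex mat) \<Rightarrow> real \<Rightarrow> complex mat \<Rightarrow> complex mat" where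
  "sg L t X = mat (dim_row X) (dim_col X)
     (\<lambda>(i,j). \<Sum>k. complex_of_real (t ^ k / fact k) * ((L ^^ k) X) $$ (i,j))"

definition qms :: "nat \<Rightarrow> (complex mat \<Rightarrow> complex mat) \<Rightarrow> bool" where
  "qms n L \<longleftrightarrow> lin_map n L \<and> (\<forall>t\<ge>0. ucp n (sg L t))"

definition decohering :: "nat \<Rightarrow> (complex mat \<Rightarrow> complex mat) \<Rightarrow> bool" where
  "decohering n L \<longleftrightarrow> (\<exists>\<rho>. pd n \<rho> \<and> tr \<rho> = 1 \<and>
     (\<forall>t\<ge>0. \<forall>X\<in>carrier_mat n n. tr (\<rho> * sg L t X) = tr (\<rho> * X)))"

definition dfa :: "nat \<Rightarrow> (complex mat \<Rightarrow> complex mat) \<Rightarrow> complex mat set" where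
  "dfa n L = {X \<in> carrier_mat n n. \<forall>t\<ge>0.
      sg L t (adj X * X) = adj (sg L t X) * sg L t X \<and>
      sg L t (X * adj X) = sg L t X * adj (sg L t X)}"

definition cond_exp :: "nat \<Rightarrow> complex mat set \<Rightarrow> (complex mat \<Rightarrow> complex mat) \<Rightarrow> bool" where
  "cond_exp n N E \<longleftrightarrow> lin_map n E \<and> (\<forall>X\<in>carrier_mat n n. E X \<in> N) \<and> (\<forall>A\<in>N. E A = A) \<and>
     (\<forall>X. psd n X \<longrightarrow> psd n (E X)) \<and>
     (\<forall>A\<in>N. \<forall>B\<in>N. \<forall>X\<in>carrier_mat n n. E (A * X * B) = A * E X * B)"

text \<open>E_N: the unique conditional expectation onto N with P_t(X - E_N X) \<rightarrow> 0
  (normalised to 0 outside B(H) so that it is unique as a HOL function)\<close>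
definition EN :: "nat \<Rightarrow> (complex mat \<Rightarrow> complex mat) \<Rightarrow> complex mat \<Rightarrow> complex mat" where
  "EN n L = (THE E. cond_exp n (dfa n L) E \<and> (\<forall>X. X \<notin> carrier_mat n n \<longrightarrow> E X = 0\<^sub>m n n) \<and>
     (\<forall>X\<in>carrier_mat n n. \<forall>i<n. \<forall>j<n.
        ((\<lambda>t. sg L t (X - E X) $$ (i,j)) \<longlongrightarrow> 0) at_top))"

text \<open>sigma_Tr = E_N*(I/d), E_N* the predual w.r.t. the trace pairing\<close>
definition sigTr :: "nat \<Rightarrow> (complex mat \<Rightarrow> complex mat) \<Rightarrow> complex mat" where
  "sigTr n L = (THE \<sigma>. \<sigma> \<in> carrier_mat n n \<and>
     (\<forall>X\<in>carrier_mat n n. tr (\<sigma> * X) = tr ((1 / of_nat n) \<cdot>\<^sub>m 1\<^sub>m n * EN n L X)))"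

definition Gam :: "nat \<Rightarrow> (complex mat \<Rightarrow> complex mat) \<Rightarrow> real \<Rightarrow> complex mat \<Rightarrow> complex mat" where
  "Gam n L s X = mpow (s/2) (sigTr n L) * X * mpow (s/2) (sigTr n L)"

definition wnorm :: "nat \<Rightarrow> (complex mat \<Rightarrow> complex mat) \<Rightarrow> ereal \<Rightarrow> complex mat \<Rightarrow> real" where
  "wnorm n L p X = schatten p (Gam n L (einv p) X)"

definition winner :: "nat \<Rightarrow> (complex mat \<Rightarrow> complex mat) \<Rightarrow> complex mat \<Rightarrow> complex mat \<Rightarrow> complex" where
  "winner n L X Y = tr (mpow (1/2) (sigTr n L) * adj X * mpow (1/2) (sigTr n L) * Y)"

definition reversible :: "nat \<Rightarrow> (complex mat \<Rightarrow> complex mat) \<Rightarrow> bool" where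
  "reversible n L \<longleftrightarrow> (\<forall>X\<in>carrier_mat n n. \<forall>Y\<in>carrier_mat n n. winner n L X (L Y) = winner n L (L X) Y)"

text \<open>the (a,b),N norm; 2r with 1/r = 1/a - 1/b (2r = \<infinity> if a = b)\<close>
definition abnorm :: "nat \<Rightarrow> (complex mat \<Rightarrow> complex mat) \<Rightarrow> ereal \<Rightarrow> ereal \<Rightarrow> complex mat \<Rightarrow> real" where
  "abnorm n L a b X = (let q = (if einv a - einv b = 0 then \<infinity> else ereal (2 / (einv a - einv b)))
     in Inf {wnorm n L q A * wnorm n L q B * wnorm n L b Y | A B Y.
              A \<in> dfa n L \<and> B \<in> dfa n L \<and> Y \<in> carrier_mat n n \<and> X = A * Y * B})"

text \<open>Dirichlet form (real-valued on positive X for reversible L; we take the real part)\<close>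
definition dirichlet2 :: "nat \<Rightarrow> (complex mat \<Rightarrow> complex mat) \<Rightarrow> complex mat \<Rightarrow> real" where
  "dirichlet2 n L X = - Re (winner n L X (L X))"

definition ent2 :: "nat \<Rightarrow> (complex mat \<Rightarrow> complex mat) \<Rightarrow> complex mat \<Rightarrow> real" where
  "ent2 n L X = (let Z = Gam n L (1/2) X; \<sigma> = sigTr n L in
     Re (tr (Z * Z * (mln Z
        - (1/2) \<cdot>\<^sub>m mln (EN n L (mpow (-1/2) \<sigma> * (Z * Z) * mpow (-1/2) \<sigma>))
        - (1/2) \<cdot>\<^sub>m mln \<sigma>))))"

definition LSI2 :: "nat \<Rightarrow> (complex mat \<Rightarrow> complex mat) \<Rightarrow> real \<Rightarrow> real \<Rightarrow> bool" where
  "LSI2 n L c d \<longleftrightarrow> (\<forall>X. pd n X \<longrightarrow>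
     ent2 n L X \<le> c * dirichlet2 n L X + d * (wnorm n L 2 X)\<^sup>2)"

definition pfac :: "ereal \<Rightarrow> real" where
  "pfac p = (if p = \<infinity> then 1 else real_of_ereal p / (real_of_ereal p - 2))"

end

theory Submission
  imports "HOL-Complex_Analysis.Conformal_Mappings" "Jordan_Normal_Form.Schur_Decomposition" Defs
begin

text \<open>
  Write \<open>\<kappa> = 1 - 2/p\<close>, \<open>Z = \<sigma>\<^bsup>1/4\<^esup> X \<sigma>\<^bsup>1/4\<^esup>\<close>, \<open>R = E(\<sigma>\<^bsup>-1/2\<^esup> Z\<^sup>2 \<sigma>\<^bsup>-1/2\<^esup>)\<close> and \<open>D = \<sigma> R\<close>; the two
  factors of \<open>D\<close> commute because \<open>\<sigma>\<close> commutes with \<open>N\<close>. Reversibility makes the semigroup,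
  transported by \<open>Y \<mapsto> \<sigma>\<^bsup>1/4\<^esup> Y \<sigma>\<^bsup>1/4\<^esup>\<close>, self-adjoint for the Hilbert-Schmidt inner product, so that
  it extends to complex times: \<open>V(z) = e\<^bsup>ztL\<^esup> Z\<close>. The function
  \<open>F(z) = Tr (Z\<^bsup>1+\<kappa>z\<^esup> D\<^bsup>-\<kappa>z/4\<^esup> V(z) D\<^bsup>-\<kappa>z/4\<^esup>)\<close> satisfies \<open>F(0) = Tr Z\<^sup>2\<close>, and its derivative at \<open>0\<close>
  is \<open>\<kappa>\<close> times the entropy minus \<open>t\<close> times the Dirichlet form. Since \<open>|F| \<le> Tr Z\<^sup>2\<close> on \<open>Re z = 0\<close>
  and, by the hypothesis, \<open>|F| \<le> M\<^sub>p Tr Z\<^sup>2\<close> on \<open>Re z = 1\<close>, the three lines theorem gives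
  \<open>|F(\<theta>)| \<le> M\<^sub>p\<^sup>\<theta> Tr Z\<^sup>2\<close>; comparing derivatives at \<open>\<theta> = 0\<close> yields the inequality.

  On the line \<open>Re z = 1\<close> the duality between the \<open>(2,p)\<close> norm and the powers of \<open>Z\<close> and \<open>D\<close> is a
  second application of the three lines theorem, between the Cauchy-Schwarz inequality and the
  case \<open>p = \<infinity>\<close>, where it rests on \<open>Tr (Z\<^sup>2 A) = Tr (D A)\<close> for \<open>A\<close> in \<open>N\<close>.

  The matrix \<open>\<sigma>\<close>, and with it reversibility, is only defined through \<open>E\<close>, so \<open>E\<close> has to be
  constructed without it, as a limit point of the semigroup along times tending to infinity.
\<close>

unbundle no vec_syntax
no_notation fps_nth (infixl "$" 75)
declare index_mult_mat(1) [simp del]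
declare carrier_matI [rule del] and carrier_matD [rule del]

section \<open>Square matrices of a fixed size\<close>

locale square_matrices =
  fixes n :: nat
begin

abbreviation M :: "complex mat set" where "M \<equiv> carrier_mat n n"

lemma M_closed [simp]:
  "A \<in> M \<Longrightarrow> B \<in> M \<Longrightarrow> A * B \<in> M"
  "A \<in> M \<Longrightarrow> B \<in> M \<Longrightarrow> A + B \<in> M"
  "A \<in> M \<Longrightarrow> B \<in> M \<Longrightarrow> A - B \<in> M"
  "A \<in> M \<Longrightarrow> c \<cdot>\<^sub>m A \<in> M"
  "A \<in> M \<Longrightarrow> adj A \<in> M"
  by (rule mult_carrier_mat add_carrier_mat minus_carrier_mat smult_carrier_mat | assumption
      | simp add: adj_def)+

lemma index_mult: "A \<in> M \<Longrightarrow> B \<in> M \<Longrightarrow> i < n \<Longrightarrow> j < n \<Longrightarrow>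
    (A * B) $$ (i,j) = (\<Sum>k<n. A $$ (i,k) * B $$ (k,j))"
  by (simp add: index_mult_mat scalar_prod_def atLeast0LessThan)

lemma index_add: "A \<in> M \<Longrightarrow> B \<in> M \<Longrightarrow> i < n \<Longrightarrow> j < n \<Longrightarrow> (A + B) $$ (i,j) = A $$ (i,j) + B $$ (i,j)"
  by auto

lemma index_minus: "A \<in> M \<Longrightarrow> B \<in> M \<Longrightarrow> i < n \<Longrightarrow> j < n \<Longrightarrow> (A - B) $$ (i,j) = A $$ (i,j) - B $$ (i,j)"
  by auto

lemma index_smult: "A \<in> M \<Longrightarrow> i < n \<Longrightarrow> j < n \<Longrightarrow> (c \<cdot>\<^sub>m A) $$ (i,j) = c * A $$ (i,j)"
  by auto

lemma index_adj: "A \<in> M \<Longrightarrow> i < n \<Longrightarrow> j < n \<Longrightarrow> adj A $$ (i,j) = cnj (A $$ (j,i))"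
  by (auto simp: adj_def)

lemma M_eqI: "A \<in> M \<Longrightarrow> B \<in> M \<Longrightarrow> (\<And>i j. i < n \<Longrightarrow> j < n \<Longrightarrow> A $$ (i,j) = B $$ (i,j)) \<Longrightarrow> A = B"
  by (intro eq_matI) auto

lemma minus_eq_zeroD:
  assumes "A - B = 0\<^sub>m n n" "A \<in> M" "B \<in> M" shows "A = B"
proof (rule M_eqI[OF assms(2,3)])
  fix i j assume "i < n" "j < n"
  then show "A $$ (i,j) = B $$ (i,j)"
    using index_minus[OF assms(2,3), of i j] assms(1) by simp
qed

lemma M_assoc: "A \<in> M \<Longrightarrow> B \<in> M \<Longrightarrow> C \<in> M \<Longrightarrow> A * B * C = A * (B * C)"
  by (rule assoc_mult_mat)

lemma M_distrib:
  "A \<in> M \<Longrightarrow> B \<in> M \<Longrightarrow> C \<in> M \<Longrightarrow> A * (B + C) = A * B + A * C"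
  "A \<in> M \<Longrightarrow> B \<in> M \<Longrightarrow> C \<in> M \<Longrightarrow> (A + B) * C = A * C + B * C"
  "A \<in> M \<Longrightarrow> B \<in> M \<Longrightarrow> C \<in> M \<Longrightarrow> A * (B - C) = A * B - A * C"
  "A \<in> M \<Longrightarrow> B \<in> M \<Longrightarrow> C \<in> M \<Longrightarrow> (A - B) * C = A * C - B * C"
  by (auto simp: mult_add_distrib_mat add_mult_distrib_mat mult_minus_distrib_mat
      minus_mult_distrib_mat)

lemma M_smult:
  "A \<in> M \<Longrightarrow> B \<in> M \<Longrightarrow> A * (c \<cdot>\<^sub>m B) = c \<cdot>\<^sub>m (A * B)"
  "A \<in> M \<Longrightarrow> B \<in> M \<Longrightarrow> (c \<cdot>\<^sub>m A) * B = c \<cdot>\<^sub>m (A * B)"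
  by (auto simp: mult_smult_distrib mult_smult_assoc_mat)

lemma M_one [simp]: "A \<in> M \<Longrightarrow> 1\<^sub>m n * A = A" "A \<in> M \<Longrightarrow> A * 1\<^sub>m n = A"
  by auto

lemma M_zero [simp]: "A \<in> M \<Longrightarrow> 0\<^sub>m n n * A = 0\<^sub>m n n" "A \<in> M \<Longrightarrow> A * 0\<^sub>m n n = 0\<^sub>m n n"
  by (rule M_eqI; simp add: index_mult)+

lemma tr_zero [simp]: "tr (0\<^sub>m n n) = 0"
  by (simp add: tr_def)

lemma adj_adj [simp]: "adj (adj A) = A"
  by (rule eq_matI) (auto simp: adj_def)

lemma adj_mult: "A \<in> M \<Longrightarrow> B \<in> M \<Longrightarrow> adj (A * B) = adj B * adj A"
  by (rule M_eqI) (simp_all add: index_adj index_mult mult.commute)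

lemma adj_add: "A \<in> M \<Longrightarrow> B \<in> M \<Longrightarrow> adj (A + B) = adj A + adj B"
  by (rule M_eqI) (simp_all add: index_adj index_add)

lemma adj_minus: "A \<in> M \<Longrightarrow> B \<in> M \<Longrightarrow> adj (A - B) = adj A - adj B"
  by (rule M_eqI) (simp_all add: index_adj index_minus)

lemma adj_smult: "A \<in> M \<Longrightarrow> adj (c \<cdot>\<^sub>m A) = cnj c \<cdot>\<^sub>m adj A"
  by (rule M_eqI) (simp_all add: index_adj index_smult)

lemma adj_one [simp]: "adj (1\<^sub>m n) = 1\<^sub>m n"
  by (rule M_eqI) (auto simp: index_adj)

lemma adj_zero [simp]: "adj (0\<^sub>m n n) = 0\<^sub>m n n"
  by (rule M_eqI) (auto simp: index_adj)

lemma tr_sum: "A \<in> M \<Longrightarrow> tr A = (\<Sum>i<n. A $$ (i,i))"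
  by (auto simp: tr_def)

lemma tr_mult: "A \<in> M \<Longrightarrow> B \<in> M \<Longrightarrow> tr (A * B) = (\<Sum>i<n. \<Sum>j<n. A $$ (i,j) * B $$ (j,i))"
  by (simp add: tr_sum index_mult)

lemma tr_mult_commute: "A \<in> M \<Longrightarrow> B \<in> M \<Longrightarrow> tr (A * B) = tr (B * A)"
  unfolding tr_mult by (subst sum.swap) (simp add: mult.commute tr_mult)

lemma tr_add: "A \<in> M \<Longrightarrow> B \<in> M \<Longrightarrow> tr (A + B) = tr A + tr B"
  by (simp add: tr_sum index_add sum.distrib)

lemma tr_minus: "A \<in> M \<Longrightarrow> B \<in> M \<Longrightarrow> tr (A - B) = tr A - tr B"
  by (simp add: tr_sum index_minus sum_subtractf)

lemma tr_smult: "A \<in> M \<Longrightarrow> tr (c \<cdot>\<^sub>m A) = c * tr A"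
  by (simp add: tr_sum index_smult sum_distrib_left)

lemma tr_adj: "A \<in> M \<Longrightarrow> tr (adj A) = cnj (tr A)"
  by (simp add: tr_sum index_adj)

definition hs_norm :: "complex mat \<Rightarrow> real" where
  "hs_norm A = L2_set (\<lambda>x. cmod (A $$ x)) ({..<n} \<times> {..<n})"

lemma hs_norm_nonneg [simp]: "0 \<le> hs_norm A"
  by (simp add: hs_norm_def)

lemma hs_norm_zero [simp]: "hs_norm (0\<^sub>m n n) = 0"
  by (auto simp: hs_norm_def L2_set_eq_0_iff)

lemma hs_norm_square: "(hs_norm A)\<^sup>2 = (\<Sum>i<n. \<Sum>j<n. (cmod (A $$ (i,j)))\<^sup>2)"
  unfolding hs_norm_def L2_set_def by (simp add: sum_nonneg sum.cartesian_product case_prod_beta)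

lemma tr_gram: "A \<in> M \<Longrightarrow> tr (adj A * A) = complex_of_real ((hs_norm A)\<^sup>2)"
  unfolding hs_norm_square
  by (simp add: tr_mult index_adj)
    (subst sum.swap, simp add: complex_norm_square[symmetric] mult.commute)

lemma hs_norm_adj:
  assumes A: "A \<in> M" shows "hs_norm (adj A) = hs_norm A"
proof -
  have "(hs_norm (adj A))\<^sup>2 = (hs_norm A)\<^sup>2"
    unfolding hs_norm_square using A by (subst sum.swap) (simp add: index_adj)
  then show ?thesis by simp
qed

lemma hs_norm_eq_0: "A \<in> M \<Longrightarrow> hs_norm A = 0 \<Longrightarrow> A = 0\<^sub>m n n"
  by (rule M_eqI) (auto simp: hs_norm_def L2_set_eq_0_iff)

lemma tr_Cauchy_Schwarz:
  assumes "A \<in> M" "B \<in> M" shows "cmod (tr (A * B)) \<le> hs_norm A * hs_norm B"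
proof -
  have "cmod (tr (A * B)) \<le> (\<Sum>i<n. \<Sum>j<n. cmod (A $$ (i,j)) * cmod (adj B $$ (i,j)))"
    unfolding tr_mult[OF assms]
    by (intro sum_norm_le) (use assms in \<open>simp add: norm_mult index_adj\<close>)
  also have "\<dots> = (\<Sum>x\<in>{..<n}\<times>{..<n}. \<bar>cmod (A $$ x)\<bar> * \<bar>cmod (adj B $$ x)\<bar>)"
    by (simp add: sum.cartesian_product case_prod_beta)
  also have "\<dots> \<le> L2_set (\<lambda>x. cmod (A $$ x)) ({..<n}\<times>{..<n})
      * L2_set (\<lambda>x. cmod (adj B $$ x)) ({..<n}\<times>{..<n})"
    by (rule L2_set_mult_ineq)
  also have "\<dots> = hs_norm A * hs_norm (adj B)"
    by (simp add: hs_norm_def case_prod_beta)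
  finally show ?thesis using assms by (simp add: hs_norm_adj)
qed

lemma tr_mult_eqI:
  assumes "A \<in> M" "B \<in> M" "\<And>X. X \<in> M \<Longrightarrow> tr (A * X) = tr (B * X)" shows "A = B"
proof -
  let ?D = "A - B"
  have "tr (?D * adj ?D) = 0" using assms by (simp add: M_distrib(4) tr_minus)
  then have "tr (adj (adj ?D) * adj ?D) = 0" by simp
  then have "hs_norm (adj ?D) = 0" using assms by (subst (asm) tr_gram) auto
  then have "hs_norm ?D = 0" using assms by (simp add: hs_norm_adj)
  then have "?D = 0\<^sub>m n n" using assms hs_norm_eq_0 by simp
  then show ?thesis by (rule minus_eq_zeroD) (use assms in simp_all)
qed

lemma entry_le_hs_norm: "i < n \<Longrightarrow> j < n \<Longrightarrow> cmod (A $$ (i,j)) \<le> hs_norm A"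
  unfolding hs_norm_def
  using member_le_L2_set[of "{..<n}\<times>{..<n}" "(i,j)" "\<lambda>x. cmod (A $$ x)"] by auto

lemma hs_norm_submult:
  assumes A: "A \<in> M" and B: "B \<in> M"
  shows "hs_norm (A * B) \<le> hs_norm A * hs_norm B"
proof -
  have entry_le: "(cmod ((A * B) $$ (i,j)))\<^sup>2
      \<le> (\<Sum>k<n. (cmod (A $$ (i,k)))\<^sup>2) * (\<Sum>k<n. (cmod (B $$ (k,j)))\<^sup>2)"
    if "i < n" "j < n" for i j
  proof -
    let ?a = "\<lambda>k. cmod (A $$ (i,k))" and ?b = "\<lambda>k. cmod (B $$ (k,j))"
    have "cmod ((A * B) $$ (i,j)) \<le> (\<Sum>k<n. \<bar>?a k\<bar> * \<bar>?b k\<bar>)"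
      using A B that by (auto simp: index_mult norm_mult intro!: sum_norm_le)
    also have "\<dots> \<le> L2_set ?a {..<n} * L2_set ?b {..<n}"
      by (rule L2_set_mult_ineq)
    finally have "(cmod ((A * B) $$ (i,j)))\<^sup>2 \<le> (L2_set ?a {..<n} * L2_set ?b {..<n})\<^sup>2"
      by (intro power_mono) auto
    then show ?thesis by (simp add: power_mult_distrib L2_set_def sum_nonneg)
  qed
  have "(hs_norm (A * B))\<^sup>2
      \<le> (\<Sum>i<n. \<Sum>j<n. (\<Sum>k<n. (cmod (A $$ (i,k)))\<^sup>2) * (\<Sum>k<n. (cmod (B $$ (k,j)))\<^sup>2))"
    unfolding hs_norm_square by (intro sum_mono entry_le) auto
  also have "\<dots> = (\<Sum>i<n. \<Sum>k<n. (cmod (A $$ (i,k)))\<^sup>2) * (\<Sum>j<n. \<Sum>k<n. (cmod (B $$ (k,j)))\<^sup>2)"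
    by (simp add: sum_product)
  also have "(\<Sum>j<n. \<Sum>k<n. (cmod (B $$ (k,j)))\<^sup>2) = (hs_norm B)\<^sup>2"
    unfolding hs_norm_square by (rule sum.swap)
  finally have "(hs_norm (A * B))\<^sup>2 \<le> (hs_norm A * hs_norm B)\<^sup>2"
    by (simp add: hs_norm_square[of A, symmetric] power_mult_distrib)
  then show ?thesis by (simp add: power2_le_iff_abs_le)
qed

subsection \<open>Positivity through traces\<close>

definition hermitian :: "complex mat \<Rightarrow> bool" where "hermitian A \<longleftrightarrow> A \<in> M \<and> adj A = A"

lemma hermitianD: "hermitian A \<Longrightarrow> A \<in> M" "hermitian A \<Longrightarrow> adj A = A" by (auto simp: hermitian_def)

lemma cinner_col_eq_index:
  assumes "A \<in> M" "S \<in> M" "T \<in> M" "k < n"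
  shows "cinner (col S k) (A *\<^sub>v col T k) = (adj S * A * T) $$ (k,k)"
proof -
  have "cinner (col S k) (A *\<^sub>v col T k)
      = (\<Sum>i<n. cnj (S $$ (i,k)) * (\<Sum>j<n. A $$ (i,j) * T $$ (j,k)))"
    using assms by (auto simp: cinner_def scalar_prod_def atLeast0LessThan intro!: sum.cong)
  also have "\<dots> = (adj S * (A * T)) $$ (k,k)"
    using assms by (simp add: index_mult index_adj)
  finally show ?thesis using assms by (simp add: M_assoc)
qed

lemma tr_sandwich_eq_sum_cinner:
  assumes "A \<in> M" "S \<in> M" "T \<in> M"
  shows "tr (adj S * A * T) = (\<Sum>k<n. cinner (col S k) (A *\<^sub>v col T k))"
  using assms by (subst tr_sum) (auto simp: cinner_col_eq_index)

definition first_column :: "complex vec \<Rightarrow> complex mat" where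
  "first_column v = mat n n (\<lambda>(i,j). if j = 0 then v $ i else 0)"

lemma first_column_closed [simp]: "first_column v \<in> M"
  by (simp add: first_column_def)

lemma col_first_column:
  "v \<in> carrier_vec n \<Longrightarrow> k < n \<Longrightarrow> col (first_column v) k = (if k = 0 then v else 0\<^sub>v n)"
  by (auto simp: first_column_def)

lemma first_column_eq_0D:
  assumes v: "v \<in> carrier_vec n" and zero: "first_column v = 0\<^sub>m n n" shows "v = 0\<^sub>v n"
proof (rule eq_vecI)
  fix i assume "i < dim_vec (0\<^sub>v n :: complex vec)"
  then have "i < n" "first_column v $$ (i,0) = 0\<^sub>m n n $$ (i,0)" by (simp_all add: zero)
  then show "v $ i = 0\<^sub>v n $ i" by (simp add: first_column_def)
qed (use v in simp)

lemma cinner_eq_tr_conjugation: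
  assumes A: "A \<in> M" and v: "v \<in> carrier_vec n"
  shows "cinner v (A *\<^sub>v v) = tr (adj (first_column v) * A * first_column v)"
proof -
  have "tr (adj (first_column v) * A * first_column v)
      = (\<Sum>k<n. if k = 0 then cinner v (A *\<^sub>v v) else 0)"
    unfolding tr_sandwich_eq_sum_cinner[OF A first_column_closed first_column_closed]
    by (intro sum.cong refl) (auto simp: col_first_column[OF v] cinner_def)
  then show ?thesis using v by (cases "n = 0") (auto simp: cinner_def)
qed

lemma Im_tr_conjugation_hermitian:
  assumes "hermitian A" "S \<in> M" shows "Im (tr (adj S * A * S)) = 0"
proof -
  have "cnj (tr (adj S * A * S)) = tr (adj S * A * S)"
    using assms by (subst tr_adj[symmetric]) (auto simp: adj_mult M_assoc hermitianD)
  then show ?thesis by (auto simp: complex_eq_iff)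
qed

lemma psd_iff_tr: "psd n A \<longleftrightarrow> hermitian A \<and> (\<forall>S\<in>M. 0 \<le> Re (tr (adj S * A * S)))"
proof
  assume "psd n A"
  then show "hermitian A \<and> (\<forall>S\<in>M. 0 \<le> Re (tr (adj S * A * S)))"
    by (auto simp: psd_def hermitian_def tr_sandwich_eq_sum_cinner intro!: sum_nonneg)
next
  assume nonneg: "hermitian A \<and> (\<forall>S\<in>M. 0 \<le> Re (tr (adj S * A * S)))"
  have "Im (cinner v (A *\<^sub>v v)) = 0 \<and> 0 \<le> Re (cinner v (A *\<^sub>v v))" if "v \<in> carrier_vec n" for v
    using nonneg that cinner_eq_tr_conjugation[of A v] Im_tr_conjugation_hermitian
    by (auto simp: hermitianD)
  then show "psd n A" using nonneg by (auto simp: psd_def hermitianD)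
qed

lemma psdD: "psd n A \<Longrightarrow> A \<in> M" "psd n A \<Longrightarrow> adj A = A" "psd n A \<Longrightarrow> hermitian A"
  "psd n A \<Longrightarrow> S \<in> M \<Longrightarrow> 0 \<le> Re (tr (adj S * A * S))"
  unfolding psd_iff_tr by (auto simp: hermitianD)

lemma pdD: "pd n A \<Longrightarrow> psd n A" by (simp add: pd_def)

lemma pd_tr_conjugation_pos:
  assumes A: "pd n A" and S: "S \<in> M" "S \<noteq> 0\<^sub>m n n"
  shows "0 < Re (tr (adj S * A * S))"
proof -
  note psd = pdD[OF A]
  obtain i k where entry: "i < n" "k < n" "S $$ (i,k) \<noteq> 0"
    using S M_eqI[of S "0\<^sub>m n n"] by auto
  then have "col S k \<noteq> 0\<^sub>v n" using S
    by (metis carrier_matD(1) carrier_matD(2) index_col index_zero_vec(1))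
  then have "0 < Re (cinner (col S k) (A *\<^sub>v col S k))"
    using A col_carrier_vec[OF entry(2) S(1)] unfolding pd_def by blast
  moreover have "0 \<le> Re (cinner (col S j) (A *\<^sub>v col S j))" if "j < n" for j
    using psd col_carrier_vec[OF that S(1)] unfolding psd_def by blast
  ultimately show ?thesis using S entry psd
    by (auto simp: tr_sandwich_eq_sum_cinner psdD intro!: sum_pos2[of _ k])
qed

lemma pd_iff_tr: "pd n A \<longleftrightarrow> hermitian A \<and> (\<forall>S\<in>M. S \<noteq> 0\<^sub>m n n \<longrightarrow> 0 < Re (tr (adj S * A * S)))"
proof
  assume "pd n A"
  then show "hermitian A \<and> (\<forall>S\<in>M. S \<noteq> 0\<^sub>m n n \<longrightarrow> 0 < Re (tr (adj S * A * S)))"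
    using pd_tr_conjugation_pos by (auto simp: pdD psdD)
next
  assume pos: "hermitian A \<and> (\<forall>S\<in>M. S \<noteq> 0\<^sub>m n n \<longrightarrow> 0 < Re (tr (adj S * A * S)))"
  have "0 \<le> Re (tr (adj S * A * S))" if "S \<in> M" for S
  proof (cases "S = 0\<^sub>m n n")
    case True
    then show ?thesis using hermitianD(1)[of A] pos by simp
  next
    case False
    then show ?thesis using pos that by force
  qed
  then have "psd n A" using pos by (auto simp: psd_iff_tr)
  moreover have "0 < Re (cinner v (A *\<^sub>v v))" if v: "v \<in> carrier_vec n" "v \<noteq> 0\<^sub>v n" for v
    using pos v first_column_eq_0D[of v] first_column_closed[of v]
    by (metis cinner_eq_tr_conjugation hermitianD(1))
  ultimately show "pd n A" by (auto simp: pd_def)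
qed

lemma psd_conjugation: assumes "psd n A" "B \<in> M" shows "psd n (adj B * A * B)"
  unfolding psd_iff_tr
proof (intro conjI ballI)
  show "hermitian (adj B * A * B)" using assms by (auto simp: hermitian_def psdD adj_mult M_assoc)
next
  fix S assume S: "S \<in> M"
  then have "adj S * (adj B * A * B) * S = adj (B * S) * A * (B * S)"
    using assms by (simp add: psdD adj_mult M_assoc)
  then show "0 \<le> Re (tr (adj S * (adj B * A * B) * S))"
    using psdD(4)[OF assms(1), of "B * S"] assms S by auto
qed

lemma psd_one: "psd n (1\<^sub>m n)"
  unfolding psd_iff_tr by (auto simp: hermitian_def tr_gram)

lemma psd_gram: "B \<in> M \<Longrightarrow> psd n (adj B * B)"
  using psd_conjugation[OF psd_one, of B] by simp

lemma pd_one: "pd n (1\<^sub>m n)"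
  unfolding pd_iff_tr
proof (intro conjI ballI impI)
  show "hermitian (1\<^sub>m n)" by (simp add: hermitian_def)
  fix S assume "S \<in> M" "S \<noteq> 0\<^sub>m n n"
  then show "0 < Re (tr (adj S * 1\<^sub>m n * S))"
    using hs_norm_eq_0[of S] by (auto simp: tr_gram simp flip: of_real_power)
qed

lemma pd_conjugation:
  assumes A: "pd n A" and B: "B \<in> M" and C: "C \<in> M" "C * B = 1\<^sub>m n" shows "pd n (adj B * A * B)"
  unfolding pd_iff_tr
proof (intro conjI ballI impI)
  note A_hermitian = psdD(1,2)[OF pdD[OF A]]
  show "hermitian (adj B * A * B)" using psd_conjugation[OF pdD[OF A] B] psdD(3) by blast
  fix S assume S: "S \<in> M" "S \<noteq> 0\<^sub>m n n"
  have "B * S \<noteq> 0\<^sub>m n n"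
  proof
    assume "B * S = 0\<^sub>m n n"
    then have "C * B * S = 0\<^sub>m n n" using B C(1) S by (simp add: M_assoc)
    then show False using C S by simp
  qed
  then have "0 < Re (tr (adj (B * S) * A * (B * S)))" using A B S unfolding pd_iff_tr by auto
  then show "0 < Re (tr (adj S * (adj B * A * B) * S))"
    using A_hermitian B S by (simp add: adj_mult M_assoc)
qed

end

section \<open>The spectral theorem\<close>

lemma cnj_mult_cmod:
  "cnj z * z = (complex_of_real (cmod z))\<^sup>2" "z * cnj z = (complex_of_real (cmod z))\<^sup>2"
  using complex_norm_square[of z] by (simp_all add: mult.commute)

lemma complex_affine_nonneg_imp_zero:
  fixes b :: complex
  assumes "\<And>c. 0 \<le> a + 2 * Re (c * b)"
  shows "b = 0"
proof (rule ccontr)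
  assume "b \<noteq> 0"
  define t where "t = (a + 1) / (2 * (cmod b)\<^sup>2)"
  have "(- complex_of_real t * cnj b) * b = complex_of_real (- t * (cmod b)\<^sup>2)"
    by (simp add: mult.assoc cnj_mult_cmod)
  then have "Re ((- complex_of_real t * cnj b) * b) = - t * (cmod b)\<^sup>2"
    by (simp only: Re_complex_of_real)
  also have "\<dots> = - (a + 1) / 2" using \<open>b \<noteq> 0\<close> by (simp add: t_def field_simps)
  finally show False using assms[of "- complex_of_real t * cnj b"] by simp
qed

context square_matrices
begin

subsection \<open>Unitarily diagonal matrices\<close>

lemma unitaryD:
  "unitary n U \<Longrightarrow> U \<in> M" "unitary n U \<Longrightarrow> adj U * U = 1\<^sub>m n" "unitary n U \<Longrightarrow> U * adj U = 1\<^sub>m n"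
  using mat_mult_left_right_inverse[of "adj U" n U] by (auto simp: unitary_def)

definition unitary_diag :: "complex mat \<Rightarrow> (nat \<Rightarrow> complex) \<Rightarrow> complex mat" where
  "unitary_diag U d = U * mat_diag n d * adj U"

lemma unitary_diag_closed [simp]: "U \<in> M \<Longrightarrow> unitary_diag U d \<in> M"
  by (simp add: unitary_diag_def)

lemma index_mat_diag: "i < n \<Longrightarrow> j < n \<Longrightarrow> mat_diag n d $$ (i,j) = (if i = j then d i else 0)"
  by (auto simp: mat_diag_def)

lemma index_mat_diag_mult: "A \<in> M \<Longrightarrow> i < n \<Longrightarrow> j < n \<Longrightarrow> (mat_diag n d * A) $$ (i,j) = d i * A $$ (i,j)"
  by (simp add: index_mult index_mat_diag if_distrib[of "\<lambda>x. x * _"] sum.delta' cong: if_cong)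

lemma index_mult_mat_diag: "A \<in> M \<Longrightarrow> i < n \<Longrightarrow> j < n \<Longrightarrow> (A * mat_diag n d) $$ (i,j) = A $$ (i,j) * d j"
  by (simp add: index_mult index_mat_diag if_distrib[of "\<lambda>x. _ * x"] sum.delta cong: if_cong)

lemma index_unitary_diag:
  "U \<in> M \<Longrightarrow> i < n \<Longrightarrow> j < n \<Longrightarrow> unitary_diag U d $$ (i,j) = (\<Sum>k<n. U $$ (i,k) * d k * cnj (U $$ (j,k)))"
  unfolding unitary_diag_def by (subst index_mult) (auto simp: index_mult_mat_diag index_adj)

lemma smult_smult_M [simp]: "A \<in> M \<Longrightarrow> c \<cdot>\<^sub>m (d \<cdot>\<^sub>m A) = (c * d) \<cdot>\<^sub>m A"
  by (rule M_eqI) (simp_all add: index_smult)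

lemma diag_mult: "mat_diag n d * mat_diag n e = mat_diag n (\<lambda>i. d i * e i)"
  by simp

lemma unitary_diag_mult:
  assumes "unitary n U" shows "unitary_diag U d * unitary_diag U e = unitary_diag U (\<lambda>i. d i * e i)"
proof -
  note U = unitaryD[OF assms]
  have "unitary_diag U d * unitary_diag U e
      = U * (mat_diag n d * ((adj U * U) * (mat_diag n e * adj U)))"
    using U(1) by (simp add: unitary_diag_def M_assoc)
  also have "\<dots> = U * ((mat_diag n d * mat_diag n e) * adj U)"
    using U(1) by (simp add: U(2) M_assoc del: mat_diag_diag)
  finally show ?thesis using U(1) by (simp add: unitary_diag_def diag_mult M_assoc)
qed

lemma unitary_diag_add:
  "U \<in> M \<Longrightarrow> unitary_diag U d + unitary_diag U e = unitary_diag U (\<lambda>i. d i + e i)"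
  by (rule M_eqI) (simp_all add: index_unitary_diag index_add sum.distrib algebra_simps)

lemma unitary_diag_smult: "U \<in> M \<Longrightarrow> c \<cdot>\<^sub>m unitary_diag U d = unitary_diag U (\<lambda>i. c * d i)"
  by (rule M_eqI) (simp_all add: index_unitary_diag index_smult sum_distrib_left algebra_simps)

lemma unitary_diag_adj: "U \<in> M \<Longrightarrow> adj (unitary_diag U d) = unitary_diag U (\<lambda>i. cnj (d i))"
  by (rule M_eqI) (simp_all add: index_unitary_diag index_adj mult.commute mult.left_commute)

lemma unitary_diag_one:
  assumes U: "unitary n U" shows "unitary_diag U (\<lambda>i. 1) = 1\<^sub>m n"
proof -
  have "mat_diag n (\<lambda>i. 1) = (1\<^sub>m n :: complex mat)" by simp
  then show ?thesis using unitaryD[OF U] by (simp add: unitary_diag_def)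
qed

lemma unitary_diag_cong: "U \<in> M \<Longrightarrow> (\<And>i. i < n \<Longrightarrow> d i = e i) \<Longrightarrow> unitary_diag U d = unitary_diag U e"
  by (rule M_eqI) (simp_all add: index_unitary_diag)

subsection \<open>Normal matrices\<close>

lemma mult_mat_vec_closed [simp]: "A \<in> M \<Longrightarrow> v \<in> carrier_vec n \<Longrightarrow> A *\<^sub>v v \<in> carrier_vec n"
  by (rule mult_mat_vec_carrier)

lemma mult_mat_vec_index:
  "A \<in> M \<Longrightarrow> v \<in> carrier_vec n \<Longrightarrow> i < n \<Longrightarrow> (A *\<^sub>v v) $ i = (\<Sum>j<n. A $$ (i,j) * v $ j)"
  by (auto simp: scalar_prod_def atLeast0LessThan)

lemma cinner_eq_sum: "v \<in> carrier_vec n \<Longrightarrow> cinner v w = (\<Sum>i<n. cnj (v $ i) * w $ i)"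
  by (auto simp: cinner_def)

lemma cinner_add_right:
  "v \<in> carrier_vec n \<Longrightarrow> w \<in> carrier_vec n \<Longrightarrow> x \<in> carrier_vec n \<Longrightarrow>
    cinner v (w + x) = cinner v w + cinner v x"
  by (auto simp: cinner_def sum.distrib distrib_left)

lemma cinner_smult_right:
  "v \<in> carrier_vec n \<Longrightarrow> w \<in> carrier_vec n \<Longrightarrow> cinner v (c \<cdot>\<^sub>v w) = c * cinner v w"
  by (auto simp: cinner_def sum_distrib_left intro!: sum.cong)

lemma cinner_cnj: "v \<in> carrier_vec n \<Longrightarrow> w \<in> carrier_vec n \<Longrightarrow> cinner w v = cnj (cinner v w)"
  by (auto simp: cinner_def mult.commute)

lemma cinner_add_left:
  "v \<in> carrier_vec n \<Longrightarrow> w \<in> carrier_vec n \<Longrightarrow> x \<in> carrier_vec n \<Longrightarrow>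
    cinner (v + w) x = cinner v x + cinner w x"
  by (auto simp: cinner_def sum.distrib distrib_right)

lemma cinner_smult_left:
  "v \<in> carrier_vec n \<Longrightarrow> w \<in> carrier_vec n \<Longrightarrow> cinner (c \<cdot>\<^sub>v v) w = cnj c * cinner v w"
  by (auto simp: cinner_def sum_distrib_left intro!: sum.cong)

lemma cinner_self: "cinner v v = of_real ((vnorm v)\<^sup>2)"
  by (simp add: cinner_def vnorm_def cnj_mult_cmod sum_nonneg)

lemma vnorm_nonneg [simp]: "0 \<le> vnorm v"
  by (simp add: vnorm_def sum_nonneg)

lemma vnorm_eq_0_iff: "v \<in> carrier_vec n \<Longrightarrow> vnorm v = 0 \<longleftrightarrow> v = 0\<^sub>v n"
  by (auto simp: vnorm_def sum_nonneg_eq_0_iff intro!: eq_vecI)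

lemma cinner_mult_mat_vec:
  assumes "A \<in> M" "v \<in> carrier_vec n" "w \<in> carrier_vec n"
  shows "cinner v (A *\<^sub>v w) = cinner (adj A *\<^sub>v v) w"
proof -
  have "cinner v (A *\<^sub>v w) = (\<Sum>i<n. \<Sum>j<n. cnj (v $ i) * A $$ (i,j) * w $ j)"
    using assms
    by (simp add: cinner_eq_sum mult_mat_vec_index sum_distrib_left mult.assoc
        del: index_mult_mat_vec)
  also have "\<dots> = (\<Sum>j<n. \<Sum>i<n. cnj (v $ i) * A $$ (i,j) * w $ j)"
    by (rule sum.swap)
  also have "\<dots> = cinner (adj A *\<^sub>v v) w"
    using assms
    by (simp add: cinner_eq_sum mult_mat_vec_index index_adj sum_distrib_left mult.commute
        mult.left_commute del: index_mult_mat_vec)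
  finally show ?thesis .
qed

definition normal_mat :: "complex mat \<Rightarrow> bool" where
  "normal_mat C \<longleftrightarrow> C \<in> M \<and> adj C * C = C * adj C"

lemma normal_mat_eigenvector_adj:
  assumes C: "normal_mat C" and g: "g \<in> carrier_vec n" and eig: "C *\<^sub>v g = \<mu> \<cdot>\<^sub>v g"
  shows "adj C *\<^sub>v g = cnj \<mu> \<cdot>\<^sub>v g"
proof -
  have CM: "C \<in> M" using C by (simp add: normal_mat_def)
  define h where "h = adj C *\<^sub>v g"
  have h: "h \<in> carrier_vec n" using CM g by (simp add: h_def)
  have cinner_hg: "cinner h g = \<mu> * cinner g g"
    using cinner_mult_mat_vec[OF CM g g] g by (simp add: eig h_def cinner_smult_right)
  have cinner_hh: "cinner h h = cnj \<mu> * \<mu> * cinner g g"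
  proof -
    have "cinner h h = cinner g ((C * adj C) *\<^sub>v g)"
      using cinner_mult_mat_vec[OF CM g h] CM g
      by (simp add: h_def assoc_mult_mat_vec[of _ n n _ n])
    also have "\<dots> = cinner g (adj C *\<^sub>v (C *\<^sub>v g))"
      using C CM g by (metis normal_mat_def M_closed(5) assoc_mult_mat_vec)
    also have "\<dots> = cinner (C *\<^sub>v g) (C *\<^sub>v g)"
      using cinner_mult_mat_vec[of "adj C" g "C *\<^sub>v g"] CM g by (simp add: eig)
    finally show ?thesis using g by (simp add: eig cinner_smult_left cinner_smult_right)
  qed
  define w where "w = h + (- cnj \<mu>) \<cdot>\<^sub>v g"
  have w: "w \<in> carrier_vec n" using g h by (simp add: w_def)
  have "cinner w w = 0"
    using g h cinner_hg cinner_hh cinner_cnj[OF h g] cinner_cnj[OF g g]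
    by (simp add: w_def cinner_add_left cinner_add_right cinner_smult_left cinner_smult_right
        algebra_simps)
  then have "w = 0\<^sub>v n" using w by (simp add: cinner_self vnorm_eq_0_iff)
  then have "w $ i = 0" if "i < n" for i using that by simp
  then have "h $ i = cnj \<mu> * g $ i" if "i < n" for i using that g h by (simp add: w_def)
  then show ?thesis using g h by (auto simp: h_def[symmetric] intro!: eq_vecI)
qed

lemma exists_eigenvalue_neq:
  assumes C: "C \<in> M" and tr: "tr C \<noteq> of_nat n * c"
  obtains \<mu> g where "\<mu> \<noteq> c" "g \<in> carrier_vec n" "g \<noteq> 0\<^sub>v n" "C *\<^sub>v g = \<mu> \<cdot>\<^sub>v g"
proof -
  obtain B where B: "B \<in> M" "upper_triangular B" and similar: "similar_mat C B"
    using char_poly_factorized[OF C] schur_decomposition_exists[OF C] by blast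
  then obtain S T where "similar_mat_wit C B S T" by (auto simp: similar_mat_def)
  note ST = similar_mat_witD2[OF C this]
  have "tr C = tr (T * (S * B))"
    unfolding ST(3) using ST(5-7) by (intro tr_mult_commute) simp_all
  also have "T * (S * B) = B"
    using M_assoc[OF ST(7,6) B(1)] ST(2) B(1) by simp
  also have "tr B = (\<Sum>i<n. B $$ (i,i))" by (rule tr_sum[OF B(1)])
  finally have "(\<Sum>i<n. B $$ (i,i)) \<noteq> (\<Sum>i<n. c)" using tr by simp
  then obtain i where i: "i < n" "B $$ (i,i) \<noteq> c"
    by (metis (no_types, lifting) lessThan_iff sum.cong)
  have "char_poly C = (\<Prod>a\<leftarrow>diag_mat B. [:- a, 1:])"
    using char_poly_similar[OF similar] char_poly_upper_triangular[OF B] by simp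
  moreover have "B $$ (i,i) \<in> set (diag_mat B)" using i B by (auto simp: diag_mat_def)
  ultimately have "poly (char_poly C) (B $$ (i,i)) = 0"
    by (force simp: poly_prod_list prod_list_zero_iff)
  then obtain g where "eigenvector C g (B $$ (i,i))"
    using eigenvalue_root_char_poly[OF C] by (auto simp: eigenvalue_def)
  then show ?thesis using that i(2) C by (auto simp: eigenvector_def)
qed

definition orthonormal :: "nat \<Rightarrow> (nat \<Rightarrow> complex vec) \<Rightarrow> bool" where
  "orthonormal m v \<longleftrightarrow> (\<forall>k<m. v k \<in> carrier_vec n) \<and>
     (\<forall>k<m. \<forall>j<m. cinner (v k) (v j) = (if k = j then 1 else 0))"

definition dyad_sum :: "nat \<Rightarrow> (nat \<Rightarrow> complex) \<Rightarrow> (nat \<Rightarrow> complex vec) \<Rightarrow> complex mat" where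
  "dyad_sum m a v = mat n n (\<lambda>(i,j). \<Sum>k<m. a k * v k $ i * cnj (v k $ j))"

lemma dyad_sum_closed [simp]: "dyad_sum m a v \<in> M"
  by (simp add: dyad_sum_def)

lemma orthonormal_carrier: "orthonormal m v \<Longrightarrow> k < m \<Longrightarrow> v k \<in> carrier_vec n"
  by (simp add: orthonormal_def)

lemma tr_dyad_sum:
  assumes v: "orthonormal m v" shows "tr (dyad_sum m a v) = (\<Sum>k<m. a k)"
proof -
  have "tr (dyad_sum m a v) = (\<Sum>k<m. \<Sum>i<n. a k * (cnj (v k $ i) * v k $ i))"
    unfolding tr_sum[OF dyad_sum_closed] by (subst sum.swap) (simp add: dyad_sum_def mult_ac)
  also have "\<dots> = (\<Sum>k<m. a k * cinner (v k) (v k))"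
    by (simp add: cinner_eq_sum[OF orthonormal_carrier[OF v]] sum_distrib_left)
  also have "\<dots> = (\<Sum>k<m. a k)" using v by (simp add: orthonormal_def)
  finally show ?thesis .
qed

lemma dyad_sum_mult_vec_index:
  assumes v: "orthonormal m v" and g: "g \<in> carrier_vec n" and i: "i < n"
  shows "(dyad_sum m a v *\<^sub>v g) $ i = (\<Sum>k<m. a k * cinner (v k) g * v k $ i)"
proof -
  have "(dyad_sum m a v *\<^sub>v g) $ i = (\<Sum>j<n. \<Sum>k<m. a k * v k $ i * cnj (v k $ j) * g $ j)"
    using i mult_mat_vec_index[OF dyad_sum_closed g i, of m a v]
    by (simp add: dyad_sum_def sum_distrib_right)
  also have "\<dots> = (\<Sum>k<m. \<Sum>j<n. a k * v k $ i * cnj (v k $ j) * g $ j)" by (rule sum.swap)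
  finally show ?thesis
    by (simp add: cinner_eq_sum[OF orthonormal_carrier[OF v]] sum_distrib_left sum_distrib_right
        mult_ac)
qed

lemma cinner_dyad_sum:
  assumes v: "orthonormal m v" and k: "k < m" and g: "g \<in> carrier_vec n"
  shows "cinner (v k) (dyad_sum m a v *\<^sub>v g) = a k * cinner (v k) g"
proof -
  note vk = orthonormal_carrier[OF v k]
  have "cinner (v k) (dyad_sum m a v *\<^sub>v g)
      = (\<Sum>i<n. \<Sum>j<m. a j * cinner (v j) g * (cnj (v k $ i) * v j $ i))"
    using vk by (simp add: cinner_eq_sum dyad_sum_mult_vec_index[OF v g] sum_distrib_left mult_ac
        del: index_mult_mat_vec)
  also have "\<dots> = (\<Sum>j<m. a j * cinner (v j) g * cinner (v k) (v j))"
    using vk by (subst sum.swap) (simp add: cinner_eq_sum sum_distrib_left)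
  also have "\<dots> = (\<Sum>j<m. if j = k then a k * cinner (v k) g else 0)"
    by (intro sum.cong refl) (use v k in \<open>auto simp: orthonormal_def\<close>)
  finally show ?thesis using k by simp
qed

(* Replacing the eigenvalue of every v k by c yields a matrix whose trace is not n c, hence which
   has an eigenvalue other than c; its eigenvectors are orthogonal to all v k. *)
lemma normal_mat_orthogonal_eigenvector:
  assumes C: "normal_mat C" and m: "m < n" and v: "orthonormal m v"
    and eig: "\<And>k. k < m \<Longrightarrow> C *\<^sub>v v k = l k \<cdot>\<^sub>v v k"
  obtains \<mu> g where "g \<in> carrier_vec n" "g \<noteq> 0\<^sub>v n" "C *\<^sub>v g = \<mu> \<cdot>\<^sub>v g"
    "\<And>k. k < m \<Longrightarrow> cinner (v k) g = 0"
proof -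
  have CM: "C \<in> M" using C by (simp add: normal_mat_def)
  define c where "c = (tr C - (\<Sum>k<m. l k)) / of_nat (n - m) + 1"
  define D where "D = dyad_sum m (\<lambda>k. c - l k) v"
  have D: "D \<in> M" by (simp add: D_def)
  have "tr (C + D) - of_nat n * c = (tr C - (\<Sum>k<m. l k)) - of_nat (n - m) * c"
    using m by (simp add: D_def tr_add[OF CM dyad_sum_closed] tr_dyad_sum[OF v] sum_subtractf
        of_nat_diff algebra_simps)
  also have "\<dots> = - of_nat (n - m)" using m by (simp add: c_def field_simps)
  finally have "tr (C + D) \<noteq> of_nat n * c" using m by auto
  then obtain \<mu> g where \<mu>: "\<mu> \<noteq> c" and g: "g \<in> carrier_vec n" "g \<noteq> 0\<^sub>v n"
    and eigenvector: "(C + D) *\<^sub>v g = \<mu> \<cdot>\<^sub>v g"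
    using exists_eigenvalue_neq[of "C + D" c] CM D by auto
  have orthogonal: "cinner (v k) g = 0" if k: "k < m" for k
  proof -
    note vk = orthonormal_carrier[OF v k]
    have "cinner (v k) (D *\<^sub>v g) = (c - l k) * cinner (v k) g"
      unfolding D_def by (rule cinner_dyad_sum[OF v k g(1)])
    moreover have "cinner (v k) (C *\<^sub>v g) = l k * cinner (v k) g"
      using cinner_mult_mat_vec[OF CM vk g(1)] normal_mat_eigenvector_adj[OF C vk eig[OF k]] vk g(1)
      by (simp add: cinner_smult_left)
    moreover have "cinner (v k) (C *\<^sub>v g) + cinner (v k) (D *\<^sub>v g) = \<mu> * cinner (v k) g"
      using eigenvector CM D g(1) vk
      by (metis add_mult_distrib_mat_vec cinner_add_right cinner_smult_right mult_mat_vec_closed)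
    ultimately have "(c - \<mu>) * cinner (v k) g = 0" by (simp add: algebra_simps)
    then show ?thesis using \<mu> by simp
  qed
  have "D *\<^sub>v g = 0\<^sub>v n"
    using carrier_matD(1)[OF D] g(1) unfolding D_def
    by (intro eq_vecI) (auto simp: dyad_sum_mult_vec_index[OF v] orthogonal
        simp del: index_mult_mat_vec(1))
  then have "C *\<^sub>v g = \<mu> \<cdot>\<^sub>v g"
    using eigenvector CM D g(1) by (simp add: add_mult_distrib_mat_vec)
  then show ?thesis using that g orthogonal by blast
qed

lemma normal_mat_orthonormal_eigenvectors:
  assumes C: "normal_mat C" and "m \<le> n"
  shows "\<exists>v l. orthonormal m v \<and> (\<forall>k<m. C *\<^sub>v v k = l k \<cdot>\<^sub>v v k)"
  using assms(2)
proof (induction m)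
  case 0
  show ?case by (simp add: orthonormal_def)
next
  case (Suc m)
  then obtain v l where v: "orthonormal m v" and eig: "\<And>k. k < m \<Longrightarrow> C *\<^sub>v v k = l k \<cdot>\<^sub>v v k"
    by force
  have CM: "C \<in> M" using C by (simp add: normal_mat_def)
  note v_carrier = orthonormal_carrier[OF v]
  obtain g \<mu> where g: "g \<in> carrier_vec n" "g \<noteq> 0\<^sub>v n" "C *\<^sub>v g = \<mu> \<cdot>\<^sub>v g"
    "\<And>k. k < m \<Longrightarrow> cinner (v k) g = 0"
    using normal_mat_orthogonal_eigenvector[OF C _ v eig] Suc.prems by (metis Suc_le_lessD)
  define u where "u = complex_of_real (1 / vnorm g) \<cdot>\<^sub>v g"
  have u: "u \<in> carrier_vec n" using g(1) by (simp add: u_def)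
  have "C *\<^sub>v u = \<mu> \<cdot>\<^sub>v u"
    using CM g by (simp add: u_def mult_mat_vec smult_smult_assoc mult.commute)
  moreover have "cinner (v k) u = 0" "cinner u (v k) = 0" if "k < m" for k
    using g v_carrier[OF that] u that cinner_cnj[OF v_carrier[OF that] u]
    by (simp_all add: u_def cinner_smult_right)
  moreover have "cinner u u = 1"
    using g vnorm_eq_0_iff[OF g(1)] cinner_self[of g]
    by (simp add: u_def cinner_smult_left cinner_smult_right power2_eq_square)
  ultimately show ?case using v eig u
    by (intro exI[of _ "v(m := u)"] exI[of _ "l(m := \<mu>)"]) (auto simp: orthonormal_def less_Suc_eq)
qed

theorem normal_spectral_theorem:
  assumes C: "normal_mat C"
  obtains U d where "unitary n U" "C = unitary_diag U d"
proof -
  have CM: "C \<in> M" using C by (simp add: normal_mat_def)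
  obtain v d where v: "orthonormal n v" and eig: "\<And>k. k < n \<Longrightarrow> C *\<^sub>v v k = d k \<cdot>\<^sub>v v k"
    using normal_mat_orthonormal_eigenvectors[OF C order_refl] by blast
  note v_carrier = orthonormal_carrier[OF v]
  define U where "U = mat n n (\<lambda>(i,k). v k $ i)"
  have U: "U \<in> M" by (simp add: U_def)
  have index_U: "U $$ (i,j) = v j $ i" if "i < n" "j < n" for i j using that by (simp add: U_def)
  have "(adj U * U) $$ (i,j) = cinner (v i) (v j)" if "i < n" "j < n" for i j
    using that U v_carrier by (auto simp: index_mult index_adj index_U cinner_eq_sum)
  then have "adj U * U = 1\<^sub>m n"
    using U v by (intro M_eqI) (auto simp: orthonormal_def)
  then have unitary: "unitary n U" using U by (simp add: unitary_def)
  have "C * U = U * mat_diag n d"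
  proof (rule M_eqI)
    fix i j assume ij: "i < n" "j < n"
    have "(C * U) $$ (i,j) = (C *\<^sub>v v j) $ i"
      using ij CM U v_carrier by (simp add: index_mult index_U mult_mat_vec_index
          del: index_mult_mat_vec)
    also have "\<dots> = (U * mat_diag n d) $$ (i,j)"
      using ij U v_carrier[OF ij(2)] by (simp add: eig index_mult_mat_diag index_U)
    finally show "(C * U) $$ (i,j) = (U * mat_diag n d) $$ (i,j)" .
  qed (use CM U in auto)
  then have "unitary_diag U d = C * U * adj U" by (simp add: unitary_diag_def)
  also have "\<dots> = C" using unitaryD[OF unitary] CM by (simp add: M_assoc)
  finally show ?thesis using that unitary by metis
qed

corollary commuting_hermitian_spectral_theorem:
  assumes A: "hermitian A" and B: "hermitian B" and comm: "A * B = B * A"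
  obtains U a b where "unitary n U" "A = unitary_diag U (\<lambda>i. complex_of_real (a i))"
    "B = unitary_diag U (\<lambda>i. complex_of_real (b i))"
proof -
  note AB = hermitianD[OF A] hermitianD[OF B]
  define C where "C = A + \<i> \<cdot>\<^sub>m B"
  have CM: "C \<in> M" and adjC: "adj C = A - \<i> \<cdot>\<^sub>m B"
    using AB by (auto simp: C_def adj_add adj_smult intro!: M_eqI
        simp: index_add index_minus index_smult)
  have "normal_mat C"
    using AB comm CM unfolding normal_mat_def adjC unfolding C_def
    by (auto simp: M_distrib M_smult intro!: M_eqI
        simp: index_add index_minus index_smult algebra_simps)
  then obtain U d where U: "unitary n U" and C: "C = unitary_diag U d"
    by (rule normal_spectral_theorem)
  note UM = unitaryD(1)[OF U]
  have "A = (1/2) \<cdot>\<^sub>m (C + adj C)"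
    unfolding adjC unfolding C_def using AB
    by (intro M_eqI) (auto simp: index_add index_minus index_smult)
  also have "\<dots> = unitary_diag U (\<lambda>i. (1/2) * (d i + cnj (d i)))"
    unfolding C using UM by (simp add: unitary_diag_adj unitary_diag_add unitary_diag_smult)
  also have "\<dots> = unitary_diag U (\<lambda>i. complex_of_real (Re (d i)))"
    using UM by (intro unitary_diag_cong) (auto simp: complex_eq_iff)
  finally have A_diag: "A = unitary_diag U (\<lambda>i. complex_of_real (Re (d i)))" .
  have "B = (- \<i>/2) \<cdot>\<^sub>m (C + (- 1) \<cdot>\<^sub>m adj C)"
    unfolding adjC unfolding C_def using AB
    by (intro M_eqI) (auto simp: index_add index_minus index_smult algebra_simps)
  also have "\<dots> = unitary_diag U (\<lambda>i. (- \<i>/2) * (d i + (- 1) * cnj (d i)))"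
    unfolding C using UM by (simp only: unitary_diag_adj unitary_diag_add unitary_diag_smult)
  also have "\<dots> = unitary_diag U (\<lambda>i. complex_of_real (Im (d i)))"
    using UM by (intro unitary_diag_cong) (auto simp: complex_eq_iff)
  finally show ?thesis by (rule that[OF U A_diag])
qed

end

section \<open>Functional calculus\<close>

lemma function_algebra_interpolation:
  fixes F :: "('a \<Rightarrow> 'b::field) set" and f :: "'a \<Rightarrow> 'b"
  assumes const: "\<And>c. (\<lambda>x. c) \<in> F"
    and add: "\<And>q r. q \<in> F \<Longrightarrow> r \<in> F \<Longrightarrow> (\<lambda>x. q x + r x) \<in> F"
    and mult: "\<And>q r. q \<in> F \<Longrightarrow> r \<in> F \<Longrightarrow> (\<lambda>x. q x * r x) \<in> F"
    and g: "g \<in> F" "inj_on g T" and T: "finite T"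
  shows "\<exists>q\<in>F. \<forall>x\<in>T. q x = f x"
  using T g(2)
proof (induction T rule: finite_induct)
  case empty
  show ?case using g(1) by auto
next
  case (insert y T)
  then obtain q where q: "q \<in> F" "\<forall>x\<in>T. q x = f x" by auto
  have linear: "(\<lambda>x. g x - g t) \<in> F" for t using add[OF g(1) const[of "- g t"]] by simp
  define r where "r x = (\<Prod>t\<in>T. g x - g t)" for x
  define c where "c = (f y - q y) / r y"
  have "r \<in> F"
    unfolding r_def using insert.hyps(1)
    by (induction T rule: finite_induct) (auto intro!: const mult linear)
  then have "(\<lambda>x. q x + c * r x) \<in> F" by (intro add mult const q(1))
  moreover have "r y \<noteq> 0" using insert.hyps insert.prems by (auto simp: r_def inj_on_def)
  moreover have "r x = 0" if "x \<in> T" for x using insert.hyps that by (auto simp: r_def)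
  ultimately show ?case using q insert.hyps
    by (intro bexI[of _ "\<lambda>x. q x + c * r x"]) (auto simp: c_def)
qed

context square_matrices
begin

lemma unitary_conjugation_cancel:
  assumes "unitary n U" "unitary n V" "A \<in> M" "B \<in> M" "adj U * A * V = adj U * B * V"
  shows "A = B"
proof -
  have cancel: "U * (adj U * X * V) * adj V = X" if "X \<in> M" for X
  proof -
    have "U * (adj U * X * V) * adj V = (U * adj U) * X * (V * adj V)"
      using that unitaryD(1)[OF assms(1)] unitaryD(1)[OF assms(2)] by (simp add: M_assoc)
    then show ?thesis using that by (simp add: unitaryD(3)[OF assms(1)] unitaryD(3)[OF assms(2)])
  qed
  show ?thesis using cancel[OF assms(3)] cancel[OF assms(4)] unfolding assms(5) by simp
qed

lemma unitary_diag_conjugation: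
  assumes U: "unitary n U" and V: "unitary n V" and X: "X \<in> M"
  shows "adj U * (unitary_diag U d * X) * V = mat_diag n d * (adj U * X * V)"
    and "adj U * (X * unitary_diag V d) * V = (adj U * X * V) * mat_diag n d"
proof -
  note unitary_U = unitaryD[OF U] and unitary_V = unitaryD[OF V]
  have "adj U * (unitary_diag U d * X) * V = (adj U * U) * (mat_diag n d * (adj U * X * V))"
    unfolding unitary_diag_def using unitary_U(1) unitary_V(1) X by (simp add: M_assoc)
  then show "adj U * (unitary_diag U d * X) * V = mat_diag n d * (adj U * X * V)"
    using unitary_U unitary_V X by simp
  have "adj U * (X * unitary_diag V d) * V = (adj U * X * V) * mat_diag n d * (adj V * V)"
    unfolding unitary_diag_def using unitary_U(1) unitary_V(1) X by (simp add: M_assoc)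
  then show "adj U * (X * unitary_diag V d) * V = (adj U * X * V) * mat_diag n d"
    using unitary_U unitary_V X by simp
qed

lemma unitary_diag_intertwine:
  assumes U: "unitary n U" and V: "unitary n V" and X: "X \<in> M"
    and intertwine: "unitary_diag U (\<lambda>i. complex_of_real (a i)) * X
        = X * unitary_diag V (\<lambda>i. complex_of_real (b i))"
  shows "unitary_diag U (\<lambda>i. f (a i)) * X = X * unitary_diag V (\<lambda>i. f (b i))"
proof (rule unitary_conjugation_cancel[OF U V])
  note conjugation = unitary_diag_conjugation[OF U V X]
  define Y where "Y = adj U * X * V"
  have Y: "Y \<in> M" using unitaryD(1)[OF U] unitaryD(1)[OF V] X by (simp add: Y_def)
  have diag_eq: "mat_diag n (\<lambda>i. complex_of_real (a i)) * Y
      = Y * mat_diag n (\<lambda>i. complex_of_real (b i))"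
    unfolding Y_def conjugation[symmetric] intertwine ..
  have "mat_diag n (\<lambda>i. f (a i)) * Y = Y * mat_diag n (\<lambda>i. f (b i))"
  proof (rule M_eqI)
    fix i j assume ij: "i < n" "j < n"
    have "complex_of_real (a i) * Y $$ (i,j) = Y $$ (i,j) * complex_of_real (b j)"
      using arg_cong[OF diag_eq, of "\<lambda>A. A $$ (i,j)"] ij Y
      by (simp only: index_mat_diag_mult index_mult_mat_diag)
    then have "Y $$ (i,j) = 0 \<or> a i = b j" by auto
    then show "(mat_diag n (\<lambda>i. f (a i)) * Y) $$ (i,j) = (Y * mat_diag n (\<lambda>i. f (b i))) $$ (i,j)"
      unfolding index_mat_diag_mult[OF Y ij] index_mult_mat_diag[OF Y ij] by auto
  qed (use Y in auto)
  then show "adj U * (unitary_diag U (\<lambda>i. f (a i)) * X) * V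
      = adj U * (X * unitary_diag V (\<lambda>i. f (b i))) * V"
    unfolding conjugation Y_def .
qed (use X unitaryD(1)[OF U] unitaryD(1)[OF V] in auto)

definition mcfun :: "(real \<Rightarrow> complex) \<Rightarrow> complex mat \<Rightarrow> complex mat" where
  "mcfun f A = (let p = (SOME p. spec_decomp A p) in unitary_diag (fst p) (\<lambda>i. f (snd p i)))"

lemma mfun_eq_mcfun: "A \<in> M \<Longrightarrow> mfun f A = mcfun (\<lambda>x. complex_of_real (f x)) A"
  by (simp add: mfun_def mcfun_def unitary_diag_def Let_def)

lemma mcfun_spectral:
  assumes "hermitian A"
  obtains U l where "unitary n U" "A = unitary_diag U (\<lambda>i. complex_of_real (l i))"
    "\<And>f. mcfun f A = unitary_diag U (\<lambda>i. f (l i))"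
proof -
  define p where "p = (SOME p. spec_decomp A p)"
  have "\<exists>p. spec_decomp A p"
    using commuting_hermitian_spectral_theorem[OF assms assms refl] hermitianD[OF assms]
    by (metis carrier_matD(1) fst_conv snd_conv spec_decomp_def unitary_diag_def)
  then have "spec_decomp A p" unfolding p_def by (rule someI_ex)
  then have "unitary n (fst p)" "A = unitary_diag (fst p) (\<lambda>i. complex_of_real (snd p i))"
    using hermitianD[OF assms] by (auto simp: spec_decomp_def unitary_diag_def)
  moreover have "mcfun f A = unitary_diag (fst p) (\<lambda>i. f (snd p i))" for f
    by (simp add: mcfun_def p_def Let_def)
  ultimately show ?thesis using that by blast
qed

lemma unitary_diag_herm: "unitary n U \<Longrightarrow> hermitian (unitary_diag U (\<lambda>i. complex_of_real (l i)))"
  by (simp add: hermitian_def unitary_diag_adj unitaryD)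

lemma mcfun_closed [simp]: "hermitian A \<Longrightarrow> mcfun f A \<in> M"
  by (metis mcfun_spectral unitary_diag_closed unitaryD(1))

lemma mcfun_intertwine:
  assumes "hermitian A" "hermitian B" "X \<in> M" "A * X = X * B"
  shows "mcfun f A * X = X * mcfun f B"
proof -
  obtain U l where U: "unitary n U" "A = unitary_diag U (\<lambda>i. complex_of_real (l i))"
    "\<And>f. mcfun f A = unitary_diag U (\<lambda>i. f (l i))"
    using mcfun_spectral[OF assms(1)] by metis
  obtain V m where V: "unitary n V" "B = unitary_diag V (\<lambda>i. complex_of_real (m i))"
    "\<And>f. mcfun f B = unitary_diag V (\<lambda>i. f (m i))"
    using mcfun_spectral[OF assms(2)] by metis
  show ?thesis using unitary_diag_intertwine[OF U(1) V(1) assms(3), of l m f] assms(4) U V by auto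
qed

lemma mcfun_unitary_diag:
  assumes U: "unitary n U"
  shows "mcfun f (unitary_diag U (\<lambda>i. complex_of_real (l i))) = unitary_diag U (\<lambda>i. f (l i))"
proof -
  let ?A = "unitary_diag U (\<lambda>i. complex_of_real (l i))"
  obtain V m where V: "unitary n V" "?A = unitary_diag V (\<lambda>i. complex_of_real (m i))"
    "\<And>f. mcfun f ?A = unitary_diag V (\<lambda>i. f (m i))"
    using mcfun_spectral[OF unitary_diag_herm[OF U, of l]] by metis
  have "unitary_diag U (\<lambda>i. f (l i)) * 1\<^sub>m n = 1\<^sub>m n * unitary_diag V (\<lambda>i. f (m i))"
    by (rule unitary_diag_intertwine[OF U V(1)]) (use U V in \<open>simp_all add: unitaryD\<close>)
  then show ?thesis using U V by (simp add: unitaryD)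
qed

lemma mcfun_mult: "hermitian A \<Longrightarrow> mcfun f A * mcfun g A = mcfun (\<lambda>x. f x * g x) A"
  by (rule mcfun_spectral[of A]) (simp_all add: unitary_diag_mult)

lemma mcfun_add: "hermitian A \<Longrightarrow> mcfun f A + mcfun g A = mcfun (\<lambda>x. f x + g x) A"
  by (rule mcfun_spectral[of A]) (simp_all add: unitary_diag_add unitaryD)

lemma mcfun_smult: "hermitian A \<Longrightarrow> c \<cdot>\<^sub>m mcfun f A = mcfun (\<lambda>x. c * f x) A"
  by (rule mcfun_spectral[of A]) (simp_all add: unitary_diag_smult unitaryD)

lemma mcfun_adj: "hermitian A \<Longrightarrow> adj (mcfun f A) = mcfun (\<lambda>x. cnj (f x)) A"
  by (rule mcfun_spectral[of A]) (simp_all add: unitary_diag_adj unitaryD)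

lemma mcfun_one: "hermitian A \<Longrightarrow> mcfun (\<lambda>x. 1) A = 1\<^sub>m n"
  by (rule mcfun_spectral[of A]) (simp_all add: unitary_diag_one)

lemma mcfun_id: "hermitian A \<Longrightarrow> mcfun complex_of_real A = A"
  by (rule mcfun_spectral[of A]) auto

lemma mcfun_cfun:
  "hermitian A \<Longrightarrow> mcfun f (mcfun (\<lambda>x. complex_of_real (g x)) A) = mcfun (\<lambda>x. f (g x)) A"
  by (rule mcfun_spectral[of A]) (simp_all add: mcfun_unitary_diag[where l = "\<lambda>i. g (_ i)"])

lemma mcfun_commute:
  assumes "hermitian A" "B \<in> M" "A * B = B * A" shows "mcfun f A * B = B * mcfun f A"
  using mcfun_intertwine[OF assms(1,1,2,3)] .

lemma unitary_diag_quadratic_form: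
  assumes U: "unitary n U" and k: "k < n"
  obtains S where "S \<in> M" "S \<noteq> 0\<^sub>m n n" "tr (adj S * unitary_diag U d * S) = d k"
proof
  note unitary = unitaryD[OF U]
  define E where "E = mat_diag n (\<lambda>i. if i = k then 1 else 0 :: complex)"
  have E: "E \<in> M" "E $$ (k,k) = 1" "adj E = E"
    using k by (auto simp: E_def index_mat_diag index_adj intro!: M_eqI)
  show S: "U * E \<in> M" using unitary E by simp
  have "adj U * (U * E) = E" using unitary E by (simp add: M_assoc[symmetric])
  then show "U * E \<noteq> 0\<^sub>m n n"
    using unitary E k by (metis M_closed(5) M_zero(2) index_zero_mat(1) zero_neq_one)
  have "adj (U * E) * unitary_diag U d * (U * E) = E * (adj U * U) * mat_diag n d * (adj U * U) * E"
    using unitary(1) E by (simp add: adj_mult M_assoc unitary_diag_def)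
  also have "\<dots> = mat_diag n (\<lambda>i. if i = k then d k else 0)"
    using E unitary by (simp add: E_def diag_mult if_distrib[of "\<lambda>x. x * _"] cong: if_cong)
  finally show "tr (adj (U * E) * unitary_diag U d * (U * E)) = d k"
    using k by (simp add: tr_sum index_mat_diag)
qed

lemma unitary_diag_psdD:
  assumes "unitary n U" "psd n (unitary_diag U (\<lambda>i. complex_of_real (l i)))" "i < n"
  shows "0 \<le> l i"
  using unitary_diag_quadratic_form[OF assms(1,3), of "\<lambda>i. complex_of_real (l i)"]
    psdD(4)[OF assms(2)]
  by (metis Re_complex_of_real)

lemma unitary_diag_pdD:
  assumes "unitary n U" "pd n (unitary_diag U (\<lambda>i. complex_of_real (l i)))" "i < n"
  shows "0 < l i"
  using unitary_diag_quadratic_form[OF assms(1,3), of "\<lambda>i. complex_of_real (l i)"]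
    pd_tr_conjugation_pos[OF assms(2)]
  by (metis Re_complex_of_real)

lemma psd_spectral:
  assumes "psd n A"
  obtains U l where "unitary n U" "A = unitary_diag U (\<lambda>i. complex_of_real (l i))"
    "\<And>f. mcfun f A = unitary_diag U (\<lambda>i. f (l i))"
    "\<And>i. i < n \<Longrightarrow> 0 \<le> l i" "\<And>i. pd n A \<Longrightarrow> i < n \<Longrightarrow> 0 < l i"
  using mcfun_spectral[OF psdD(3)[OF assms]] unitary_diag_psdD unitary_diag_pdD assms by metis

lemma mcfun_cong_psd: "psd n A \<Longrightarrow> (\<And>x. 0 \<le> x \<Longrightarrow> f x = g x) \<Longrightarrow> mcfun f A = mcfun g A"
  by (rule psd_spectral[of A]) (auto intro!: unitary_diag_cong simp: unitaryD)

lemma mcfun_cong_pd: "pd n A \<Longrightarrow> (\<And>x. 0 < x \<Longrightarrow> f x = g x) \<Longrightarrow> mcfun f A = mcfun g A"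
  by (rule psd_spectral[of A]) (auto intro!: unitary_diag_cong simp: unitaryD pdD)

lemma unitary_diag_psd:
  assumes U: "unitary n U" and d: "\<And>i. i < n \<Longrightarrow> 0 \<le> d i"
  shows "psd n (unitary_diag U (\<lambda>i. complex_of_real (d i)))"
proof -
  define B where "B = unitary_diag U (\<lambda>i. complex_of_real (sqrt (d i)))"
  have B: "B \<in> M" using U by (simp add: B_def unitaryD)
  have "adj B * B
      = unitary_diag U (\<lambda>i. complex_of_real (sqrt (d i)) * complex_of_real (sqrt (d i)))"
    using U by (simp add: B_def unitary_diag_adj unitary_diag_mult unitaryD)
  also have "\<dots> = unitary_diag U (\<lambda>i. complex_of_real (d i))"
    using U d by (intro unitary_diag_cong) (auto simp: unitaryD simp flip: of_real_mult)
  finally show ?thesis using psd_gram[OF B] by simp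
qed

lemma mcfun_psd:
  assumes "psd n A" "\<And>x. 0 \<le> x \<Longrightarrow> 0 \<le> g x"
  shows "psd n (mcfun (\<lambda>x. complex_of_real (g x)) A)"
  using assms by (auto elim!: psd_spectral[of A] intro!: unitary_diag_psd)

lemma psd_sqrt: assumes "psd n A" obtains B where "psd n B" "A = B * B"
proof
  show "psd n (mcfun (\<lambda>x. complex_of_real (sqrt \<bar>x\<bar>)) A)" using assms by (intro mcfun_psd) auto
  have "mcfun (\<lambda>x. complex_of_real (sqrt \<bar>x\<bar>)) A * mcfun (\<lambda>x. complex_of_real (sqrt \<bar>x\<bar>)) A
      = mcfun complex_of_real A"
    using assms by (subst mcfun_mult)
      (auto intro!: mcfun_cong_psd simp: psdD simp flip: of_real_mult)
  then show "A = mcfun (\<lambda>x. complex_of_real (sqrt \<bar>x\<bar>)) A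
      * mcfun (\<lambda>x. complex_of_real (sqrt \<bar>x\<bar>)) A"
    using assms by (simp add: mcfun_id psdD)
qed

lemma unitary_diag_pd:
  assumes U: "unitary n U" and d: "\<And>i. i < n \<Longrightarrow> 0 < d i"
  shows "pd n (unitary_diag U (\<lambda>i. complex_of_real (d i)))"
proof -
  note U_closed = unitaryD(1)[OF U]
  define B where "B = unitary_diag U (\<lambda>i. complex_of_real (sqrt (d i)))"
  define C where "C = unitary_diag U (\<lambda>i. complex_of_real (1 / sqrt (d i)))"
  have BC: "B \<in> M" "C \<in> M" "adj B = B"
    using U_closed by (simp_all add: B_def C_def unitary_diag_adj)
  have "C * B = unitary_diag U (\<lambda>i. 1)"
    unfolding B_def C_def unitary_diag_mult[OF U]
    using U_closed d by (intro unitary_diag_cong)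
      (auto simp: less_imp_neq[symmetric] simp flip: of_real_mult)
  then have "pd n (adj B * 1\<^sub>m n * B)"
    using U BC by (intro pd_conjugation[OF pd_one, of _ C]) (simp_all add: unitary_diag_one)
  also have "adj B * 1\<^sub>m n * B
      = unitary_diag U (\<lambda>i. complex_of_real (sqrt (d i)) * complex_of_real (sqrt (d i)))"
    using BC by (simp add: B_def unitary_diag_mult[OF U])
  also have "\<dots> = unitary_diag U (\<lambda>i. complex_of_real (d i))"
    using U_closed d by (intro unitary_diag_cong) (auto simp: less_imp_le simp flip: of_real_mult)
  finally show ?thesis .
qed

lemma mcfun_pd:
  assumes "pd n A" "\<And>x. 0 < x \<Longrightarrow> 0 < g x"
  shows "pd n (mcfun (\<lambda>x. complex_of_real (g x)) A)"
  by (rule psd_spectral[OF pdD[OF assms(1)]]) (use assms in \<open>auto intro!: unitary_diag_pd\<close>)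

lemma mcfun_mult_commuting:
  assumes A: "psd n A" and B: "psd n B" and comm: "A * B = B * A"
    and f: "\<And>x y. 0 \<le> x \<Longrightarrow> 0 \<le> y \<Longrightarrow> f (x * y) = f x * f y"
  shows "mcfun f (A * B) = mcfun f A * mcfun f B"
proof -
  obtain U a b where U: "unitary n U" and a: "A = unitary_diag U (\<lambda>i. complex_of_real (a i))"
    and b: "B = unitary_diag U (\<lambda>i. complex_of_real (b i))"
    using commuting_hermitian_spectral_theorem[OF psdD(3)[OF A] psdD(3)[OF B] comm] by blast
  have nonneg: "0 \<le> a i" "0 \<le> b i" if "i < n" for i
    using that A B unitary_diag_psdD[OF U] unfolding a b by blast+
  have "A * B = unitary_diag U (\<lambda>i. complex_of_real (a i * b i))"
    unfolding a b by (simp add: unitary_diag_mult[OF U])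
  then have "mcfun f (A * B) = unitary_diag U (\<lambda>i. f (a i * b i))"
    by (simp only: mcfun_unitary_diag[OF U])
  also have "\<dots> = unitary_diag U (\<lambda>i. f (a i) * f (b i))"
    using unitaryD(1)[OF U] nonneg f by (intro unitary_diag_cong) auto
  also have "\<dots> = mcfun f A * mcfun f B"
    unfolding a b by (simp add: mcfun_unitary_diag[OF U] unitary_diag_mult[OF U])
  finally show ?thesis .
qed

lemma mcfun_subalgebra:
  assumes S: "S \<subseteq> M" "1\<^sub>m n \<in> S" "\<And>X Y. X \<in> S \<Longrightarrow> Y \<in> S \<Longrightarrow> X + Y \<in> S"
    "\<And>X Y. X \<in> S \<Longrightarrow> Y \<in> S \<Longrightarrow> X * Y \<in> S" "\<And>c X. X \<in> S \<Longrightarrow> c \<cdot>\<^sub>m X \<in> S"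
    and A: "hermitian A" "A \<in> S"
  shows "mcfun f A \<in> S"
proof -
  obtain U l where U: "unitary n U" "\<And>f. mcfun f A = unitary_diag U (\<lambda>i. f (l i))"
    using mcfun_spectral[OF A(1)] by metis
  have "\<exists>q\<in>{q. mcfun q A \<in> S}. \<forall>x\<in>l ` {..<n}. q x = f x"
  proof (rule function_algebra_interpolation[where g = complex_of_real])
    show "(\<lambda>x. c) \<in> {q. mcfun q A \<in> S}" for c
      using S(5)[OF S(2), of c] mcfun_smult[OF A(1), of c "\<lambda>x. 1"] mcfun_one[OF A(1)] by simp
    show "(\<lambda>x. q x + r x) \<in> {q. mcfun q A \<in> S}" "(\<lambda>x. q x * r x) \<in> {q. mcfun q A \<in> S}"
      if "q \<in> {q. mcfun q A \<in> S}" "r \<in> {q. mcfun q A \<in> S}" for q r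
      using that S(3,4)[of "mcfun q A" "mcfun r A"] A(1) by (simp_all add: mcfun_add mcfun_mult)
  qed (use A in \<open>auto simp: mcfun_id inj_on_def\<close>)
  then obtain q where q: "mcfun q A \<in> S" "\<And>i. i < n \<Longrightarrow> q (l i) = f (l i)" by auto
  have "mcfun q A = mcfun f A"
    unfolding U(2) using q(2) unitaryD(1)[OF U(1)] by (intro unitary_diag_cong) auto
  then show ?thesis using q(1) by simp
qed

subsection \<open>Contractions\<close>

definition contraction :: "complex mat \<Rightarrow> bool" where
  "contraction C \<longleftrightarrow> C \<in> M \<and> (\<forall>B\<in>M. hs_norm (C * B) \<le> hs_norm B)"

lemma contractionD: "contraction C \<Longrightarrow> C \<in> M" "contraction C \<Longrightarrow> B \<in> M \<Longrightarrow> hs_norm (C * B) \<le> hs_norm B"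
  by (auto simp: contraction_def)

lemma contraction_mult: "contraction C \<Longrightarrow> contraction D \<Longrightarrow> contraction (C * D)"
  unfolding contraction_def by (auto simp: M_assoc) (meson M_closed(1) order_trans)

lemma contraction_adj: assumes "contraction C" shows "contraction (adj C)"
  unfolding contraction_def
proof (intro conjI ballI)
  note closed = contractionD(1)[OF assms]
  show "adj C \<in> M" using closed by simp
  fix B assume B: "B \<in> M"
  let ?h = "hs_norm (adj C * B)"
  have "?h\<^sup>2 = cmod (tr (adj (adj C * B) * (adj C * B)))"
    using B closed by (simp add: tr_gram norm_power)
  also have "adj (adj C * B) * (adj C * B) = adj B * (C * (adj C * B))"
    using B closed by (simp add: adj_mult M_assoc)
  also have "cmod (tr \<dots>) \<le> hs_norm B * hs_norm (C * (adj C * B))"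
    using tr_Cauchy_Schwarz[of "adj B" "C * (adj C * B)"] B closed by (simp add: hs_norm_adj)
  also have "\<dots> \<le> hs_norm B * ?h"
    using contractionD(2)[OF assms, of "adj C * B"] B closed by (intro mult_left_mono) auto
  finally have "?h * ?h \<le> hs_norm B * ?h" by (simp add: power2_eq_square)
  then show "?h \<le> hs_norm B" using hs_norm_nonneg[of "adj C * B"] hs_norm_nonneg[of B]
    by (cases "?h = 0") (auto simp: mult_le_cancel_right)
qed

lemma contraction_mult_right: assumes "contraction C" "B \<in> M" shows "hs_norm (B * C) \<le> hs_norm B"
proof -
  have "hs_norm (B * C) = hs_norm (adj (B * C))"
    using assms contractionD(1)[of C] by (simp add: hs_norm_adj)
  also have "\<dots> = hs_norm (adj C * adj B)" using assms contractionD(1)[of C] by (simp add: adj_mult)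
  also have "\<dots> \<le> hs_norm (adj B)"
    using contractionD(2)[OF contraction_adj[OF assms(1)]] assms by simp
  finally show ?thesis using assms by (simp add: hs_norm_adj)
qed

lemma contractionI_gram:
  assumes C: "C \<in> M" and A: "psd n A" and gram: "adj C * C = mcfun (\<lambda>x. complex_of_real (g x)) A"
    and g_le_1: "\<And>x. 0 \<le> x \<Longrightarrow> g x \<le> 1"
  shows "contraction C"
  unfolding contraction_def
proof (intro conjI ballI)
  fix B assume B: "B \<in> M"
  note A_closed = psdD(1-3)[OF A]
  have complement: "psd n (mcfun (\<lambda>x. complex_of_real (1 - g x)) A)"
    using A g_le_1 by (intro mcfun_psd) auto
  have "adj B * B = adj B * mcfun (\<lambda>x. complex_of_real (g x) + complex_of_real (1 - g x)) A * B"
    using A_closed B by (simp add: mcfun_one)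
  also have "\<dots> = adj B * (adj C * C) * B + adj B * mcfun (\<lambda>x. complex_of_real (1 - g x)) A * B"
    using A_closed B C by (subst mcfun_add[symmetric]) (simp_all add: gram M_distrib)
  also have "adj B * (adj C * C) * B = adj (C * B) * (C * B)"
    using B C by (simp add: adj_mult M_assoc)
  finally have "Re (tr (adj B * B)) = Re (tr (adj (C * B) * (C * B)))
      + Re (tr (adj B * mcfun (\<lambda>x. complex_of_real (1 - g x)) A * B))"
    using A_closed B C by (simp add: tr_add)
  then have "(hs_norm (C * B))\<^sup>2 \<le> (hs_norm B)\<^sup>2"
    using psdD(4)[OF complement B] B C by (simp add: tr_gram)
  then show "hs_norm (C * B) \<le> hs_norm B" by (simp add: power2_le_iff_abs_le)
qed (use C in simp)

subsection \<open>Complex powers\<close>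

definition mcpow :: "complex \<Rightarrow> complex mat \<Rightarrow> complex mat" where
  "mcpow z A = mcfun (\<lambda>x. complex_of_real x powr z) A"

lemma mcpow_closed [simp]: "psd n A \<Longrightarrow> mcpow z A \<in> M"
  by (simp add: mcpow_def psdD)

lemma mcpow_mult: "psd n A \<Longrightarrow> mcpow z A * mcpow w A = mcpow (z + w) A"
  by (simp add: mcpow_def mcfun_mult psdD powr_add)

lemma mcpow_adj: "psd n A \<Longrightarrow> adj (mcpow z A) = mcpow (cnj z) A"
  unfolding mcpow_def by (subst mcfun_adj) (auto simp: psdD cnj_powr intro!: mcfun_cong_psd)

lemma mcpow_0: "pd n A \<Longrightarrow> mcpow 0 A = 1\<^sub>m n"
  unfolding mcpow_def by (subst mcfun_cong_pd[where g = "\<lambda>x. 1"]) (auto simp: mcfun_one psdD pdD)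

lemma mcpow_1: "psd n A \<Longrightarrow> mcpow 1 A = A"
  unfolding mcpow_def by (subst mcfun_cong_psd[where g = complex_of_real])
    (auto simp: mcfun_id psdD)

lemma mcpow_2: "psd n A \<Longrightarrow> mcpow 2 A = A * A"
  using mcpow_mult[of A 1 1] by (simp add: mcpow_1)

lemma mpow_eq_mcpow: "psd n A \<Longrightarrow> mpow s A = mcpow (complex_of_real s) A"
  unfolding mpow_def mcpow_def
  by (subst mfun_eq_mcfun) (auto simp: psdD powr_of_real intro!: mcfun_cong_psd)

lemma mpow_mpow: "psd n A \<Longrightarrow> mpow s (mpow t A) = mpow (t * s) A"
  unfolding mpow_def
  by (simp add: psdD mfun_eq_mcfun mcfun_cfun powr_powr)

lemma mcpow_real_psd: "psd n A \<Longrightarrow> psd n (mcpow (complex_of_real s) A)"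
  by (subst mpow_eq_mcpow[symmetric]) (auto simp: mpow_def mfun_eq_mcfun psdD intro: mcfun_psd)

lemma mcpow_real_pd: "pd n A \<Longrightarrow> pd n (mcpow (complex_of_real s) A)"
  by (subst mpow_eq_mcpow[symmetric]) (auto simp: mpow_def mfun_eq_mcfun psdD pdD intro: mcfun_pd)

lemma mcpow_commute:
  assumes "psd n A" "B \<in> M" "A * B = B * A" shows "mcpow z A * B = B * mcpow z A"
  unfolding mcpow_def using assms by (simp add: mcfun_commute psdD)

lemma mcpow_mult_commuting:
  assumes "psd n A" "psd n B" "A * B = B * A" shows "mcpow z (A * B) = mcpow z A * mcpow z B"
  unfolding mcpow_def using assms by (intro mcfun_mult_commuting) (auto simp: powr_times_real)

lemma contraction_mcpow_imaginary: assumes "psd n A" "Re z = 0" shows "contraction (mcpow z A)"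
proof (rule contractionI_gram[OF _ assms(1)])
  have conj_sum: "cnj z + z = 0" using assms(2) by (simp add: complex_eq_iff)
  show "adj (mcpow z A) * mcpow z A = mcfun (\<lambda>x. complex_of_real (if x = 0 then 0 else 1)) A"
    using assms unfolding mcpow_adj[OF assms(1)] mcpow_mult[OF assms(1)]
    by (auto simp: mcpow_def powr_def conj_sum intro!: mcfun_cong_psd)
qed (use assms in auto)

end

section \<open>Linear maps on matrices and their exponentials\<close>

lemma Bolzano_Weierstrass_finite:
  fixes x :: "nat \<Rightarrow> 'i \<Rightarrow> complex"
  assumes "finite I" "\<And>i. i \<in> I \<Longrightarrow> bounded (range (\<lambda>k. x k i))"
  obtains r l where "strict_mono r" "\<And>i. i \<in> I \<Longrightarrow> (\<lambda>k. x (r k) i) \<longlonglongrightarrow> l i"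
proof -
  have "\<exists>l r. strict_mono r \<and> (\<forall>e>0. \<forall>\<^sub>F k in sequentially. \<forall>i\<in>I. dist (x (r k) i) (l i) < e)"
    using compact_lemma_general[of I "\<lambda>f i. f i" x "\<lambda>f. f"] assms by (auto simp: image_image)
  then obtain r l where r: "strict_mono r"
    and l: "\<And>e. 0 < e \<Longrightarrow> \<forall>\<^sub>F k in sequentially. \<forall>i\<in>I. dist (x (r k) i) (l i) < e" by blast
  have "(\<lambda>k. x (r k) i) \<longlonglongrightarrow> l i" if "i \<in> I" for i
    unfolding tendsto_iff using that by (auto intro: eventually_mono[OF l])
  then show ?thesis using that r by blast
qed

context square_matrices
begin

definition matrix_unit :: "nat \<Rightarrow> nat \<Rightarrow> complex mat" where
  "matrix_unit k l = mat n n (\<lambda>(i,j). if i = k \<and> j = l then 1 else 0)"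

lemma matrix_unit_closed [simp]: "matrix_unit k l \<in> M" by (simp add: matrix_unit_def)

lemma lin_map_closed: "lin_map n \<Phi> \<Longrightarrow> X \<in> M \<Longrightarrow> \<Phi> X \<in> M"
  by (auto simp: lin_map_def)

lemma one_smult_M [simp]: "A \<in> M \<Longrightarrow> 1 \<cdot>\<^sub>m A = A"
  by (rule M_eqI) (simp_all add: index_smult)

lemma lin_map_add: "lin_map n \<Phi> \<Longrightarrow> X \<in> M \<Longrightarrow> Y \<in> M \<Longrightarrow> \<Phi> (X + Y) = \<Phi> X + \<Phi> Y"
  unfolding lin_map_def by (metis one_smult_M)

lemma lin_map_zero: assumes "lin_map n \<Phi>" shows "\<Phi> (0\<^sub>m n n) = 0\<^sub>m n n"
proof -
  have "\<Phi> (0\<^sub>m n n + 0\<^sub>m n n) = \<Phi> (0\<^sub>m n n) + \<Phi> (0\<^sub>m n n)" using assms by (intro lin_map_add) auto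
  then have "\<Phi> (0\<^sub>m n n) $$ (i,j) = \<Phi> (0\<^sub>m n n) $$ (i,j) + \<Phi> (0\<^sub>m n n) $$ (i,j)"
    if "i < n" "j < n" for i j
    using that lin_map_closed[OF assms, of "0\<^sub>m n n"] index_add[of "\<Phi> (0\<^sub>m n n)" "\<Phi> (0\<^sub>m n n)" i j]
    by simp
  then show ?thesis using lin_map_closed[OF assms, of "0\<^sub>m n n"] by (intro M_eqI) auto
qed

lemma lin_map_smult:
  assumes "lin_map n \<Phi>" "X \<in> M" shows "\<Phi> (c \<cdot>\<^sub>m X) = c \<cdot>\<^sub>m \<Phi> X"
proof -
  have "\<Phi> (c \<cdot>\<^sub>m X + 0\<^sub>m n n) = c \<cdot>\<^sub>m \<Phi> X + \<Phi> (0\<^sub>m n n)"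
    using assms unfolding lin_map_def using zero_carrier_mat by blast
  then show ?thesis
    using assms lin_map_closed[OF assms] right_add_zero_mat[of "c \<cdot>\<^sub>m X" n n]
      right_add_zero_mat[of "c \<cdot>\<^sub>m \<Phi> X" n n]
    by (simp add: lin_map_zero)
qed

lemma minus_M: "A \<in> M \<Longrightarrow> B \<in> M \<Longrightarrow> A - B = A + (- 1) \<cdot>\<^sub>m B"
  by (rule M_eqI) (simp_all add: index_smult index_add index_minus)

lemma lin_map_minus: "lin_map n \<Phi> \<Longrightarrow> X \<in> M \<Longrightarrow> Y \<in> M \<Longrightarrow> \<Phi> (X - Y) = \<Phi> X - \<Phi> Y"
  by (simp add: minus_M lin_map_add lin_map_smult lin_map_closed)

lemma lin_map_expand:
  assumes "lin_map n \<Phi>" "X \<in> M" "i < n" "j < n"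
  shows "\<Phi> X $$ (i,j) = (\<Sum>(k,l)\<in>{..<n}\<times>{..<n}. X $$ (k,l) * \<Phi> (matrix_unit k l) $$ (i,j))"
proof -
  define Y where "Y T = mat n n (\<lambda>(i,j). if (i,j) \<in> T then X $$ (i,j) else 0)" for T
  have Y: "Y T \<in> M" for T by (simp add: Y_def)
  have partial: "\<Phi> (Y T) $$ (i,j) = (\<Sum>(k,l)\<in>T. X $$ (k,l) * \<Phi> (matrix_unit k l) $$ (i,j))"
    if "finite T" "T \<subseteq> {..<n}\<times>{..<n}" for T
    using that
  proof (induction T rule: finite_induct)
    case empty
    have "Y {} = 0\<^sub>m n n" by (rule M_eqI) (auto simp: Y_def)
    then show ?case using assms by (simp add: lin_map_zero)
  next
    case (insert p T)
    obtain k l where p_eq: "p = (k,l)" by (cases p)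
    have kl: "k < n" "l < n" using insert.prems p_eq by auto
    have "Y (insert p T) = X $$ (k,l) \<cdot>\<^sub>m matrix_unit k l + Y T"
      by (rule M_eqI) (use insert.hyps p_eq kl in \<open>auto simp: Y_def matrix_unit_def\<close>)
    then have "\<Phi> (Y (insert p T)) = X $$ (k,l) \<cdot>\<^sub>m \<Phi> (matrix_unit k l) + \<Phi> (Y T)"
      using assms(1) Y by (simp add: lin_map_add lin_map_smult)
    then have "\<Phi> (Y (insert p T)) $$ (i,j)
        = X $$ (k,l) * \<Phi> (matrix_unit k l) $$ (i,j) + \<Phi> (Y T) $$ (i,j)"
      using assms Y lin_map_closed[OF assms(1)] by (simp add: index_add index_smult)
    then show ?case using insert p_eq by simp
  qed
  have "Y ({..<n}\<times>{..<n}) = X" by (rule M_eqI) (use assms in \<open>auto simp: Y_def\<close>)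
  then show ?thesis using partial[of "{..<n}\<times>{..<n}"] by simp
qed

lemma exists_trace_dual:
  assumes \<Phi>: "lin_map n \<Phi>"
  obtains S where "S \<in> M" "\<And>X. X \<in> M \<Longrightarrow> tr (S * X) = tr (\<Phi> X)"
proof
  define S where "S = mat n n (\<lambda>(i,j). tr (\<Phi> (matrix_unit j i)))"
  show S: "S \<in> M" by (simp add: S_def)
  fix X assume X: "X \<in> M"
  have "tr (\<Phi> X) = (\<Sum>i<n. \<Sum>(k,l)\<in>{..<n}\<times>{..<n}. X $$ (k,l) * \<Phi> (matrix_unit k l) $$ (i,i))"
    unfolding tr_sum[OF lin_map_closed[OF \<Phi> X]] by (intro sum.cong refl lin_map_expand[OF \<Phi> X]) auto
  also have "\<dots> = (\<Sum>(k,l)\<in>{..<n}\<times>{..<n}. X $$ (k,l) * tr (\<Phi> (matrix_unit k l)))"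
    unfolding case_prod_beta
    by (subst sum.swap) (simp add: tr_sum[OF lin_map_closed[OF \<Phi>]] sum_distrib_left)
  also have "\<dots> = (\<Sum>k<n. \<Sum>l<n. X $$ (k,l) * S $$ (l,k))"
    by (simp add: sum.cartesian_product S_def)
  also have "\<dots> = tr (S * X)" unfolding tr_mult_commute[OF S X] by (rule tr_mult[OF X S, symmetric])
  finally show "tr (S * X) = tr (\<Phi> X)" ..
qed

subsection \<open>Entrywise limits\<close>

definition mlim :: "('a \<Rightarrow> complex mat) \<Rightarrow> complex mat \<Rightarrow> 'a filter \<Rightarrow> bool" where
  "mlim X Y F \<longleftrightarrow> (\<forall>i<n. \<forall>j<n. ((\<lambda>t. X t $$ (i,j)) \<longlongrightarrow> Y $$ (i,j)) F)"

lemma mlimD: "mlim X Y F \<Longrightarrow> i < n \<Longrightarrow> j < n \<Longrightarrow> ((\<lambda>t. X t $$ (i,j)) \<longlongrightarrow> Y $$ (i,j)) F"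
  by (simp add: mlim_def)

lemma mlim_superop:
  assumes "\<And>t. lin_map n (\<Phi> t)" "lin_map n \<Psi>" "\<And>Z. Z \<in> M \<Longrightarrow> mlim (\<lambda>t. \<Phi> t Z) (\<Psi> Z) F"
    "\<And>t. X t \<in> M" "Y \<in> M" "mlim X Y F"
  shows "mlim (\<lambda>t. \<Phi> t (X t)) (\<Psi> Y) F"
  unfolding mlim_def
proof (intro allI impI)
  fix i j assume ij: "i < n" "j < n"
  show "((\<lambda>t. \<Phi> t (X t) $$ (i,j)) \<longlongrightarrow> \<Psi> Y $$ (i,j)) F"
    unfolding lin_map_expand[OF assms(1,4) ij] lin_map_expand[OF assms(2,5) ij] case_prod_beta
    by (intro tendsto_sum tendsto_mult mlimD[OF assms(6)] mlimD[OF assms(3)]) (use ij in auto)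
qed

lemma mlim_const: "mlim (\<lambda>t. Y) Y F" by (simp add: mlim_def)

lemma mlim_lin: "lin_map n \<Phi> \<Longrightarrow> (\<And>t. X t \<in> M) \<Longrightarrow> Y \<in> M \<Longrightarrow> mlim X Y F \<Longrightarrow> mlim (\<lambda>t. \<Phi> (X t)) (\<Phi> Y) F"
  by (rule mlim_superop) (auto intro: mlim_const)

lemma mlim_mult:
  assumes "\<And>t. X t \<in> M" "Y \<in> M" "mlim X Y F" "\<And>t. X' t \<in> M" "Y' \<in> M" "mlim X' Y' F"
  shows "mlim (\<lambda>t. X t * X' t) (Y * Y') F"
  unfolding mlim_def
proof (intro allI impI)
  fix i j assume ij: "i < n" "j < n"
  show "((\<lambda>t. (X t * X' t) $$ (i,j)) \<longlongrightarrow> (Y * Y') $$ (i,j)) F"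
    unfolding index_mult[OF assms(1,4) ij] index_mult[OF assms(2,5) ij]
    by (intro tendsto_sum tendsto_mult mlimD[OF assms(3)] mlimD[OF assms(6)]) (use ij in auto)
qed

lemma mlim_adj:
  assumes "\<And>t. X t \<in> M" "Y \<in> M" "mlim X Y F" shows "mlim (\<lambda>t. adj (X t)) (adj Y) F"
  unfolding mlim_def
proof (intro allI impI)
  fix i j assume ij: "i < n" "j < n"
  show "((\<lambda>t. adj (X t) $$ (i,j)) \<longlongrightarrow> adj Y $$ (i,j)) F"
    unfolding index_adj[OF assms(1) ij] index_adj[OF assms(2) ij]
    by (intro tendsto_cnj mlimD[OF assms(3)] ij)
qed

lemma mlim_tr:
  assumes "\<And>t. X t \<in> M" "Y \<in> M" "mlim X Y F" shows "((\<lambda>t. tr (X t)) \<longlongrightarrow> tr Y) F"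
  unfolding tr_sum[OF assms(1)] tr_sum[OF assms(2)]
  by (intro tendsto_sum mlimD[OF assms(3)]) auto

lemma mlim_unique:
  assumes "mlim X Y F" "mlim X Y' F" "Y \<in> M" "Y' \<in> M" "F \<noteq> bot" shows "Y = Y'"
  by (rule M_eqI) (use assms in \<open>auto intro: tendsto_unique dest: mlimD\<close>)

lemma mlim_zero_iff:
  assumes "\<And>t. X t \<in> M"
  shows "mlim X (0\<^sub>m n n) F \<longleftrightarrow> ((\<lambda>t. hs_norm (X t)) \<longlongrightarrow> 0) F"
proof
  assume "mlim X (0\<^sub>m n n) F"
  then have "((\<lambda>t. \<Sum>p\<in>{..<n}\<times>{..<n}. (cmod (X t $$ p))\<^sup>2) \<longlongrightarrow> (\<Sum>p\<in>{..<n}\<times>{..<n}. (cmod 0)\<^sup>2)) F"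
    by (intro tendsto_intros) (auto simp: mlim_def)
  then have "((\<lambda>t. hs_norm (X t)) \<longlongrightarrow> sqrt (\<Sum>p\<in>{..<n}\<times>{..<n}. (cmod 0)\<^sup>2)) F"
    unfolding hs_norm_def L2_set_def by (rule tendsto_real_sqrt)
  then show "((\<lambda>t. hs_norm (X t)) \<longlongrightarrow> 0) F" by simp
next
  assume lim: "((\<lambda>t. hs_norm (X t)) \<longlongrightarrow> 0) F"
  have "((\<lambda>t. X t $$ (i,j)) \<longlongrightarrow> 0) F" if "i < n" "j < n" for i j
    by (rule Lim_null_comparison[OF _ lim])
      (use that entry_le_hs_norm in \<open>auto intro!: always_eventually\<close>)
  then show "mlim X (0\<^sub>m n n) F" by (simp add: mlim_def)
qed

lemma mlim_psd:
  assumes "\<And>t. psd n (X t)" "Y \<in> M" "mlim X Y F" "F \<noteq> bot" shows "psd n Y"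
  unfolding psd_iff_tr hermitian_def
proof (intro conjI ballI)
  have X: "\<And>t. X t \<in> M" "\<And>t. adj (X t) = X t" using assms(1) psdD by auto
  show "Y \<in> M" by fact
  show "adj Y = Y" using mlim_unique[OF mlim_adj[OF X(1) assms(2,3)], of Y] assms X by simp
  fix S assume S: "S \<in> M"
  have "((\<lambda>t. Re (tr (adj S * X t * S))) \<longlongrightarrow> Re (tr (adj S * Y * S))) F"
    by (intro tendsto_Re mlim_tr mlim_mult mlim_const) (use S X assms in auto)
  then show "0 \<le> Re (tr (adj S * Y * S))"
    by (rule tendsto_lowerbound[OF _ _ assms(4)]) (use psdD(4)[OF assms(1) S] in auto)
qed

lemma lin_map_from_coefficients:
  "lin_map n (\<lambda>X. mat n n (\<lambda>(i,j). \<Sum>(a,b)\<in>{..<n}\<times>{..<n}. X $$ (a,b) * \<gamma> (a,b,i,j)))"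
  (is "lin_map n ?\<Psi>")
  unfolding lin_map_def
proof (intro conjI ballI allI)
  fix X Y c assume XY: "X \<in> M" "Y \<in> M"
  have "(\<Sum>(a,b)\<in>{..<n}\<times>{..<n}. (c \<cdot>\<^sub>m X + Y) $$ (a,b) * \<gamma> (a,b,i,j)) =
    (\<Sum>(a,b)\<in>{..<n}\<times>{..<n}. c * (X $$ (a,b) * \<gamma> (a,b,i,j)) + Y $$ (a,b) * \<gamma> (a,b,i,j))" for i j
    by (intro sum.cong) (use XY in \<open>auto simp: index_add index_smult algebra_simps\<close>)
  then show "?\<Psi> (c \<cdot>\<^sub>m X + Y) = c \<cdot>\<^sub>m ?\<Psi> X + ?\<Psi> Y"
    by (intro M_eqI) (simp_all add: index_add index_smult case_prod_beta sum.distrib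
        sum_distrib_left)
qed simp

lemma lin_map_sequence_compact:
  fixes \<Phi> :: "nat \<Rightarrow> complex mat \<Rightarrow> complex mat"
  assumes lin: "\<And>k. lin_map n (\<Phi> k)"
    and bounded: "\<And>X. X \<in> M \<Longrightarrow> \<exists>B. \<forall>k. hs_norm (\<Phi> k X) \<le> B"
  obtains r \<Psi> where "strict_mono r" "lin_map n \<Psi>"
    "\<And>X. X \<in> M \<Longrightarrow> mlim (\<lambda>k. \<Phi> (r k) X) (\<Psi> X) sequentially"
proof -
  let ?I = "{..<n}\<times>{..<n}\<times>{..<n}\<times>{..<n}"
  let ?x = "\<lambda>k (a,b,i,j). \<Phi> k (matrix_unit a b) $$ (i,j)"
  have entries_bounded: "bounded (range (\<lambda>k. ?x k p))" if "p \<in> ?I" for p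
  proof -
    obtain a b i j where p_eq: "p = (a,b,i,j)" by (metis prod_cases4)
    then have ij: "i < n" "j < n" using that by auto
    obtain B where "\<forall>k. hs_norm (\<Phi> k (matrix_unit a b)) \<le> B"
      using bounded[of "matrix_unit a b"] by auto
    then have "\<forall>k. cmod (\<Phi> k (matrix_unit a b) $$ (i,j)) \<le> B"
      using entry_le_hs_norm[OF ij] order_trans by blast
    then show ?thesis by (auto simp: bounded_iff p_eq)
  qed
  have "finite ?I" by simp
  then obtain r \<gamma> where r: "strict_mono r" and \<gamma>: "\<And>p. p \<in> ?I \<Longrightarrow> (\<lambda>k. ?x (r k) p) \<longlonglongrightarrow> \<gamma> p"
    by (rule Bolzano_Weierstrass_finite[of ?I ?x, OF _ entries_bounded]) (assumption, rule that)
  define \<Psi> where "\<Psi> X = mat n n (\<lambda>(i,j). \<Sum>(a,b)\<in>{..<n}\<times>{..<n}. X $$ (a,b) * \<gamma> (a,b,i,j))" for X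
  have "mlim (\<lambda>k. \<Phi> (r k) X) (\<Psi> X) sequentially" if X: "X \<in> M" for X
    unfolding mlim_def
  proof (intro allI impI)
    fix i j assume ij: "i < n" "j < n"
    have "(\<lambda>k. \<Phi> (r k) (matrix_unit a b) $$ (i,j)) \<longlonglongrightarrow> \<gamma> (a,b,i,j)" if "a < n" "b < n" for a b
      using \<gamma>[of "(a,b,i,j)"] that ij by simp
    then have "(\<lambda>k. \<Phi> (r k) X $$ (i,j)) \<longlonglongrightarrow> (\<Sum>(a,b)\<in>{..<n}\<times>{..<n}. X $$ (a,b) * \<gamma> (a,b,i,j))"
      unfolding lin_map_expand[OF lin X ij] case_prod_beta
      by (intro tendsto_sum tendsto_mult tendsto_const) auto
    then show "(\<lambda>k. \<Phi> (r k) X $$ (i,j)) \<longlonglongrightarrow> \<Psi> X $$ (i,j)" using ij by (simp add: \<Psi>_def)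
  qed
  moreover have "lin_map n \<Psi>" unfolding \<Psi>_def by (rule lin_map_from_coefficients)
  ultimately show ?thesis using that r by blast
qed

subsection \<open>The exponential of a linear map\<close>

definition superop_exp :: "(complex mat \<Rightarrow> complex mat) \<Rightarrow> complex \<Rightarrow> complex mat \<Rightarrow> complex mat" where
  "superop_exp \<Phi> z X = mat n n (\<lambda>(i,j). \<Sum>k. z ^ k / fact k * (\<Phi> ^^ k) X $$ (i,j))"

lemma superop_exp_closed [simp]: "superop_exp \<Phi> z X \<in> M"
  by (simp add: superop_exp_def)

lemma sg_eq_superop_exp: "X \<in> M \<Longrightarrow> sg \<Phi> t X = superop_exp \<Phi> (of_real t) X"
  by (rule M_eqI) (auto simp: sg_def superop_exp_def)

lemma hs_norm_le_sum: "hs_norm A \<le> (\<Sum>p\<in>{..<n}\<times>{..<n}. cmod (A $$ p))"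
  unfolding hs_norm_def by (intro L2_set_le_sum) simp

lemma lin_map_bounded:
  assumes \<Phi>: "lin_map n \<Phi>"
  obtains C where "0 \<le> C" "\<And>X. X \<in> M \<Longrightarrow> hs_norm (\<Phi> X) \<le> C * hs_norm X"
proof
  let ?I = "{..<n}\<times>{..<n}"
  define c where "c p = (\<Sum>(k,l)\<in>?I. cmod (\<Phi> (matrix_unit k l) $$ p))" for p
  show "0 \<le> (\<Sum>p\<in>?I. c p)" by (auto simp: c_def intro!: sum_nonneg)
  fix X assume X: "X \<in> M"
  have "cmod (\<Phi> X $$ (i,j)) \<le> c (i,j) * hs_norm X" if ij: "i < n" "j < n" for i j
  proof -
    have "cmod (\<Phi> X $$ (i,j)) \<le> (\<Sum>(k,l)\<in>?I. cmod (\<Phi> (matrix_unit k l) $$ (i,j)) * hs_norm X)"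
      unfolding lin_map_expand[OF \<Phi> X ij]
      by (intro sum_norm_le) (auto simp: norm_mult mult.commute[of "cmod (X $$ _)"]
          intro!: mult_left_mono entry_le_hs_norm)
    then show ?thesis by (simp add: c_def case_prod_beta sum_distrib_right)
  qed
  then have "(\<Sum>p\<in>?I. cmod (\<Phi> X $$ p)) \<le> (\<Sum>p\<in>?I. c p * hs_norm X)"
    by (intro sum_mono) auto
  then show "hs_norm (\<Phi> X) \<le> (\<Sum>p\<in>?I. c p) * hs_norm X"
    using hs_norm_le_sum[of "\<Phi> X"] by (simp add: sum_distrib_right)
qed

context
  fixes \<Phi> :: "complex mat \<Rightarrow> complex mat"
  assumes \<Phi>: "lin_map n \<Phi>"
begin

lemma funpow_closed: "X \<in> M \<Longrightarrow> (\<Phi> ^^ k) X \<in> M"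
  by (induction k) (auto simp: lin_map_closed[OF \<Phi>])

lemma lin_map_funpow: "lin_map n (\<Phi> ^^ k)"
  using \<Phi> by (induction k) (auto simp: lin_map_def)

lemma superop_exp_sums:
  assumes X: "X \<in> M" and ij: "i < n" "j < n"
  shows "(\<lambda>k. z ^ k / fact k * (\<Phi> ^^ k) X $$ (i,j)) sums (superop_exp \<Phi> z X $$ (i,j))"
proof -
  obtain C where C: "0 \<le> C" "\<And>Y. Y \<in> M \<Longrightarrow> hs_norm (\<Phi> Y) \<le> C * hs_norm Y"
    using lin_map_bounded[OF \<Phi>] by blast
  have growth: "hs_norm ((\<Phi> ^^ k) X) \<le> C ^ k * hs_norm X" for k
  proof (induction k)
    case (Suc k)
    have "hs_norm ((\<Phi> ^^ Suc k) X) \<le> C * hs_norm ((\<Phi> ^^ k) X)"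
      using C(2)[OF funpow_closed[OF X]] by simp
    also have "\<dots> \<le> C * (C ^ k * hs_norm X)" using Suc C(1) by (rule mult_left_mono)
    finally show ?case by (simp add: mult_ac)
  qed simp
  have "summable (\<lambda>k. z ^ k / fact k * (\<Phi> ^^ k) X $$ (i,j))"
  proof (rule summable_comparison_test'[where N = 0])
    show "summable (\<lambda>k. ((cmod z * C) ^ k /\<^sub>R fact k) * hs_norm X)"
      by (intro summable_mult2 summable_exp_generic)
    fix k
    have "cmod ((\<Phi> ^^ k) X $$ (i,j)) \<le> C ^ k * hs_norm X"
      using entry_le_hs_norm[OF ij] growth order_trans by blast
    then have "cmod z ^ k / fact k * cmod ((\<Phi> ^^ k) X $$ (i,j))
        \<le> cmod z ^ k / fact k * (C ^ k * hs_norm X)"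
      by (intro mult_left_mono) auto
    then show "cmod (z ^ k / fact k * (\<Phi> ^^ k) X $$ (i,j))
        \<le> ((cmod z * C) ^ k /\<^sub>R fact k) * hs_norm X"
      by (simp add: norm_mult norm_divide norm_power power_mult_distrib)
        (simp add: divide_inverse mult_ac)
  qed
  then show ?thesis using ij by (simp add: superop_exp_def summable_sums)
qed

lemma lin_map_superop_exp_sums:
  assumes \<Psi>: "lin_map n \<Psi>" and X: "X \<in> M" and ij: "i < n" "j < n"
  shows "(\<lambda>k. z ^ k / fact k * \<Psi> ((\<Phi> ^^ k) X) $$ (i,j)) sums (\<Psi> (superop_exp \<Phi> z X) $$ (i,j))"
proof -
  have "(\<lambda>k. \<Sum>p\<in>{..<n}\<times>{..<n}. (z ^ k / fact k * (\<Phi> ^^ k) X $$ p)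
      * \<Psi> (matrix_unit (fst p) (snd p)) $$ (i,j))
    sums (\<Sum>p\<in>{..<n}\<times>{..<n}. superop_exp \<Phi> z X $$ p * \<Psi> (matrix_unit (fst p) (snd p)) $$ (i,j))"
    by (intro sums_sum sums_mult2) (use superop_exp_sums[OF X] in auto)
  then show ?thesis
    unfolding lin_map_expand[OF \<Psi> funpow_closed[OF X] ij] lin_map_expand[OF \<Psi> superop_exp_closed ij]
      case_prod_beta sum_distrib_left prod.collapse mult.assoc .
qed

lemma superop_exp_intertwine:
  assumes \<Psi>: "lin_map n \<Psi>" and \<Omega>: "lin_map n \<Omega>" and X: "X \<in> M"
    and intertwine: "\<And>Y. Y \<in> M \<Longrightarrow> \<Omega> (\<Phi> Y) = \<Psi> (\<Omega> Y)"
  shows "\<Omega> (superop_exp \<Phi> z X) = superop_exp \<Psi> z (\<Omega> X)"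
proof (rule M_eqI)
  have funpow: "\<Omega> ((\<Phi> ^^ k) X) = (\<Psi> ^^ k) (\<Omega> X)" for k
    by (induction k) (simp_all add: intertwine funpow_closed X)
  fix i j assume ij: "i < n" "j < n"
  show "\<Omega> (superop_exp \<Phi> z X) $$ (i,j) = superop_exp \<Psi> z (\<Omega> X) $$ (i,j)"
    using sums_unique[OF lin_map_superop_exp_sums[OF \<Omega> X ij, of z]] ij
    by (simp add: superop_exp_def funpow)
qed (simp_all add: lin_map_closed[OF \<Omega>])

lemma lin_map_superop_exp: "lin_map n (superop_exp \<Phi> z)"
  unfolding lin_map_def
proof (intro conjI ballI allI)
  fix X Y c assume XY: "X \<in> M" "Y \<in> M"
  show "superop_exp \<Phi> z (c \<cdot>\<^sub>m X + Y) = c \<cdot>\<^sub>m superop_exp \<Phi> z X + superop_exp \<Phi> z Y"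
  proof (rule M_eqI)
    fix i j assume ij: "i < n" "j < n"
    have "(\<Phi> ^^ k) (c \<cdot>\<^sub>m X + Y) $$ (i,j) = c * (\<Phi> ^^ k) X $$ (i,j) + (\<Phi> ^^ k) Y $$ (i,j)" for k
      using lin_map_funpow[of k] XY ij
      by (simp add: lin_map_add lin_map_smult index_add index_smult funpow_closed)
    then have "(\<lambda>k. z ^ k / fact k * (\<Phi> ^^ k) (c \<cdot>\<^sub>m X + Y) $$ (i,j))
      = (\<lambda>k. c * (z ^ k / fact k * (\<Phi> ^^ k) X $$ (i,j)) + z ^ k / fact k * (\<Phi> ^^ k) Y $$ (i,j))"
      by (simp add: algebra_simps)
    moreover have "\<dots> sums (c * superop_exp \<Phi> z X $$ (i,j) + superop_exp \<Phi> z Y $$ (i,j))"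
      by (intro sums_add sums_mult superop_exp_sums XY ij)
    moreover have "(\<lambda>k. z ^ k / fact k * (\<Phi> ^^ k) (c \<cdot>\<^sub>m X + Y) $$ (i,j))
      sums (superop_exp \<Phi> z (c \<cdot>\<^sub>m X + Y) $$ (i,j))"
      using XY by (intro superop_exp_sums ij) simp
    ultimately show "superop_exp \<Phi> z (c \<cdot>\<^sub>m X + Y) $$ (i,j)
      = (c \<cdot>\<^sub>m superop_exp \<Phi> z X + superop_exp \<Phi> z Y) $$ (i,j)"
      using ij by (simp add: index_add index_smult sums_unique2)
  qed simp_all
qed simp

lemma superop_exp_0: assumes X: "X \<in> M" shows "superop_exp \<Phi> 0 X = X"
proof (rule M_eqI)
  fix i j assume ij: "i < n" "j < n"
  have "(\<lambda>k. 0 ^ k / fact k * (\<Phi> ^^ k) X $$ (i,j)) = (\<lambda>k. if k = 0 then X $$ (i,j) else 0)"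
    by (auto simp: fun_eq_iff power_0_left)
  then have "(\<lambda>k. 0 ^ k / fact k * (\<Phi> ^^ k) X $$ (i,j)) sums X $$ (i,j)"
    using sums_single[of 0 "\<lambda>_. X $$ (i,j)"] by simp
  then show "superop_exp \<Phi> 0 X $$ (i,j) = X $$ (i,j)"
    using superop_exp_sums[OF X ij] sums_unique2 by blast
qed (use X in auto)

lemma superop_exp_has_derivative:
  assumes X: "X \<in> M" and ij: "i < n" "j < n"
  shows "((\<lambda>z. superop_exp \<Phi> z X $$ (i,j))
      has_field_derivative superop_exp \<Phi> z (\<Phi> X) $$ (i,j)) (at z)"
proof -
  define c where "c k = (\<Phi> ^^ k) X $$ (i,j) / fact k" for k
  have series: "superop_exp \<Phi> z X $$ (i,j) = (\<Sum>k. c k * z ^ k)" for z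
    using ij by (simp add: superop_exp_def c_def mult.commute)
  have "summable (\<lambda>k. c k * z ^ k)" for z
    using sums_summable[OF superop_exp_sums[OF X ij, of z]] by (simp add: c_def mult.commute)
  then have "((\<lambda>z. \<Sum>k. c k * z ^ k) has_field_derivative (\<Sum>k. diffs c k * z ^ k)) (at z)"
    by (rule termdiffs_strong_converges_everywhere)
  moreover have "diffs c k = (\<Phi> ^^ k) (\<Phi> X) $$ (i,j) / fact k" for k
    by (simp add: diffs_def c_def funpow_swap1 field_simps del: of_nat_Suc)
  then have "(\<Sum>k. diffs c k * z ^ k) = superop_exp \<Phi> z (\<Phi> X) $$ (i,j)"
    using ij by (simp add: superop_exp_def mult.commute)
  ultimately show ?thesis by (simp add: series)
qed

lemma superop_exp_commute: "X \<in> M \<Longrightarrow> superop_exp \<Phi> z (\<Phi> X) = \<Phi> (superop_exp \<Phi> z X)"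
  by (rule superop_exp_intertwine[OF \<Phi> \<Phi>, symmetric]) simp_all

lemma superop_exp_shifted_product_derivative:
  assumes X: "X \<in> M" and ij: "i < n" "j < n"
  shows "((\<lambda>w. superop_exp \<Phi> (s - w) (superop_exp \<Phi> w X) $$ (i,j)) has_field_derivative 0) (at w)"
proof -
  let ?I = "{..<n}\<times>{..<n}"
  note expand = lin_map_expand[OF lin_map_superop_exp superop_exp_closed ij]
  have backwards: "((\<lambda>w. superop_exp \<Phi> (s - w) Y $$ (i,j)) has_field_derivative
      - superop_exp \<Phi> (s - w) (\<Phi> Y) $$ (i,j)) (at w)" if "Y \<in> M" for Y
  proof -
    have "((\<lambda>w. s - w) has_field_derivative - 1) (at w)" by (auto intro!: derivative_eq_intros)
    from DERIV_chain2[OF superop_exp_has_derivative[OF that ij] this] show ?thesis by simp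
  qed
  have "((\<lambda>w. superop_exp \<Phi> (s - w) (superop_exp \<Phi> w X) $$ (i,j)) has_field_derivative
      (\<Sum>p\<in>?I. superop_exp \<Phi> w (\<Phi> X) $$ p
        * superop_exp \<Phi> (s - w) (matrix_unit (fst p) (snd p)) $$ (i,j)
        + - superop_exp \<Phi> (s - w) (\<Phi> (matrix_unit (fst p) (snd p))) $$ (i,j)
          * superop_exp \<Phi> w X $$ p)) (at w)"
    unfolding expand case_prod_beta prod.collapse
    by (intro DERIV_sum DERIV_mult backwards) (auto intro!: superop_exp_has_derivative X)
  also have "(\<Sum>p\<in>?I. superop_exp \<Phi> w (\<Phi> X) $$ p
      * superop_exp \<Phi> (s - w) (matrix_unit (fst p) (snd p)) $$ (i,j)
        + - superop_exp \<Phi> (s - w) (\<Phi> (matrix_unit (fst p) (snd p))) $$ (i,j)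
          * superop_exp \<Phi> w X $$ p)
      = superop_exp \<Phi> (s - w) (superop_exp \<Phi> w (\<Phi> X)) $$ (i,j)
        - (\<lambda>Y. superop_exp \<Phi> (s - w) (\<Phi> Y)) (superop_exp \<Phi> w X) $$ (i,j)"
  proof -
    have "lin_map n (\<lambda>Y. superop_exp \<Phi> (s - w) (\<Phi> Y))"
      using \<Phi> lin_map_superop_exp by (simp add: lin_map_def)
    from lin_map_expand[OF this superop_exp_closed ij] show ?thesis
      unfolding expand by (simp add: case_prod_beta sum_subtractf mult.commute)
  qed
  also have "\<dots> = 0" using X by (simp add: superop_exp_commute)
  finally show ?thesis .
qed

lemma superop_exp_add:
  assumes X: "X \<in> M"
  shows "superop_exp \<Phi> s (superop_exp \<Phi> t X) = superop_exp \<Phi> (s + t) X"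
proof (rule M_eqI)
  fix i j assume ij: "i < n" "j < n"
  let ?f = "\<lambda>w. superop_exp \<Phi> (s + t - w) (superop_exp \<Phi> w X) $$ (i,j)"
  obtain c where const: "\<And>w. ?f w = c"
    using has_field_derivative_zero_constant[of UNIV ?f]
      superop_exp_shifted_product_derivative[OF X ij]
    by auto
  have "?f t = ?f 0" unfolding const ..
  then show "superop_exp \<Phi> s (superop_exp \<Phi> t X) $$ (i,j) = superop_exp \<Phi> (s + t) X $$ (i,j)"
    using X by (simp add: superop_exp_0)
qed simp_all

subsection \<open>Symmetric linear maps\<close>

lemma tr_superop_exp_sums:
  assumes A: "A \<in> M" and X: "X \<in> M"
  shows "(\<lambda>k. z ^ k / fact k * tr (A * (\<Phi> ^^ k) X)) sums tr (A * superop_exp \<Phi> z X)"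
proof -
  have "lin_map n (\<lambda>Y. A * Y)" using A by (auto simp: lin_map_def M_distrib M_smult)
  then have "(\<lambda>k. \<Sum>i<n. z ^ k / fact k * (A * (\<Phi> ^^ k) X) $$ (i,i))
      sums (\<Sum>i<n. (A * superop_exp \<Phi> z X) $$ (i,i))"
    by (intro sums_sum lin_map_superop_exp_sums X) auto
  then show ?thesis using A X by (simp add: tr_sum funpow_closed sum_distrib_left)
qed

context
  assumes sym: "\<And>A B. A \<in> M \<Longrightarrow> B \<in> M \<Longrightarrow> tr (adj A * \<Phi> B) = tr (adj (\<Phi> A) * B)"
begin

lemma superop_exp_adjoint:
  assumes A: "A \<in> M" and B: "B \<in> M"
  shows "tr (adj A * superop_exp \<Phi> z B) = tr (adj (superop_exp \<Phi> (cnj z) A) * B)"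
proof -
  have tr_swap: "tr (adj Y * B) = cnj (tr (adj B * Y))" if "Y \<in> M" for Y
    using B that by (subst tr_adj[symmetric]) (auto simp: adj_mult)
  have funpow_sym: "tr (adj A * (\<Phi> ^^ k) B) = tr (adj ((\<Phi> ^^ k) A) * B)" for k
    using A B
  proof (induction k arbitrary: B)
    case (Suc k)
    then show ?case using sym[of "(\<Phi> ^^ k) A" B] lin_map_closed[OF \<Phi>]
      by (simp add: funpow_closed funpow_swap1)
  qed simp
  have "(\<lambda>k. cnj (cnj z ^ k / fact k * tr (adj B * (\<Phi> ^^ k) A)))
      sums cnj (tr (adj B * superop_exp \<Phi> (cnj z) A))"
    using tr_superop_exp_sums[of "adj B" A "cnj z"] A B by (subst sums_cnj) simp
  then have "(\<lambda>k. z ^ k / fact k * tr (adj A * (\<Phi> ^^ k) B))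
      sums tr (adj (superop_exp \<Phi> (cnj z) A) * B)"
    using A by (simp add: funpow_sym tr_swap funpow_closed)
  moreover have "(\<lambda>k. z ^ k / fact k * tr (adj A * (\<Phi> ^^ k) B)) sums tr (adj A * superop_exp \<Phi> z B)"
    using A B by (intro tr_superop_exp_sums) auto
  ultimately show ?thesis by (rule sums_unique2[symmetric])
qed

lemma hs_norm_superop_exp_imaginary:
  assumes X: "X \<in> M" and z: "Re z = 0"
  shows "hs_norm (superop_exp \<Phi> z X) = hs_norm X"
proof -
  have "complex_of_real ((hs_norm (superop_exp \<Phi> z X))\<^sup>2)
      = tr (adj (superop_exp \<Phi> z X) * superop_exp \<Phi> z X)"
    by (simp add: tr_gram)
  also have "\<dots> = tr (adj (superop_exp \<Phi> (cnj z) (superop_exp \<Phi> z X)) * X)"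
    by (rule superop_exp_adjoint[OF superop_exp_closed X])
  also have "superop_exp \<Phi> (cnj z) (superop_exp \<Phi> z X) = X"
    using z X by (simp add: superop_exp_add complex_add_cnj superop_exp_0 add.commute)
  also have "tr (adj X * X) = complex_of_real ((hs_norm X)\<^sup>2)" using X by (rule tr_gram)
  finally show ?thesis by (simp only: of_real_eq_iff power2_eq_iff_nonneg hs_norm_nonneg)
qed

end

end

end

section \<open>Unital completely positive maps\<close>

lemma sum_lessThan_mult: "(\<Sum>p<m * n. f p) = (\<Sum>i<m. \<Sum>a<n. f (i * n + a))"
  for f :: "nat \<Rightarrow> 'a::comm_monoid_add"
proof -
  have "sum f {i * n..<i * n + n} = (\<Sum>a<n. f (i * n + a))" for i
    using sum.shift_bounds_nat_ivl[of f 0 "i * n" n] by (simp add: add.commute atLeast0LessThan)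
  then show ?thesis by (simp add: sum.nat_group[symmetric])
qed

lemma exists_phase: obtains \<omega> where "cmod \<omega> = 1" "\<omega> * z = - of_real (cmod z)"
proof (cases "z = 0")
  case True
  then show ?thesis using that[of 1] by simp
next
  case False
  then show ?thesis using that[of "- cnj z / of_real (cmod z)"]
    by (simp add: norm_divide cnj_mult_cmod power2_eq_square)
qed

context square_matrices
begin

subsection \<open>Block matrices\<close>

lemma index_blockmat:
  assumes "i < m" "j < m" "a < n" "b < n"
  shows "blockmat m n B $$ (i * n + a, j * n + b) = B i j $$ (a,b)"
proof -
  have "k * n + c < m * n" if "k < m" "c < n" for k c
  proof -
    have "k * n + c < Suc k * n" using that by simp
    also have "\<dots> \<le> m * n" using that by (intro mult_right_mono) auto
    finally show ?thesis .
  qed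
  then show ?thesis using assms by (simp add: blockmat_def)
qed

lemma adj_blockmat:
  assumes "\<And>i j. i < m \<Longrightarrow> j < m \<Longrightarrow> B i j \<in> M"
  shows "adj (blockmat m n B) = blockmat m n (\<lambda>i j. adj (B j i))"
proof (rule eq_matI)
  interpret big: square_matrices "m * n" .
  have closed: "blockmat m n B \<in> carrier_mat (m * n) (m * n)" by (simp add: blockmat_def)
  fix p r assume "p < dim_row (blockmat m n (\<lambda>i j. adj (B j i)))"
    "r < dim_col (blockmat m n (\<lambda>i j. adj (B j i)))"
  then have pr: "p < m * n" "r < m * n" by (simp_all add: blockmat_def)
  then have "0 < n" by (auto intro: gr0I)
  then have "p div n < m" "r div n < m" "p mod n < n" "r mod n < n"
    using pr by (simp_all add: less_mult_imp_div_less)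
  then show "adj (blockmat m n B) $$ (p,r) = blockmat m n (\<lambda>i j. adj (B j i)) $$ (p,r)"
    unfolding big.index_adj[OF closed pr] using pr assms by (simp add: blockmat_def index_adj)
qed (simp_all add: blockmat_def adj_def)

definition vec_block :: "complex vec \<Rightarrow> nat \<Rightarrow> complex vec" where
  "vec_block w i = vec n (\<lambda>a. w $ (i * n + a))"

lemma vec_block_closed [simp]: "vec_block w i \<in> carrier_vec n"
  by (simp add: vec_block_def)

lemma cinner_blockmat:
  assumes B: "\<And>i j. i < m \<Longrightarrow> j < m \<Longrightarrow> B i j \<in> M" and w: "w \<in> carrier_vec (m * n)"
  shows "cinner w (blockmat m n B *\<^sub>v w)
      = (\<Sum>i<m. \<Sum>j<m. cinner (vec_block w i) (B i j *\<^sub>v vec_block w j))"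
proof -
  interpret big: square_matrices "m * n" .
  have closed: "blockmat m n B \<in> carrier_mat (m * n) (m * n)" by (simp add: blockmat_def)
  have "cinner w (blockmat m n B *\<^sub>v w)
      = (\<Sum>p<m * n. cnj (w $ p) * (\<Sum>r<m * n. blockmat m n B $$ (p,r) * w $ r))"
    using w by (simp add: big.cinner_eq_sum big.mult_mat_vec_index[OF closed]
        del: index_mult_mat_vec)
  also have "\<dots> = (\<Sum>i<m. \<Sum>a<n. cnj (w $ (i * n + a))
      * (\<Sum>j<m. \<Sum>b<n. B i j $$ (a,b) * w $ (j * n + b)))"
    unfolding sum_lessThan_mult by (simp add: index_blockmat)
  also have "\<dots> = (\<Sum>i<m. \<Sum>a<n. \<Sum>j<m. cnj (w $ (i * n + a))
      * (\<Sum>b<n. B i j $$ (a,b) * w $ (j * n + b)))"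
    by (simp add: sum_distrib_left)
  also have "\<dots> = (\<Sum>i<m. \<Sum>j<m. \<Sum>a<n. cnj (w $ (i * n + a))
      * (\<Sum>b<n. B i j $$ (a,b) * w $ (j * n + b)))"
    by (intro sum.cong refl sum.swap)
  also have "\<dots> = (\<Sum>i<m. \<Sum>j<m. cinner (vec_block w i) (B i j *\<^sub>v vec_block w j))"
    using B by (simp add: cinner_eq_sum mult_mat_vec_index vec_block_def del: index_mult_mat_vec)
  finally show ?thesis .
qed

lemma blockmat_Gram_psd:
  assumes G: "\<And>i. i < m \<Longrightarrow> G i \<in> M"
  shows "psd (m * n) (blockmat m n (\<lambda>i j. G i * adj (G j)))" (is "psd _ ?B")
proof -
  have "cinner w (?B *\<^sub>v w)
      = complex_of_real (\<Sum>k<n. (cmod (\<Sum>i<m. (adj (G i) *\<^sub>v vec_block w i) $ k))\<^sup>2)"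
    if w: "w \<in> carrier_vec (m * n)" for w
  proof -
    define u where "u i = adj (G i) *\<^sub>v vec_block w i" for i
    have u: "u i \<in> carrier_vec n" if "i < m" for i using G that by (simp add: u_def)
    have "cinner (vec_block w i) ((G i * adj (G j)) *\<^sub>v vec_block w j) = cinner (u i) (u j)"
      if "i < m" "j < m" for i j
      using G[OF that(1)] G[OF that(2)] cinner_mult_mat_vec[of "G i" "vec_block w i" "u j"]
      by (simp add: u_def assoc_mult_mat_vec[of _ n n _ n])
    then have "cinner w (?B *\<^sub>v w) = (\<Sum>i<m. \<Sum>j<m. cinner (u i) (u j))"
      using G by (simp add: cinner_blockmat[OF _ w])
    also have "\<dots> = (\<Sum>i<m. \<Sum>k<n. \<Sum>j<m. cnj (u i $ k) * u j $ k)"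
      using u by (simp add: cinner_eq_sum sum.swap[of _ "{..<n}" "{..<m}"])
    also have "\<dots> = (\<Sum>k<n. \<Sum>i<m. \<Sum>j<m. cnj (u i $ k) * u j $ k)" by (rule sum.swap)
    also have "\<dots> = (\<Sum>k<n. cnj (\<Sum>i<m. u i $ k) * (\<Sum>i<m. u i $ k))" by (simp add: sum_product)
    finally show ?thesis unfolding u_def by (simp only: cnj_mult_cmod of_real_sum of_real_power)
  qed
  moreover have "adj ?B = ?B"
    using G by (subst adj_blockmat)
      (auto simp: adj_mult blockmat_def less_mult_imp_div_less intro!: cong_mat)
  moreover have "?B \<in> carrier_mat (m * n) (m * n)" by (simp add: blockmat_def)
  ultimately show ?thesis by (auto simp: psd_def intro!: sum_nonneg)
qed

lemma
  assumes psd: "psd (2 * n) (blockmat 2 n C)" and C: "\<And>i j. C i j \<in> M"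
  shows psd_blockmat2_hermitian: "C 1 0 = adj (C 0 1)"
    and psd_blockmat2_form: "S \<in> M \<Longrightarrow> T \<in> M \<Longrightarrow> 0 \<le> Re (tr (adj S * C 0 0 * S) + tr (adj S * C 0 1 * T)
           + tr (adj T * C 1 0 * S) + tr (adj T * C 1 1 * T))"
proof -
  have "blockmat 2 n C = blockmat 2 n (\<lambda>i j. adj (C j i))"
    using psd adj_blockmat[of 2 C] C by (simp add: psd_def)
  then have "C 1 0 $$ (a,b) = adj (C 0 1) $$ (a,b)" if "a < n" "b < n" for a b
    using index_blockmat[of 1 2 0 a b C] index_blockmat[of 1 2 0 a b "\<lambda>i j. adj (C j i)"] that
    by simp
  then show "C 1 0 = adj (C 0 1)" using C by (intro M_eqI) auto
next
  assume S: "S \<in> M" and T: "T \<in> M"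
  define w where "w k = vec (2 * n) (\<lambda>i. if i < n then S $$ (i,k) else T $$ (i - n,k))" for k
  have w: "w k \<in> carrier_vec (2 * n)" for k by (simp add: w_def)
  have blocks: "vec_block (w k) 0 = col S k" "vec_block (w k) (Suc 0) = col T k" if "k < n" for k
    using that S T by (auto simp: vec_block_def w_def)
  have sum_two: "(\<Sum>i<2. f i) = f 0 + f 1" for f :: "nat \<Rightarrow> complex" by (simp add: numeral_2_eq_2)
  have "0 \<le> Re (\<Sum>k<n. cinner (w k) (blockmat 2 n C *\<^sub>v w k))"
    using psd w by (auto simp: psd_def intro!: sum_nonneg)
  also have "(\<Sum>k<n. cinner (w k) (blockmat 2 n C *\<^sub>v w k))
    = tr (adj S * C 0 0 * S) + tr (adj S * C 0 1 * T) + tr (adj T * C 1 0 * S)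
      + tr (adj T * C 1 1 * T)"
    using C S T by (simp add: cinner_blockmat[OF _ w] sum_two blocks tr_sandwich_eq_sum_cinner
        sum.distrib add.assoc)
  finally show "0 \<le> Re (tr (adj S * C 0 0 * S) + tr (adj S * C 0 1 * T)
           + tr (adj T * C 1 0 * S) + tr (adj T * C 1 1 * T))" .
qed

subsection \<open>The Kadison--Schwarz inequality and the multiplicative domain\<close>

lemma ucp_lin: "ucp n \<Phi> \<Longrightarrow> lin_map n \<Phi>" by (simp add: ucp_def)
lemma ucp_one: "ucp n \<Phi> \<Longrightarrow> \<Phi> (1\<^sub>m n) = 1\<^sub>m n" by (simp add: ucp_def)
lemma ucp_closed: "ucp n \<Phi> \<Longrightarrow> X \<in> M \<Longrightarrow> \<Phi> X \<in> M" by (simp add: ucp_lin lin_map_closed)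

lemma ucp_gram_block:
  assumes ucp: "ucp n \<Phi>" and g: "g \<in> M" and h: "h \<in> M"
  shows "\<Phi> (h * adj g) = adj (\<Phi> (g * adj h))"
    and "S \<in> M \<Longrightarrow> T \<in> M \<Longrightarrow> 0 \<le> Re (tr (adj S * \<Phi> (g * adj g) * S) + tr (adj S * \<Phi> (g * adj h) * T)
           + tr (adj T * \<Phi> (h * adj g) * S) + tr (adj T * \<Phi> (h * adj h) * T))"
proof -
  define G where "G i = (if i = (0::nat) then g else h)" for i
  have G: "G i \<in> M" for i using g h by (simp add: G_def)
  have cp_map: "cp_map n \<Phi>" using ucp by (simp add: ucp_def)
  have "psd (2 * n) (blockmat 2 n (\<lambda>i j. G i * adj (G j)))"
    using G by (intro blockmat_Gram_psd) auto
  then have image: "psd (2 * n) (blockmat 2 n (\<lambda>i j. \<Phi> (G i * adj (G j))))"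
    using cp_map[unfolded cp_map_def, rule_format, of 2 "\<lambda>i j. G i * adj (G j)"] G by simp
  note closed = ucp_closed[OF ucp]
  show "\<Phi> (h * adj g) = adj (\<Phi> (g * adj h))"
    using psd_blockmat2_hermitian[OF image] G closed by simp (simp add: G_def)
  show "0 \<le> Re (tr (adj S * \<Phi> (g * adj g) * S) + tr (adj S * \<Phi> (g * adj h) * T)
           + tr (adj T * \<Phi> (h * adj g) * S) + tr (adj T * \<Phi> (h * adj h) * T))" if "S \<in> M" "T \<in> M"
    using psd_blockmat2_form[OF image _ that] G closed by simp (simp add: G_def)
qed

lemma ucp_offdiagonal_bound:
  assumes ucp: "ucp n \<Phi>" and closed_args: "g \<in> M" "h \<in> M" "S \<in> M" "T \<in> M"
  shows "2 * cmod (tr (adj S * \<Phi> (g * adj h) * T))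
    \<le> Re (tr (adj S * \<Phi> (g * adj g) * S)) + Re (tr (adj T * \<Phi> (h * adj h) * T))"
proof -
  have closed: "\<Phi> X \<in> M" if "X \<in> M" for X using ucp_closed[OF ucp that] .
  define t where "t = tr (adj S * \<Phi> (g * adj h) * T)"
  obtain \<omega> where \<omega>: "cmod \<omega> = 1" "\<omega> * t = - of_real (cmod t)" by (rule exists_phase)
  let ?T = "\<omega> \<cdot>\<^sub>m T"
  have upper: "tr (adj S * \<Phi> (g * adj h) * ?T) = - of_real (cmod t)"
    using closed_args closed \<omega>(2) by (simp add: M_smult tr_smult t_def)
  have "tr (adj ?T * \<Phi> (h * adj g) * S) = cnj (tr (adj S * \<Phi> (g * adj h) * ?T))"
    unfolding ucp_gram_block(1)[OF ucp closed_args(1,2)]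
    using closed_args closed by (subst tr_adj[symmetric]) (auto simp: adj_mult M_assoc)
  then have lower: "tr (adj ?T * \<Phi> (h * adj g) * S) = - of_real (cmod t)" by (simp add: upper)
  have "tr (adj ?T * \<Phi> (h * adj h) * ?T) = cnj \<omega> * \<omega> * tr (adj T * \<Phi> (h * adj h) * T)"
    using closed_args closed by (simp add: adj_smult M_smult tr_smult)
  then have diagonal: "tr (adj ?T * \<Phi> (h * adj h) * ?T) = tr (adj T * \<Phi> (h * adj h) * T)"
    by (simp add: cnj_mult_cmod \<omega>(1))
  show ?thesis
    using ucp_gram_block(2)[OF ucp closed_args(1,2,3), of ?T] closed_args(4)
    by (simp add: upper lower diagonal flip: t_def)
qed

lemma ucp_adj: "ucp n \<Phi> \<Longrightarrow> X \<in> M \<Longrightarrow> \<Phi> (adj X) = adj (\<Phi> X)"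
  using ucp_gram_block(1)[of \<Phi> X "1\<^sub>m n"] by simp

lemma ucp_psd: assumes ucp: "ucp n \<Phi>" and A: "psd n A" shows "psd n (\<Phi> A)"
  unfolding psd_iff_tr hermitian_def
proof (intro conjI ballI)
  note A_hermitian = psdD(1,2)[OF A]
  show "\<Phi> A \<in> M" "adj (\<Phi> A) = \<Phi> A"
    using ucp_closed[OF ucp A_hermitian(1)] ucp_adj[OF ucp A_hermitian(1)] A_hermitian by auto
  obtain B where B: "psd n B" "A = B * B" using psd_sqrt[OF A] by blast
  note B_hermitian = psdD(1,2)[OF B(1)]
  fix S assume S: "S \<in> M"
  show "0 \<le> Re (tr (adj S * \<Phi> A * S))"
    using ucp_gram_block(2)[OF ucp B_hermitian(1) zero_carrier_mat S zero_carrier_mat] S B_hermitian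
      B ucp lin_map_zero[OF ucp_lin[OF ucp]]
    by (simp add: ucp_closed)
qed

definition Schwarz_defect ::
  "(complex mat \<Rightarrow> complex mat) \<Rightarrow> complex mat \<Rightarrow> complex mat \<Rightarrow> complex mat" where
  "Schwarz_defect \<Phi> X Y = \<Phi> (adj X * Y) - adj (\<Phi> X) * \<Phi> Y"

lemma Schwarz_defect_closed: "ucp n \<Phi> \<Longrightarrow> X \<in> M \<Longrightarrow> Y \<in> M \<Longrightarrow> Schwarz_defect \<Phi> X Y \<in> M"
  by (simp add: Schwarz_defect_def ucp_closed)

lemma adj_Schwarz_defect:
  "ucp n \<Phi> \<Longrightarrow> X \<in> M \<Longrightarrow> Y \<in> M \<Longrightarrow> adj (Schwarz_defect \<Phi> X Y) = Schwarz_defect \<Phi> Y X"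
  using ucp_adj[of \<Phi> "adj X * Y"] by (simp add: Schwarz_defect_def adj_minus adj_mult ucp_closed)

lemma Kadison_Schwarz:
  assumes ucp: "ucp n \<Phi>" and X: "X \<in> M" shows "psd n (Schwarz_defect \<Phi> X X)"
  unfolding psd_iff_tr hermitian_def
proof (intro conjI ballI)
  show "Schwarz_defect \<Phi> X X \<in> M" "adj (Schwarz_defect \<Phi> X X) = Schwarz_defect \<Phi> X X"
    using Schwarz_defect_closed[OF ucp X X] adj_Schwarz_defect[OF ucp X X] by auto
  have closed: "\<Phi> X \<in> M" "\<Phi> (adj X) \<in> M" "\<Phi> (adj X * X) \<in> M" using ucp X by (auto simp: ucp_closed)
  fix T assume T: "T \<in> M"
  let ?S = "(- 1) \<cdot>\<^sub>m (\<Phi> X * T)"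
  have S: "?S \<in> M" and adjS: "adj ?S = (- 1) \<cdot>\<^sub>m (adj T * \<Phi> (adj X))"
    using closed T ucp_adj[OF ucp X] by (auto simp: adj_smult adj_mult)
  have "0 \<le> Re (tr (adj ?S * \<Phi> (1\<^sub>m n) * ?S) + tr (adj ?S * \<Phi> X * T)
           + tr (adj T * \<Phi> (adj X) * ?S) + tr (adj T * \<Phi> (adj X * X) * T))"
    using ucp_gram_block(2)[OF ucp, of "1\<^sub>m n" "adj X" ?S T] X T S by simp
  also have "tr (adj ?S * \<Phi> (1\<^sub>m n) * ?S) + tr (adj ?S * \<Phi> X * T)
           + tr (adj T * \<Phi> (adj X) * ?S) + tr (adj T * \<Phi> (adj X * X) * T)
     = tr (adj T * \<Phi> (adj X * X) * T) - tr (adj T * (\<Phi> (adj X) * \<Phi> X) * T)"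
    unfolding adjS using closed T ucp by (simp add: ucp_one M_smult tr_smult M_assoc)
  also have "\<dots> = tr (adj T * Schwarz_defect \<Phi> X X * T)"
    using closed T ucp_adj[OF ucp X] by (simp add: Schwarz_defect_def M_distrib tr_minus)
  finally show "0 \<le> Re (tr (adj T * Schwarz_defect \<Phi> X X * T))" .
qed

lemma Schwarz_defect_expand:
  assumes ucp: "ucp n \<Phi>" and Y: "Y \<in> M" and A: "A \<in> M"
  shows "Schwarz_defect \<Phi> (Y + c \<cdot>\<^sub>m A) (Y + c \<cdot>\<^sub>m A)
      = Schwarz_defect \<Phi> Y Y + c \<cdot>\<^sub>m Schwarz_defect \<Phi> Y A
    + cnj c \<cdot>\<^sub>m Schwarz_defect \<Phi> A Y + (c * cnj c) \<cdot>\<^sub>m Schwarz_defect \<Phi> A A"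
  unfolding Schwarz_defect_def using ucp Y A ucp_lin[OF ucp]
  by (intro M_eqI) (simp_all add: adj_add adj_smult M_distrib M_smult lin_map_add lin_map_smult
      ucp_closed index_add index_minus index_smult algebra_simps)

lemma zero_if_quadratic_form_zero:
  assumes D: "D \<in> M" and zero: "\<And>T. T \<in> M \<Longrightarrow> tr (adj T * D * T) = 0"
  shows "D = 0\<^sub>m n n"
proof -
  have polarized: "c * tr (adj S * D * T) + cnj c * tr (adj T * D * S) = 0"
    if "S \<in> M" "T \<in> M" for S T c
  proof -
    have "tr (adj (S + c \<cdot>\<^sub>m T) * D * (S + c \<cdot>\<^sub>m T)) = tr (adj S * D * S) + c * tr (adj S * D * T)
      + cnj c * tr (adj T * D * S) + c * cnj c * tr (adj T * D * T)"
      using that D by (simp add: adj_add adj_smult M_distrib M_smult tr_add tr_smult distrib_left)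
    then show ?thesis using zero that by simp
  qed
  have "tr (adj S * D * T) = 0" if "S \<in> M" "T \<in> M" for S T
    using polarized[OF that, of 1] polarized[OF that, of \<i>] by (simp add: complex_eq_iff)
  from this[of D "1\<^sub>m n"] have "hs_norm D = 0" using D by (simp add: tr_gram)
  then show ?thesis using D hs_norm_eq_0 by blast
qed

lemma multiplicative_domain:
  assumes ucp: "ucp n \<Phi>" and A: "A \<in> M" and X: "X \<in> M"
    and gram_preserved: "\<Phi> (adj A * A) = adj (\<Phi> A) * \<Phi> A"
  shows "\<Phi> (X * A) = \<Phi> X * \<Phi> A"
proof -
  define Y where "Y = adj X"
  have Y: "Y \<in> M" using X by (simp add: Y_def)
  let ?D = "Schwarz_defect \<Phi>"
  note D = Schwarz_defect_closed[OF ucp]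
  have DAA: "?D A A = 0\<^sub>m n n"
    using gram_preserved A ucp by (simp add: Schwarz_defect_def ucp_closed minus_r_inv_mat)
  have "?D Y A = 0\<^sub>m n n"
  proof (rule zero_if_quadratic_form_zero)
    fix T assume T: "T \<in> M"
    show "tr (adj T * ?D Y A * T) = 0"
    proof (rule complex_affine_nonneg_imp_zero)
      fix c :: complex
      let ?Z = "Y + c \<cdot>\<^sub>m A"
      have Z: "?Z \<in> M" using Y A by simp
      have "tr (adj T * ?D ?Z ?Z * T)
          = tr (adj T * ?D Y Y * T) + c * tr (adj T * ?D Y A * T) + cnj c * tr (adj T * ?D A Y * T)"
        unfolding Schwarz_defect_expand[OF ucp Y A] using T D Y A
        by (simp add: M_distrib M_smult tr_add tr_smult DAA)
      also have "tr (adj T * ?D A Y * T) = cnj (tr (adj T * ?D Y A * T))"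
        using T D[OF Y A] adj_Schwarz_defect[OF ucp Y A]
        by (subst tr_adj[symmetric]) (simp_all add: adj_mult M_assoc)
      finally have "Re (tr (adj T * ?D ?Z ?Z * T))
          = Re (tr (adj T * ?D Y Y * T)) + 2 * Re (c * tr (adj T * ?D Y A * T))"
        by simp
      then show "0 \<le> Re (tr (adj T * ?D Y Y * T)) + 2 * Re (c * tr (adj T * ?D Y A * T))"
        using psdD(4)[OF Kadison_Schwarz[OF ucp Z] T] by simp
    qed
  qed (rule D[OF Y A])
  then have "\<Phi> (X * A) - \<Phi> X * \<Phi> A = 0\<^sub>m n n"
    using X A ucp_adj[OF ucp X] by (simp add: Schwarz_defect_def Y_def)
  then show ?thesis by (rule minus_eq_zeroD) (use X A ucp in \<open>simp_all add: ucp_closed\<close>)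
qed

lemma tr_psd_mult_nonneg: assumes "psd n A" "psd n B" shows "0 \<le> Re (tr (A * B))"
proof -
  obtain C where C: "psd n C" "B = C * C" using psd_sqrt[OF assms(2)] by blast
  note C_hermitian = psdD(1,2)[OF C(1)] and A_closed = psdD(1)[OF assms(1)]
  have "tr (A * B) = tr (C * (A * C))"
    using tr_mult_commute[of "A * C" C] C C_hermitian A_closed by (simp add: M_assoc)
  then show ?thesis using psdD(4)[OF assms(1) C_hermitian(1)] C_hermitian A_closed
    by (simp add: M_assoc)
qed

lemma tr_pd_mult_eq_0D: assumes "pd n A" "psd n B" "Re (tr (A * B)) = 0" shows "B = 0\<^sub>m n n"
proof -
  obtain C where C: "psd n C" "B = C * C" using psd_sqrt[OF assms(2)] by blast
  note C_hermitian = psdD(1,2)[OF C(1)] and A_closed = psdD(1)[OF pdD[OF assms(1)]]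
  have "tr (A * B) = tr (adj C * A * C)"
    using tr_mult_commute[of "A * C" C] C C_hermitian A_closed by (simp add: M_assoc)
  then have "C = 0\<^sub>m n n" using assms(1,3) C_hermitian unfolding pd_iff_tr by force
  then show ?thesis using C by simp
qed

lemma pd_minus_scalar_psd:
  assumes "pd n A" obtains \<delta> where "0 < \<delta>" "psd n (A - complex_of_real \<delta> \<cdot>\<^sub>m 1\<^sub>m n)"
proof -
  obtain U l where U: "unitary n U" "A = unitary_diag U (\<lambda>i. complex_of_real (l i))"
    and l: "\<And>i. i < n \<Longrightarrow> 0 < l i"
    using psd_spectral[OF pdD[OF assms]] assms by metis
  define \<delta> where "\<delta> = Min (insert 1 (l ` {..<n}))"
  have \<delta>: "0 < \<delta>" using l by (auto simp: \<delta>_def)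
  have \<delta>_le: "\<delta> \<le> l i" if "i < n" for i using that by (auto simp: \<delta>_def intro!: Min_le)
  have U_closed: "U \<in> M" using U by (simp add: unitaryD)
  have "A - complex_of_real \<delta> \<cdot>\<^sub>m 1\<^sub>m n = unitary_diag U (\<lambda>i. complex_of_real (l i))
      + (- complex_of_real \<delta>) \<cdot>\<^sub>m unitary_diag U (\<lambda>i. 1)"
    using U U_closed by (simp add: unitary_diag_one minus_M)
  also have "\<dots> = unitary_diag U (\<lambda>i. complex_of_real (l i - \<delta>))"
    using U_closed by (simp add: unitary_diag_smult unitary_diag_add)
  finally show ?thesis using that[OF \<delta>] unitary_diag_psd[OF U(1), of "\<lambda>i. l i - \<delta>"] \<delta>_le by simp
qed

lemma pdI_minus_scalar:
  assumes \<delta>: "0 < \<delta>" and A: "hermitian A" and shifted_psd: "psd n (A - complex_of_real \<delta> \<cdot>\<^sub>m 1\<^sub>m n)"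
  shows "pd n A"
  unfolding pd_iff_tr
proof (intro conjI ballI impI A)
  fix S assume S: "S \<in> M" "S \<noteq> 0\<^sub>m n n"
  have "0 \<le> Re (tr (adj S * (A - complex_of_real \<delta> \<cdot>\<^sub>m 1\<^sub>m n) * S))"
    using psdD(4)[OF shifted_psd S(1)] .
  also have "\<dots> = Re (tr (adj S * A * S)) - \<delta> * (hs_norm S)\<^sup>2"
    using S hermitianD(1)[OF A]
    by (simp add: M_distrib M_smult tr_minus tr_smult tr_gram flip: of_real_power of_real_mult)
  finally have "\<delta> * (hs_norm S)\<^sup>2 \<le> Re (tr (adj S * A * S))" by simp
  moreover have "0 < \<delta> * (hs_norm S)\<^sup>2"
    using \<delta> hs_norm_eq_0[OF S(1)] S(2) by (auto intro!: mult_pos_pos)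
  ultimately show "0 < Re (tr (adj S * A * S))" by linarith
qed

end

section \<open>The decoherence-free algebra and its conditional expectation\<close>

lemma strict_mono_double_gap:
  fixes r :: "nat \<Rightarrow> nat"
  assumes r: "strict_mono r" shows "k \<le> r (2 * k) - r k"
proof -
  have "r k + d \<le> r (k + d)" for d
    by (induction d) (use r in \<open>auto simp: strict_mono_Suc_iff Suc_le_eq intro: le_less_trans\<close>)
  from this[of k] show ?thesis by (simp add: mult_2)
qed

locale decohering_qms = square_matrices +
  fixes L :: "complex mat \<Rightarrow> complex mat" and \<rho> :: "complex mat"
  assumes n_pos: "0 < n"
    and qms: "qms n L"
    and rho: "pd n \<rho>"
    and tr_rho_P: "\<And>t X. 0 \<le> t \<Longrightarrow> X \<in> M \<Longrightarrow> tr (\<rho> * sg L t X) = tr (\<rho> * X)"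
begin

abbreviation P :: "real \<Rightarrow> complex mat \<Rightarrow> complex mat" where "P \<equiv> sg L"
abbreviation N :: "complex mat set" where "N \<equiv> dfa n L"

lemma lin_map_L: "lin_map n L" using qms by (simp add: qms_def)

lemma P_closed [simp]: "X \<in> M \<Longrightarrow> P t X \<in> M" by (simp add: sg_eq_superop_exp)

lemma P_add: "X \<in> M \<Longrightarrow> P s (P t X) = P (s + t) X"
  by (simp add: sg_eq_superop_exp superop_exp_add[OF lin_map_L])

lemma P_ucp: "0 \<le> t \<Longrightarrow> ucp n (P t)" using qms by (simp add: qms_def)

lemma P_lin: "0 \<le> t \<Longrightarrow> lin_map n (P t)" using P_ucp ucp_lin by blast

lemma rho_M [simp]: "\<rho> \<in> M" using rho by (simp add: pdD psdD)

lemma P_adj: "0 \<le> t \<Longrightarrow> X \<in> M \<Longrightarrow> P t (adj X) = adj (P t X)" using P_ucp ucp_adj by blast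

lemma dfa_carrier: "A \<in> N \<Longrightarrow> A \<in> M" by (simp add: dfa_def)

lemma P_mult_dfa: assumes "A \<in> N" "X \<in> M" "0 \<le> t" shows "P t (X * A) = P t X * P t A"
  using assms by (intro multiplicative_domain P_ucp) (auto simp: dfa_def)

lemma dfa_adj: "A \<in> N \<Longrightarrow> adj A \<in> N"
  using P_adj by (auto simp: dfa_def)

lemma P_dfa_mult: assumes "A \<in> N" "X \<in> M" "0 \<le> t" shows "P t (A * X) = P t A * P t X"
proof -
  note A_closed = dfa_carrier[OF assms(1)]
  have "P t (adj X * adj A) = P t (adj X) * P t (adj A)"
    using P_mult_dfa[OF dfa_adj[OF assms(1)], of "adj X"] assms by simp
  then have "P t (adj (A * X)) = adj (P t A * P t X)"
    using A_closed assms by (simp add: adj_mult P_adj)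
  then have "adj (P t (A * X)) = adj (P t A * P t X)" using A_closed assms by (simp add: P_adj)
  then show ?thesis by (metis adj_adj)
qed

lemma dfaI:
  assumes "A \<in> M" "\<And>t. 0 \<le> t \<Longrightarrow> P t (adj A * A) = adj (P t A) * P t A"
    "\<And>t. 0 \<le> t \<Longrightarrow> P t (A * adj A) = P t A * adj (P t A)"
  shows "A \<in> N" using assms by (simp add: dfa_def)

lemma dfaD:
  assumes "A \<in> N" "0 \<le> t"
  shows "P t (adj A * A) = adj (P t A) * P t A" "P t (A * adj A) = P t A * adj (P t A)"
  using assms by (simp_all add: dfa_def)

lemma dfa_one: "1\<^sub>m n \<in> N"
  by (rule dfaI) (auto simp: ucp_one[OF P_ucp])

lemma P_gram_dfa_mult:
  assumes A: "A \<in> N" and B: "B \<in> N" and t: "0 \<le> t"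
  shows "P t (adj (A * B) * (A * B)) = adj (P t (A * B)) * P t (A * B)"
proof -
  note closed = dfa_carrier[OF A] dfa_carrier[OF B]
  have "P t (adj (A * B) * (A * B)) = P t (adj B * (adj A * A * B))"
    using closed by (simp add: adj_mult M_assoc)
  also have "\<dots> = P t (adj B) * (P t (adj A * A) * P t B)"
    using P_dfa_mult[OF dfa_adj[OF B] _ t, of "adj A * A * B"] P_mult_dfa[OF B _ t, of "adj A * A"]
      closed
    by simp
  also have "\<dots> = adj (P t A * P t B) * (P t A * P t B)"
    using dfaD[OF A t] t closed by (simp add: P_adj adj_mult M_assoc)
  finally show ?thesis using P_dfa_mult[OF A closed(2) t] by simp
qed

lemma dfa_mult:
  assumes A: "A \<in> N" and B: "B \<in> N" shows "A * B \<in> N"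
proof (rule dfaI)
  note closed = dfa_carrier[OF A] dfa_carrier[OF B]
  show "A * B \<in> M" using closed by simp
  fix t :: real assume t: "0 \<le> t"
  show "P t (adj (A * B) * (A * B)) = adj (P t (A * B)) * P t (A * B)"
    by (rule P_gram_dfa_mult[OF A B t])
  show "P t ((A * B) * adj (A * B)) = P t (A * B) * adj (P t (A * B))"
    using P_gram_dfa_mult[OF dfa_adj[OF B] dfa_adj[OF A] t] closed t
    by (simp add: adj_mult flip: P_adj)
qed

lemma dfa_smult: assumes "A \<in> N" shows "c \<cdot>\<^sub>m A \<in> N"
  using dfaD[OF assms] dfa_carrier[OF assms]
  by (intro dfaI) (auto simp: adj_smult M_smult lin_map_smult[OF P_lin])

lemma P_gram_dfa_add:
  assumes A: "A \<in> N" and B: "B \<in> N" and t: "0 \<le> t"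
  shows "P t (adj (A + B) * (A + B)) = adj (P t (A + B)) * P t (A + B)"
  using P_mult_dfa[OF A _ t] P_mult_dfa[OF B _ t] dfa_carrier[OF A] dfa_carrier[OF B] t
  by (simp add: adj_add M_distrib lin_map_add[OF P_lin] P_adj)

lemma dfa_add:
  assumes A: "A \<in> N" and B: "B \<in> N" shows "A + B \<in> N"
proof (rule dfaI)
  note closed = dfa_carrier[OF A] dfa_carrier[OF B]
  show "A + B \<in> M" using closed by simp
  fix t :: real assume t: "0 \<le> t"
  show "P t (adj (A + B) * (A + B)) = adj (P t (A + B)) * P t (A + B)"
    by (rule P_gram_dfa_add[OF A B t])
  show "P t ((A + B) * adj (A + B)) = P t (A + B) * adj (P t (A + B))"
    using P_gram_dfa_add[OF dfa_adj[OF A] dfa_adj[OF B] t] closed t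
    by (simp add: adj_add flip: P_adj)
qed

lemma dfa_minus: "A \<in> N \<Longrightarrow> B \<in> N \<Longrightarrow> A - B \<in> N"
  by (simp add: minus_M dfa_carrier dfa_add dfa_smult)

lemma dfa_mcfun: "hermitian A \<Longrightarrow> A \<in> N \<Longrightarrow> mcfun f A \<in> N"
  by (rule mcfun_subalgebra[of N]) (auto simp: dfa_carrier dfa_one dfa_add dfa_mult dfa_smult)

lemma dfa_mcpow: "psd n A \<Longrightarrow> A \<in> N \<Longrightarrow> mcpow z A \<in> N"
  by (simp add: mcpow_def dfa_mcfun psdD)

definition rho_sqnorm :: "complex mat \<Rightarrow> real" where
  "rho_sqnorm X = Re (tr (\<rho> * (adj X * X))) + Re (tr (\<rho> * (X * adj X)))"

lemma rho_gram_nonneg: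
  "X \<in> M \<Longrightarrow> 0 \<le> Re (tr (\<rho> * (adj X * X)))" "X \<in> M \<Longrightarrow> 0 \<le> Re (tr (\<rho> * (X * adj X)))"
  using tr_psd_mult_nonneg[OF pdD[OF rho]] psd_gram[of X] psd_gram[of "adj X"] by auto

lemma rho_sqnorm_lower_bound: obtains \<delta> where "0 < \<delta>" "\<And>X. X \<in> M \<Longrightarrow> \<delta> * (hs_norm X)\<^sup>2 \<le> rho_sqnorm X"
proof -
  obtain \<delta> where \<delta>: "0 < \<delta>" "psd n (\<rho> - complex_of_real \<delta> \<cdot>\<^sub>m 1\<^sub>m n)"
    using pd_minus_scalar_psd[OF rho] by blast
  have "\<delta> * (hs_norm X)\<^sup>2 \<le> rho_sqnorm X" if X: "X \<in> M" for X
  proof -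
    have "0 \<le> Re (tr (adj X * (\<rho> - complex_of_real \<delta> \<cdot>\<^sub>m 1\<^sub>m n) * X))" using psdD(4)[OF \<delta>(2) X] .
    also have "adj X * (\<rho> - complex_of_real \<delta> \<cdot>\<^sub>m 1\<^sub>m n) * X
        = adj X * (\<rho> * X) - complex_of_real \<delta> \<cdot>\<^sub>m (adj X * X)"
      using X by (simp add: M_distrib M_smult M_assoc)
    also have "Re (tr \<dots>) = Re (tr (adj X * (\<rho> * X))) - \<delta> * (hs_norm X)\<^sup>2"
      using X by (simp add: tr_minus tr_smult tr_gram flip: of_real_power of_real_mult)
    also have "tr (adj X * (\<rho> * X)) = tr (\<rho> * (X * adj X))"
      using X tr_mult_commute[of "adj X" "\<rho> * X"] by (simp add: M_assoc)
    finally show ?thesis using rho_gram_nonneg[OF X] by (simp add: rho_sqnorm_def)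
  qed
  then show ?thesis using that \<delta>(1) by blast
qed

lemma rho_sqnorm_eq_0:
  assumes X: "X \<in> M" "rho_sqnorm X = 0" shows "X = 0\<^sub>m n n"
proof -
  obtain \<delta> where "0 < \<delta>" "\<delta> * (hs_norm X)\<^sup>2 \<le> rho_sqnorm X" using rho_sqnorm_lower_bound X by metis
  then have "hs_norm X = 0" using X by (simp add: mult_le_0_iff)
  then show ?thesis using X hs_norm_eq_0 by blast
qed

lemma rho_gram_P_le:
  assumes "X \<in> M" "0 \<le> t"
  shows "Re (tr (\<rho> * (adj (P t X) * P t X))) \<le> Re (tr (\<rho> * (adj X * X)))"
    and "Re (tr (\<rho> * (adj (P t X) * P t X))) = Re (tr (\<rho> * (adj X * X))) \<Longrightarrow>
        P t (adj X * X) = adj (P t X) * P t X"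
proof -
  let ?D = "P t (adj X * X) - adj (P t X) * P t X"
  have defect_psd: "psd n ?D"
    using Kadison_Schwarz[OF P_ucp[OF assms(2)] assms(1)] by (simp add: Schwarz_defect_def)
  have "tr (\<rho> * ?D) = tr (\<rho> * (adj X * X)) - tr (\<rho> * (adj (P t X) * P t X))"
    using assms by (simp add: M_distrib tr_minus tr_rho_P)
  then have tr_defect: "Re (tr (\<rho> * ?D))
      = Re (tr (\<rho> * (adj X * X))) - Re (tr (\<rho> * (adj (P t X) * P t X)))" by simp
  show "Re (tr (\<rho> * (adj (P t X) * P t X))) \<le> Re (tr (\<rho> * (adj X * X)))"
    using tr_psd_mult_nonneg[OF pdD[OF rho] defect_psd] tr_defect by simp
  assume "Re (tr (\<rho> * (adj (P t X) * P t X))) = Re (tr (\<rho> * (adj X * X)))"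
  then have "?D = 0\<^sub>m n n" using tr_pd_mult_eq_0D[OF rho defect_psd] tr_defect by simp
  then show "P t (adj X * X) = adj (P t X) * P t X" by (rule minus_eq_zeroD) (use assms in simp_all)
qed

lemma rho_sqnorm_P_le: assumes "X \<in> M" "0 \<le> t" shows "rho_sqnorm (P t X) \<le> rho_sqnorm X"
  using rho_gram_P_le(1)[OF assms] rho_gram_P_le(1)[of "adj X" t] assms
  by (simp add: rho_sqnorm_def P_adj)

lemma rho_sqnorm_P_antimono:
  assumes "X \<in> M" "0 \<le> s" "s \<le> t" shows "rho_sqnorm (P t X) \<le> rho_sqnorm (P s X)"
  using rho_sqnorm_P_le[of "P s X" "t - s"] assms by (simp add: P_add)

lemma dfa_iff_rho_sqnorm:
  assumes X: "X \<in> M" shows "X \<in> N \<longleftrightarrow> (\<forall>t\<ge>0. rho_sqnorm (P t X) = rho_sqnorm X)"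
proof
  assume "X \<in> N"
  then show "\<forall>t\<ge>0. rho_sqnorm (P t X) = rho_sqnorm X"
    using dfaD[of X] X tr_rho_P[of _ "adj X * X"] tr_rho_P[of _ "X * adj X"]
    by (auto simp: rho_sqnorm_def)
next
  assume preserved: "\<forall>t\<ge>0. rho_sqnorm (P t X) = rho_sqnorm X"
  have "P t (adj X * X) = adj (P t X) * P t X \<and> P t (X * adj X) = P t X * adj (P t X)"
    if t: "0 \<le> t" for t
  proof -
    have "rho_sqnorm (P t X) = rho_sqnorm X" using preserved t by simp
    then have "Re (tr (\<rho> * (adj (P t X) * P t X))) = Re (tr (\<rho> * (adj X * X)))"
      "Re (tr (\<rho> * (adj (P t (adj X)) * P t (adj X)))) = Re (tr (\<rho> * (adj (adj X) * adj X)))"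
      using rho_gram_P_le(1)[OF X t] rho_gram_P_le(1)[of "adj X" t] X t
      by (simp_all add: rho_sqnorm_def P_adj)
    then show ?thesis using rho_gram_P_le(2)[OF X t] rho_gram_P_le(2)[of "adj X" t] X t
      by (simp add: P_adj)
  qed
  then show "X \<in> N" using X by (intro dfaI) auto
qed

lemma rho_sqnorm_tendsto:
  assumes "\<And>t. X t \<in> M" "Y \<in> M" "mlim X Y F" shows "((\<lambda>t. rho_sqnorm (X t)) \<longlongrightarrow> rho_sqnorm Y) F"
  unfolding rho_sqnorm_def
  by (intro tendsto_add tendsto_Re mlim_tr mlim_mult mlim_adj mlim_const) (use assms in auto)

lemma P_bounded: assumes "X \<in> M" obtains B where "\<And>t. 0 \<le> t \<Longrightarrow> hs_norm (P t X) \<le> B"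
proof -
  obtain \<delta> where \<delta>: "0 < \<delta>" "\<And>X. X \<in> M \<Longrightarrow> \<delta> * (hs_norm X)\<^sup>2 \<le> rho_sqnorm X"
    using rho_sqnorm_lower_bound by metis
  have "hs_norm (P t X) \<le> sqrt (rho_sqnorm X / \<delta>)" if "0 \<le> t" for t
  proof (rule real_le_rsqrt)
    have "\<delta> * (hs_norm (P t X))\<^sup>2 \<le> rho_sqnorm X"
      using \<delta>(2)[of "P t X"] rho_sqnorm_P_le[OF assms that] assms by simp
    then show "(hs_norm (P t X))\<^sup>2 \<le> rho_sqnorm X / \<delta>" using \<delta>(1) by (simp add: field_simps)
  qed
  then show ?thesis using that by blast
qed

subsection \<open>Matrices that the semigroup sends to zero\<close>

definition null :: "complex mat \<Rightarrow> bool" where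
  "null X \<longleftrightarrow> X \<in> M \<and> mlim (\<lambda>t. P t X) (0\<^sub>m n n) at_top"

lemma nullD: "null X \<Longrightarrow> X \<in> M" "null X \<Longrightarrow> mlim (\<lambda>t. P t X) (0\<^sub>m n n) at_top"
  by (simp_all add: null_def)

lemma null_iff_hs_norm: "X \<in> M \<Longrightarrow> null X \<longleftrightarrow> ((\<lambda>t. hs_norm (P t X)) \<longlongrightarrow> 0) at_top"
  by (simp add: null_def mlim_zero_iff)

lemma null_zero: "null (0\<^sub>m n n)"
proof -
  have "P t (0\<^sub>m n n) = 0\<^sub>m n n" for t
    by (simp add: sg_eq_superop_exp lin_map_zero[OF lin_map_superop_exp[OF lin_map_L]])
  then show ?thesis by (simp add: null_iff_hs_norm)
qed

lemma null_minus:
  assumes X: "null X" and Y: "null Y"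
  shows "null (X - Y)"
proof -
  note closed = nullD(1)[OF X] nullD(1)[OF Y]
  have "((\<lambda>t. P t X $$ (i,j) - P t Y $$ (i,j)) \<longlongrightarrow> 0 - 0) at_top" if "i < n" "j < n" for i j
    using mlimD[OF nullD(2)[OF X] that] mlimD[OF nullD(2)[OF Y] that] that
    by (intro tendsto_diff) simp_all
  moreover have "P t (X - Y) = P t X - P t Y" for t
    using closed
    by (simp add: sg_eq_superop_exp lin_map_minus[OF lin_map_superop_exp[OF lin_map_L]])
  ultimately show ?thesis using closed by (simp add: null_def mlim_def index_minus)
qed

lemma null_adj:
  assumes X: "null X" shows "null (adj X)"
proof -
  have "\<forall>\<^sub>F t in at_top. hs_norm (P t X) = hs_norm (P t (adj X))"
    using eventually_ge_at_top[of 0]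
    by eventually_elim (simp add: nullD(1)[OF X] P_adj hs_norm_adj)
  then show ?thesis
    using X nullD(1)[OF X] Lim_transform_eventually by (fastforce simp: null_iff_hs_norm)
qed

lemma null_bimodule:
  assumes A: "A \<in> N" and B: "B \<in> N" and X: "null X"
  shows "null (A * X * B)"
proof -
  note closed = dfa_carrier[OF A] dfa_carrier[OF B] nullD(1)[OF X]
  obtain a where a: "\<And>t. 0 \<le> t \<Longrightarrow> hs_norm (P t A) \<le> a" using P_bounded[OF closed(1)] by blast
  obtain b where b: "\<And>t. 0 \<le> t \<Longrightarrow> hs_norm (P t B) \<le> b" using P_bounded[OF closed(2)] by blast
  have ab_nonneg: "0 \<le> a" "0 \<le> b"
    using order_trans[OF hs_norm_nonneg a[of 0]] order_trans[OF hs_norm_nonneg b[of 0]] by simp_all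
  have norm_le: "hs_norm (P t (A * X * B)) \<le> a * hs_norm (P t X) * b" if t: "0 \<le> t" for t
  proof -
    have "P t (A * X * B) = P t A * P t X * P t B"
      using P_mult_dfa[OF B, of "A * X" t] P_dfa_mult[OF A closed(3) t] t closed by simp
    then have "hs_norm (P t (A * X * B)) \<le> hs_norm (P t A * P t X) * hs_norm (P t B)"
      using hs_norm_submult closed by simp
    also have "\<dots> \<le> (hs_norm (P t A) * hs_norm (P t X)) * hs_norm (P t B)"
      using hs_norm_submult closed by (intro mult_right_mono) auto
    also have "\<dots> \<le> (a * hs_norm (P t X)) * b"
      using a[OF t] b[OF t] ab_nonneg by (intro mult_mono) auto
    finally show ?thesis .
  qed
  have "((\<lambda>t. a * hs_norm (P t X) * b) \<longlongrightarrow> a * 0 * b) at_top"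
    using X closed by (intro tendsto_intros) (simp add: null_iff_hs_norm)
  then have lim: "((\<lambda>t. a * hs_norm (P t X) * b) \<longlongrightarrow> 0) at_top" by simp
  have "((\<lambda>t. hs_norm (P t (A * X * B))) \<longlongrightarrow> 0) at_top"
    by (rule tendsto_sandwich[OF _ _ tendsto_const lim])
      (use norm_le in \<open>auto simp: eventually_at_top_linorder\<close>)
  then show ?thesis using closed by (simp add: null_iff_hs_norm)
qed

lemma dfa_null_imp_zero:
  assumes A: "A \<in> N" and null: "null A" shows "A = 0\<^sub>m n n"
proof -
  note A_closed = dfa_carrier[OF A]
  have "((\<lambda>t. rho_sqnorm (P t A)) \<longlongrightarrow> rho_sqnorm (0\<^sub>m n n)) at_top"
    by (rule rho_sqnorm_tendsto) (use A_closed nullD[OF null] in auto)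
  moreover have "((\<lambda>t. rho_sqnorm (P t A)) \<longlongrightarrow> rho_sqnorm A) at_top"
    by (rule tendsto_eventually)
      (use A dfa_iff_rho_sqnorm A_closed in \<open>auto simp: eventually_at_top_linorder\<close>)
  ultimately have "rho_sqnorm A = rho_sqnorm (0\<^sub>m n n)"
    using tendsto_unique trivial_limit_at_top_linorder by blast
  then show ?thesis using rho_sqnorm_eq_0 A_closed by (simp add: rho_sqnorm_def)
qed

lemma dfa_component_unique:
  assumes A: "A \<in> N" "null (X - A)" and B: "B \<in> N" "null (X - B)" and X: "X \<in> M"
  shows "A = B"
proof (rule minus_eq_zeroD)
  show closed: "A \<in> M" "B \<in> M" using A B dfa_carrier by auto
  have "A - B = (X - B) - (X - A)" using closed X by (intro M_eqI) (auto simp: index_minus)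
  then have "null (A - B)" using null_minus[OF B(2) A(2)] by simp
  then show "A - B = 0\<^sub>m n n" using dfa_null_imp_zero dfa_minus A(1) B(1) by blast
qed

lemma null_if_tendsto_0_along:
  assumes X: "X \<in> M" and r: "\<And>k. 0 \<le> r k" and lim: "mlim (\<lambda>k. P (r k) X) (0\<^sub>m n n) sequentially"
  shows "null X"
proof -
  obtain \<delta> where \<delta>: "0 < \<delta>" "\<And>X. X \<in> M \<Longrightarrow> \<delta> * (hs_norm X)\<^sup>2 \<le> rho_sqnorm X"
    using rho_sqnorm_lower_bound by metis
  have "(\<lambda>k. rho_sqnorm (P (r k) X)) \<longlonglongrightarrow> rho_sqnorm (0\<^sub>m n n)"
    using X lim by (intro rho_sqnorm_tendsto) auto
  then have lim': "(\<lambda>k. rho_sqnorm (P (r k) X)) \<longlonglongrightarrow> 0" by (simp add: rho_sqnorm_def)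
  have "((\<lambda>t. hs_norm (P t X)) \<longlongrightarrow> 0) at_top"
    unfolding tendsto_iff
  proof (intro allI impI)
    fix e :: real assume e: "0 < e"
    then have "0 < \<delta> * e\<^sup>2" using \<delta>(1) by simp
    then obtain k where k: "rho_sqnorm (P (r k) X) < \<delta> * e\<^sup>2"
        using eventually_happens'[OF sequentially_bot order_tendstoD(2)[OF lim']] by blast
    have "hs_norm (P t X) < e" if "r k \<le> t" for t
    proof (rule power2_less_imp_less)
      have "\<delta> * (hs_norm (P t X))\<^sup>2 < \<delta> * e\<^sup>2"
        using \<delta>(2)[of "P t X"] rho_sqnorm_P_antimono[OF X r that] k X by simp
      then show "(hs_norm (P t X))\<^sup>2 < e\<^sup>2" using \<delta>(1) by simp
    qed (use e in simp)
    then show "\<forall>\<^sub>F t in at_top. dist (hs_norm (P t X)) 0 < e"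
      unfolding eventually_at_top_linorder by (intro exI[of _ "r k"]) simp
  qed
  then show ?thesis using X by (simp add: null_iff_hs_norm)
qed

subsection \<open>The projection onto the decoherence-free algebra\<close>

lemma rho_sqnorm_limit_le:
  assumes X: "X \<in> M" and Y: "Y \<in> M" and v: "0 \<le> v"
    and s: "filterlim s at_top sequentially" and lim: "mlim (\<lambda>k. P (s k) X) Y sequentially"
  shows "rho_sqnorm Y \<le> rho_sqnorm (P v X)"
proof (rule tendsto_upperbound)
  show "(\<lambda>k. rho_sqnorm (P (s k) X)) \<longlonglongrightarrow> rho_sqnorm Y"
    using X Y lim by (intro rho_sqnorm_tendsto) auto
  have "\<forall>\<^sub>F k in sequentially. v \<le> s k" using s by (simp add: filterlim_at_top)
  then show "\<forall>\<^sub>F k in sequentially. rho_sqnorm (P (s k) X) \<le> rho_sqnorm (P v X)"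
    by eventually_elim (rule rho_sqnorm_P_antimono[OF X v])
qed simp

lemma limit_point_in_dfa:
  assumes X: "X \<in> M" and Y: "Y \<in> M" and s: "filterlim s at_top sequentially" "\<And>k. 0 \<le> s k"
    and lim: "mlim (\<lambda>k. P (s k) X) Y sequentially"
  shows "Y \<in> N"
  unfolding dfa_iff_rho_sqnorm[OF Y]
proof (intro allI impI antisym)
  fix u :: real assume u: "0 \<le> u"
  show "rho_sqnorm (P u Y) \<le> rho_sqnorm Y" using rho_sqnorm_P_le Y u by blast
  have "(\<lambda>k. rho_sqnorm (P u (P (s k) X))) \<longlonglongrightarrow> rho_sqnorm (P u Y)"
    by (rule rho_sqnorm_tendsto[OF _ _ mlim_lin[OF P_lin[OF u] _ _ lim]]) (use X Y in auto)
  moreover have "rho_sqnorm Y \<le> rho_sqnorm (P u (P (s k) X))" for k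
    using rho_sqnorm_limit_le[OF X Y _ s(1) lim, of "u + s k"] s(2)[of k] X u by (simp add: P_add)
  ultimately show "rho_sqnorm Y \<le> rho_sqnorm (P u Y)" by (intro LIMSEQ_le_const) auto
qed

(* If P (r k) tends to Q and P (s k) to E with s k = r (2 k) - r k, then P (s k) (P (r k) X) =
   P (r (2 k)) X gives E Q = Q. *)
lemma exists_recurrent_limits:
  obtains r s :: "nat \<Rightarrow> real" and Q E where "lin_map n Q" "lin_map n E" "\<And>k. 0 \<le> r k" "\<And>k. 0 \<le> s k"
    "filterlim s at_top sequentially"
    "\<And>X. X \<in> M \<Longrightarrow> mlim (\<lambda>k. P (r k) X) (Q X) sequentially"
    "\<And>X. X \<in> M \<Longrightarrow> mlim (\<lambda>k. P (s k) X) (E X) sequentially"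
    "\<And>X. X \<in> M \<Longrightarrow> E (Q X) = Q X"
proof -
  have bounded: "\<exists>B. \<forall>k. hs_norm (P (real (f k)) X) \<le> B" if "X \<in> M" for X and f :: "nat \<Rightarrow> nat"
    using P_bounded[OF that] by (metis of_nat_0_le_iff)
  obtain r Q where r: "strict_mono r" and Q: "lin_map n Q"
    and PQ: "\<And>X. X \<in> M \<Longrightarrow> mlim (\<lambda>k. P (real (r k)) X) (Q X) sequentially"
    using lin_map_sequence_compact[of "\<lambda>k. P (real k)", OF P_lin bounded[of _ "\<lambda>k. k"]] by auto
  define g where "g k = r (2 * k) - r k" for k
  obtain h E where h: "strict_mono h" and E: "lin_map n E"
    and PE: "\<And>X. X \<in> M \<Longrightarrow> mlim (\<lambda>k. P (real (g (h k))) X) (E X) sequentially"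
    using lin_map_sequence_compact[of "\<lambda>k. P (real (g k))", OF P_lin bounded] by auto
  have gap: "g k + r k = r (2 * k)" for k using r by (simp add: g_def strict_mono_less_eq)
  have "k \<le> g (h k)" for k
    using strict_mono_imp_increasing[OF h, of k] strict_mono_double_gap[OF r, of "h k"]
    by (simp add: g_def)
  then have "filterlim (\<lambda>k. real (g (h k))) at_top sequentially"
    by (intro filterlim_at_top_mono[OF filterlim_real_sequentially]) auto
  moreover have "E (Q X) = Q X" if X: "X \<in> M" for X
  proof (rule mlim_unique)
    have closed: "E Y \<in> M" "Q Y \<in> M" if "Y \<in> M" for Y using that E Q lin_map_closed by auto
    have subsequence: "mlim (\<lambda>k. P (real (r (f k))) X) (Q X) sequentially" if "strict_mono f" for f
      unfolding mlim_def using LIMSEQ_subseq_LIMSEQ[OF mlimD[OF PQ[OF X]] that]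
      by (auto simp: o_def)
    show "mlim (\<lambda>k. P (real (g (h k))) (P (real (r (h k))) X)) (E (Q X)) sequentially"
      by (rule mlim_superop[OF _ E PE _ _ subsequence[OF h]]) (use X closed P_lin in auto)
    have "mlim (\<lambda>k. P (real (r (2 * h k))) X) (Q X) sequentially"
      using h by (intro subsequence) (simp add: strict_mono_def)
    then show "mlim (\<lambda>k. P (real (g (h k))) (P (real (r (h k))) X)) (Q X) sequentially"
      using X by (simp add: P_add flip: gap)
    show "E (Q X) \<in> M" "Q X \<in> M" using X closed by auto
  qed simp
  ultimately show ?thesis using that[OF Q E _ _ _ PQ PE] by auto
qed

lemma exists_projection:
  obtains E where "lin_map n E" "\<And>X. X \<in> M \<Longrightarrow> E X \<in> N" "\<And>X. psd n X \<Longrightarrow> psd n (E X)"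
    "\<And>X. X \<in> M \<Longrightarrow> null (X - E X)"
proof -
  obtain r s :: "nat \<Rightarrow> real" and Q E where lin: "lin_map n Q" "lin_map n E"
    and nonneg: "\<And>k. 0 \<le> r k" "\<And>k. 0 \<le> s k" and s: "filterlim s at_top sequentially"
    and PQ: "\<And>X. X \<in> M \<Longrightarrow> mlim (\<lambda>k. P (r k) X) (Q X) sequentially"
    and PE: "\<And>X. X \<in> M \<Longrightarrow> mlim (\<lambda>k. P (s k) X) (E X) sequentially"
    and EQ: "\<And>X. X \<in> M \<Longrightarrow> E (Q X) = Q X"
    by (rule exists_recurrent_limits) blast
  have closed: "E X \<in> M" "Q X \<in> M" if "X \<in> M" for X using that lin lin_map_closed by auto
  have P_Q: "P t (Q X) = Q (P t X)" if X: "X \<in> M" and t: "0 \<le> t" for X t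
  proof (rule mlim_unique)
    show "mlim (\<lambda>k. P t (P (r k) X)) (P t (Q X)) sequentially"
      by (rule mlim_lin[OF P_lin[OF t] _ _ PQ[OF X]]) (use X closed in auto)
    show "mlim (\<lambda>k. P t (P (r k) X)) (Q (P t X)) sequentially"
      using PQ[of "P t X"] X by (simp add: P_add add.commute)
  qed (use closed X in auto)
  have QE: "Q (E X) = Q X" if X: "X \<in> M" for X
  proof (rule mlim_unique)
    show "mlim (\<lambda>k. Q (P (s k) X)) (Q (E X)) sequentially"
      by (rule mlim_lin[OF lin(1) _ _ PE[OF X]]) (use X closed in auto)
    show "mlim (\<lambda>k. Q (P (s k) X)) (Q X) sequentially"
      using PE[of "Q X"] EQ[OF X] X closed nonneg by (simp add: P_Q)
  qed (use closed X in auto)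
  have "null (X - E X)" if X: "X \<in> M" for X
  proof (rule null_if_tendsto_0_along[OF _ nonneg(1)])
    have "Q (X - E X) = 0\<^sub>m n n"
      using lin_map_minus[OF lin(1) X closed(1)[OF X]] QE[OF X] closed[OF X]
      by (simp add: minus_r_inv_mat)
    then show "mlim (\<lambda>k. P (r k) (X - E X)) (0\<^sub>m n n) sequentially"
      using PQ[of "X - E X"] X closed by simp
  qed (use X closed in simp)
  moreover have "E X \<in> N" if "X \<in> M" for X
    using limit_point_in_dfa[OF that closed(1)[OF that] s nonneg(2) PE[OF that]] .
  moreover have "psd n (E X)" if X: "psd n X" for X
    by (rule mlim_psd[OF _ _ PE]) (use X psdD closed nonneg P_ucp ucp_psd in auto)
  ultimately show ?thesis using that[OF lin(2)] by blast
qed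

subsection \<open>The conditional expectation\<close>

definition is_decoh_expectation :: "(complex mat \<Rightarrow> complex mat) \<Rightarrow> bool" where
  "is_decoh_expectation E \<longleftrightarrow> cond_exp n N E \<and> (\<forall>X. X \<notin> M \<longrightarrow> E X = 0\<^sub>m n n) \<and>
     (\<forall>X\<in>M. \<forall>i<n. \<forall>j<n. ((\<lambda>t. P t (X - E X) $$ (i,j)) \<longlongrightarrow> 0) at_top)"

lemma is_decoh_expectationD:
  assumes "is_decoh_expectation E"
  shows "lin_map n E" "X \<in> M \<Longrightarrow> E X \<in> N" "A \<in> N \<Longrightarrow> E A = A" "psd n X \<Longrightarrow> psd n (E X)"
    "A \<in> N \<Longrightarrow> B \<in> N \<Longrightarrow> X \<in> M \<Longrightarrow> E (A * X * B) = A * E X * B" "X \<in> M \<Longrightarrow> null (X - E X)"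
  using assms dfa_carrier by (auto simp: is_decoh_expectation_def cond_exp_def null_def mlim_def)

lemma is_decoh_expectation_exists: "\<exists>E. is_decoh_expectation E"
proof -
  obtain E where E: "lin_map n E" "\<And>X. X \<in> M \<Longrightarrow> E X \<in> N" "\<And>X. psd n X \<Longrightarrow> psd n (E X)"
    "\<And>X. X \<in> M \<Longrightarrow> null (X - E X)"
    by (rule exists_projection) blast
  have fixed: "E A = A" if A: "A \<in> N" for A
    using A dfa_carrier[OF A] E null_zero
    by (intro dfa_component_unique[of _ A]) (auto simp: minus_r_inv_mat)
  have bimodule: "E (A * X * B) = A * E X * B" if A: "A \<in> N" and B: "B \<in> N" and X: "X \<in> M" for A B X
  proof (rule dfa_component_unique)
    note closed = dfa_carrier[OF A] dfa_carrier[OF B] X dfa_carrier[OF E(2)[OF X]]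
    show "A * X * B \<in> M" "A * E X * B \<in> N" using closed A B E(2)[OF X] by (auto intro: dfa_mult)
    show "E (A * X * B) \<in> N" "null (A * X * B - E (A * X * B))" using closed E by auto
    have "A * X * B - A * E X * B = A * (X - E X) * B" using closed by (simp add: M_distrib)
    then show "null (A * X * B - A * E X * B)" using null_bimodule[OF A B E(4)[OF X]] by simp
  qed
  define E' where "E' X = (if X \<in> M then E X else 0\<^sub>m n n)" for X
  have "lin_map n E'" using E(1) by (simp add: lin_map_def E'_def)
  then have "cond_exp n N E'"
    unfolding cond_exp_def using E fixed bimodule dfa_carrier psdD(1) by (auto simp: E'_def)
  then have "is_decoh_expectation E'"
    using E(4) by (auto simp: is_decoh_expectation_def E'_def null_def mlim_def)
  then show ?thesis by blast
qed

lemma is_decoh_expectation_unique: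
  assumes E: "is_decoh_expectation E" and E': "is_decoh_expectation E'" shows "E = E'"
proof
  fix X
  show "E X = E' X"
  proof (cases "X \<in> M")
    case True
    show ?thesis
      by (rule dfa_component_unique[OF is_decoh_expectationD(2,6)[OF E True]
            is_decoh_expectationD(2,6)[OF E' True] True])
  qed (use E E' in \<open>auto simp: is_decoh_expectation_def\<close>)
qed

abbreviation E :: "complex mat \<Rightarrow> complex mat" where "E \<equiv> EN n L"

lemma E_is_decoh_expectation: "is_decoh_expectation E"
proof -
  have "E = (THE E. is_decoh_expectation E)" by (simp add: EN_def is_decoh_expectation_def)
  moreover have "\<exists>!E. is_decoh_expectation E"
    using is_decoh_expectation_exists is_decoh_expectation_unique by blast
  ultimately show ?thesis by (metis theI')
qed

lemma lin_map_E: "lin_map n E" and E_dfa: "X \<in> M \<Longrightarrow> E X \<in> N" and E_dfa_fixed: "A \<in> N \<Longrightarrow> E A = A"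
  and E_psd: "psd n X \<Longrightarrow> psd n (E X)"
  and E_bimodule: "A \<in> N \<Longrightarrow> B \<in> N \<Longrightarrow> X \<in> M \<Longrightarrow> E (A * X * B) = A * E X * B"
  and null_minus_E: "X \<in> M \<Longrightarrow> null (X - E X)"
  using is_decoh_expectationD[OF E_is_decoh_expectation] by auto

lemma E_closed [simp]: "X \<in> M \<Longrightarrow> E X \<in> M" by (simp add: E_dfa dfa_carrier)

lemma E_adj: assumes X: "X \<in> M" shows "E (adj X) = adj (E X)"
proof (rule dfa_component_unique[of _ "adj X"])
  have "adj X - adj (E X) = adj (X - E X)" using X by (simp add: adj_minus)
  then show "null (adj X - adj (E X))" using null_adj[OF null_minus_E[OF X]] by simp
qed (use X in \<open>auto simp: E_dfa dfa_adj null_minus_E\<close>)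

lemma E_pd: assumes X: "pd n X" shows "pd n (E X)"
proof -
  note X_closed = psdD(1)[OF pdD[OF X]]
  obtain \<delta> where \<delta>: "0 < \<delta>" "psd n (X - complex_of_real \<delta> \<cdot>\<^sub>m 1\<^sub>m n)"
    using pd_minus_scalar_psd[OF X] by blast
  have "E (X - complex_of_real \<delta> \<cdot>\<^sub>m 1\<^sub>m n) = E X - complex_of_real \<delta> \<cdot>\<^sub>m 1\<^sub>m n"
    using X_closed
    by (simp add: lin_map_minus[OF lin_map_E] lin_map_smult[OF lin_map_E] E_dfa_fixed dfa_one)
  then show ?thesis
    using \<delta> E_psd[OF \<delta>(2)] E_psd[OF pdD[OF X]] by (intro pdI_minus_scalar[of \<delta>]) (auto simp: psdD)
qed

lemma tr_rho_E: assumes X: "X \<in> M" shows "tr (\<rho> * E X) = tr (\<rho> * X)"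
proof -
  have "((\<lambda>t. tr (\<rho> * P t (X - E X))) \<longlongrightarrow> tr (\<rho> * 0\<^sub>m n n)) at_top"
    by (intro mlim_tr mlim_mult mlim_const nullD(2) null_minus_E) (use X in auto)
  moreover have "((\<lambda>t. tr (\<rho> * P t (X - E X))) \<longlongrightarrow> tr (\<rho> * (X - E X))) at_top"
    by (rule tendsto_eventually)
      (use X tr_rho_P in \<open>auto simp: eventually_at_top_linorder intro!: exI[of _ 0]\<close>)
  ultimately have "tr (\<rho> * (X - E X)) = tr (\<rho> * 0\<^sub>m n n)"
    using tendsto_unique trivial_limit_at_top_linorder by blast
  then show ?thesis using X by (simp add: M_distrib tr_minus)
qed

lemma E_faithful: assumes X: "psd n X" and E: "E X = 0\<^sub>m n n" shows "X = 0\<^sub>m n n"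
  using tr_pd_mult_eq_0D[OF rho X] tr_rho_E[OF psdD(1)[OF X]] by (simp add: E)

subsection \<open>The state \<open>\<sigma>\<close>\<close>

abbreviation \<sigma> :: "complex mat" where "\<sigma> \<equiv> sigTr n L"

lemma sigma_closed [simp]: "\<sigma> \<in> M" and tr_sigma: "X \<in> M \<Longrightarrow> tr (\<sigma> * X) = tr (E X) / of_nat n"
proof -
  define Q where "Q s \<longleftrightarrow> s \<in> M \<and> (\<forall>X\<in>M. tr (s * X) = tr ((1 / of_nat n) \<cdot>\<^sub>m 1\<^sub>m n * E X))" for s
  have "lin_map n (\<lambda>X. (1 / of_nat n) \<cdot>\<^sub>m 1\<^sub>m n * E X)"
    using lin_map_E by (auto simp: lin_map_def M_distrib M_smult)
  then have "\<exists>s. Q s" unfolding Q_def using exists_trace_dual by metis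
  moreover have "s = s'" if "Q s" "Q s'" for s s'
    using that by (intro tr_mult_eqI) (auto simp: Q_def)
  ultimately have "\<exists>!s. Q s" by blast
  moreover have "\<sigma> = (THE s. Q s)" by (simp add: sigTr_def Q_def)
  ultimately have "Q \<sigma>" by (metis theI')
  then show "\<sigma> \<in> M" "X \<in> M \<Longrightarrow> tr (\<sigma> * X) = tr (E X) / of_nat n"
    by (auto simp: Q_def M_smult tr_smult)
qed

lemma tr_sigma_E: "X \<in> M \<Longrightarrow> tr (\<sigma> * E X) = tr (\<sigma> * X)"
  by (simp add: tr_sigma E_dfa_fixed E_dfa)

lemma sigma_commute: assumes A: "A \<in> N" shows "\<sigma> * A = A * \<sigma>"
proof (rule tr_mult_eqI)
  note A_closed = dfa_carrier[OF A]
  show "\<sigma> * A \<in> M" "A * \<sigma> \<in> M" using A_closed by auto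
  fix X assume X: "X \<in> M"
  have "tr (\<sigma> * A * X) = tr (E (A * X * 1\<^sub>m n)) / of_nat n"
    using A_closed X by (simp add: M_assoc tr_sigma)
  also have "\<dots> = tr (A * E X) / of_nat n" using E_bimodule[OF A dfa_one X] X A_closed by simp
  also have "\<dots> = tr (E X * A) / of_nat n" using tr_mult_commute[of A "E X"] A_closed X by simp
  also have "\<dots> = tr (E (1\<^sub>m n * X * A)) / of_nat n"
    using E_bimodule[OF dfa_one A X] X A_closed by simp
  also have "\<dots> = tr (\<sigma> * (X * A))" using A_closed X by (simp add: tr_sigma)
  also have "\<dots> = tr (A * \<sigma> * X)"
    using tr_mult_commute[of A "\<sigma> * X"] A_closed X by (simp add: M_assoc)
  finally show "tr (\<sigma> * A * X) = tr (A * \<sigma> * X)" .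
qed

lemma sigma_hermitian: "hermitian \<sigma>"
proof -
  have "adj \<sigma> = \<sigma>"
  proof (rule tr_mult_eqI)
    fix X assume X: "X \<in> M"
    have "tr (adj \<sigma> * X) = cnj (tr (adj X * \<sigma>))"
      using X by (subst tr_adj[symmetric]) (simp_all add: adj_mult)
    also have "tr (adj X * \<sigma>) = tr (adj (E X)) / of_nat n"
      using X tr_mult_commute[of "adj X" \<sigma>] by (simp add: tr_sigma E_adj)
    finally show "tr (adj \<sigma> * X) = tr (\<sigma> * X)" using X by (simp add: tr_sigma tr_adj)
  qed simp_all
  then show ?thesis by (simp add: hermitian_def)
qed

lemma sigma_pd: "pd n \<sigma>"
  unfolding pd_iff_tr
proof (intro conjI ballI impI sigma_hermitian)
  fix S assume S: "S \<in> M" "S \<noteq> 0\<^sub>m n n"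
  define X where "X = S * adj S"
  have X: "psd n X" using psd_gram[of "adj S"] S by (simp add: X_def)
  have "X \<noteq> 0\<^sub>m n n"
    using tr_gram[of "adj S"] hs_norm_eq_0[of S] S by (auto simp: X_def hs_norm_adj)
  then have "Re (tr (1\<^sub>m n * E X)) \<noteq> 0"
    using E_faithful[OF X] tr_pd_mult_eq_0D[OF pd_one E_psd[OF X]] by blast
  moreover have "0 \<le> Re (tr (1\<^sub>m n * E X))" by (rule tr_psd_mult_nonneg[OF psd_one E_psd[OF X]])
  moreover have "tr (adj S * \<sigma> * S) = tr (1\<^sub>m n * E X) / of_nat n"
    using tr_mult_commute[of "adj S" "\<sigma> * S"] S psdD(1)[OF X]
    by (simp add: M_assoc tr_sigma flip: X_def)
  ultimately show "0 < Re (tr (adj S * \<sigma> * S))" using n_pos by simp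
qed

end

section \<open>The three lines theorem\<close>

lemma maximum_modulus_strip_rectangle:
  fixes h :: "complex \<Rightarrow> complex"
  assumes hol: "h holomorphic_on UNIV" and R: "0 \<le> R" and \<theta>: "0 \<le> \<theta>" "\<theta> \<le> 1"
    and left: "\<And>z. Re z = 0 \<Longrightarrow> cmod (h z) \<le> 1" and right: "\<And>z. Re z = 1 \<Longrightarrow> cmod (h z) \<le> 1"
    and caps: "\<And>z. 0 \<le> Re z \<Longrightarrow> Re z \<le> 1 \<Longrightarrow> \<bar>Im z\<bar> = R \<Longrightarrow> cmod (h z) \<le> 1"
  shows "cmod (h (of_real \<theta>)) \<le> 1"
proof (rule maximum_modulus_frontier[of h "cbox (Complex 0 (- R)) (Complex 1 R)"])
  let ?S = "cbox (Complex 0 (- R)) (Complex 1 R)"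
  show "h holomorphic_on interior ?S" "continuous_on (closure ?S) h"
    using hol holomorphic_on_subset holomorphic_on_imp_continuous_on by blast+
  show "of_real \<theta> \<in> ?S" using \<theta> R by (auto simp: in_cbox_complex_iff)
  fix z assume "z \<in> frontier ?S"
  then have z: "z \<in> ?S" "z \<notin> box (Complex 0 (- R)) (Complex 1 R)" by (auto simp: frontier_cbox)
  have "0 \<le> Re z" "Re z \<le> 1" "- R \<le> Im z" "Im z \<le> R" using z(1) by (auto simp: in_cbox_complex_iff)
  then consider "Re z = 0" | "Re z = 1" | "0 \<le> Re z" "Re z \<le> 1" "\<bar>Im z\<bar> = R"
    using z by (fastforce simp: in_box_complex_iff)
  then show "cmod (h z) \<le> 1" using left right caps by cases auto
qed (rule bounded_cbox)

lemma three_lines_damped: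
  fixes g :: "complex \<Rightarrow> complex"
  assumes hol: "g holomorphic_on UNIV"
    and bounded: "\<And>z. 0 \<le> Re z \<Longrightarrow> Re z \<le> 1 \<Longrightarrow> cmod (g z) \<le> B"
    and left: "\<And>z. Re z = 0 \<Longrightarrow> cmod (g z) \<le> 1" and right: "\<And>z. Re z = 1 \<Longrightarrow> cmod (g z) \<le> 1"
    and \<theta>: "0 \<le> \<theta>" "\<theta> \<le> 1" and \<epsilon>: "0 < \<epsilon>"
  shows "cmod (g (of_real \<theta>)) * exp (\<epsilon> * (\<theta>\<^sup>2 - 1)) \<le> 1"
proof -
  define h where "h z = g z * exp (of_real \<epsilon> * (z\<^sup>2 - 1))" for z
  have norm_h: "cmod (h z) = cmod (g z) * exp (\<epsilon> * ((Re z)\<^sup>2 - (Im z)\<^sup>2 - 1))" for z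
    by (simp add: h_def norm_mult norm_exp_eq_Re power2_eq_square)
  have damping: "exp (\<epsilon> * ((Re z)\<^sup>2 - (Im z)\<^sup>2 - 1)) \<le> exp (- \<epsilon> * (Im z)\<^sup>2)"
    if "0 \<le> Re z" "Re z \<le> 1" for z
    using that \<epsilon> by (simp add: power_le_one algebra_simps)
  have h_le_1: "cmod (h z) \<le> 1" if "0 \<le> Re z" "Re z \<le> 1" "cmod (g z) \<le> 1" for z
    unfolding norm_h using damping[OF that(1,2)] that(3) \<epsilon> order_trans
    by (intro mult_le_one) (fastforce+)
  have B: "0 \<le> B" using order_trans[OF norm_ge_zero bounded[of 0]] by simp
  define R where "R = 1 + B / \<epsilon>"
  have R: "1 \<le> R" using B \<epsilon> by (simp add: R_def)
  have "cmod (h (of_real \<theta>)) \<le> 1"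
  proof (rule maximum_modulus_strip_rectangle[where R = R])
    show "h holomorphic_on UNIV" unfolding h_def by (intro holomorphic_intros hol)
    fix z assume z: "0 \<le> Re z" "Re z \<le> 1" "\<bar>Im z\<bar> = R"
    have "B \<le> \<epsilon> * R" using \<epsilon> by (simp add: R_def field_simps)
    also have "\<dots> \<le> \<epsilon> * R\<^sup>2" using \<epsilon> R by (intro mult_left_mono) (auto simp: power2_eq_square)
    also have "\<dots> \<le> exp (\<epsilon> * R\<^sup>2)" using exp_ge_add_one_self[of "\<epsilon> * R\<^sup>2"] by linarith
    finally have "B * exp (- \<epsilon> * R\<^sup>2) \<le> 1" by (simp add: exp_minus field_simps)
    moreover have "cmod (h z) \<le> B * exp (- \<epsilon> * (Im z)\<^sup>2)"
      unfolding norm_h using bounded damping z B by (intro mult_mono) auto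
    moreover have "(Im z)\<^sup>2 = R\<^sup>2" using z(3) by (metis power2_abs)
    ultimately show "cmod (h z) \<le> 1" by simp
  qed (use R \<theta> left right h_le_1 in auto)
  then show ?thesis by (simp add: norm_h)
qed

lemma three_lines_normalised:
  fixes g :: "complex \<Rightarrow> complex"
  assumes "g holomorphic_on UNIV"
    and "\<And>z. 0 \<le> Re z \<Longrightarrow> Re z \<le> 1 \<Longrightarrow> cmod (g z) \<le> B"
    and "\<And>z. Re z = 0 \<Longrightarrow> cmod (g z) \<le> 1" and "\<And>z. Re z = 1 \<Longrightarrow> cmod (g z) \<le> 1"
    and "0 \<le> \<theta>" "\<theta> \<le> 1"
  shows "cmod (g (of_real \<theta>)) \<le> 1"
proof (rule tendsto_upperbound)
  let ?f = "\<lambda>\<epsilon>. cmod (g (of_real \<theta>)) * exp (\<epsilon> * (\<theta>\<^sup>2 - 1))"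
  have "(?f \<longlongrightarrow> cmod (g (of_real \<theta>)) * exp (0 * (\<theta>\<^sup>2 - 1))) (at_right 0)"
    by (intro tendsto_intros)
  then show "(?f \<longlongrightarrow> cmod (g (of_real \<theta>))) (at_right 0)" by simp
  show "\<forall>\<^sub>F \<epsilon> in at_right 0. ?f \<epsilon> \<le> 1"
    using three_lines_damped[OF assms] by (auto simp: eventually_at_right_field intro!: exI[of _ 1])
qed simp

definition strip_bounded :: "(complex \<Rightarrow> complex) \<Rightarrow> bool" where
  "strip_bounded f \<longleftrightarrow> f holomorphic_on UNIV \<and> (\<exists>B. \<forall>z. 0 \<le> Re z \<longrightarrow> Re z \<le> 1 \<longrightarrow> cmod (f z) \<le> B)"

lemma strip_bounded_const: "strip_bounded (\<lambda>z. c)" by (auto simp: strip_bounded_def)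

lemma strip_bounded_add:
  assumes "strip_bounded f" "strip_bounded g" shows "strip_bounded (\<lambda>z. f z + g z)"
proof -
  obtain B C where "\<forall>z. 0 \<le> Re z \<longrightarrow> Re z \<le> 1 \<longrightarrow> cmod (f z) \<le> B"
    "\<forall>z. 0 \<le> Re z \<longrightarrow> Re z \<le> 1 \<longrightarrow> cmod (g z) \<le> C"
    using assms by (auto simp: strip_bounded_def)
  then have "\<forall>z. 0 \<le> Re z \<longrightarrow> Re z \<le> 1 \<longrightarrow> cmod (f z + g z) \<le> B + C"
    using norm_triangle_mono by blast
  then show ?thesis using assms by (auto simp: strip_bounded_def intro!: holomorphic_intros)
qed

lemma strip_bounded_mult:
  assumes "strip_bounded f" "strip_bounded g" shows "strip_bounded (\<lambda>z. f z * g z)"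
proof -
  obtain B C where BC: "\<forall>z. 0 \<le> Re z \<longrightarrow> Re z \<le> 1 \<longrightarrow> cmod (f z) \<le> B"
    "\<forall>z. 0 \<le> Re z \<longrightarrow> Re z \<le> 1 \<longrightarrow> cmod (g z) \<le> C"
    using assms by (auto simp: strip_bounded_def)
  have "cmod (f z * g z) \<le> B * C" if "0 \<le> Re z" "Re z \<le> 1" for z
    unfolding norm_mult using BC that order_trans[OF norm_ge_zero] by (intro mult_mono) auto
  then show ?thesis using assms by (auto simp: strip_bounded_def intro!: holomorphic_intros)
qed

lemma strip_bounded_sum: "(\<And>i. i \<in> I \<Longrightarrow> strip_bounded (f i)) \<Longrightarrow> strip_bounded (\<lambda>z. \<Sum>i\<in>I. f i z)"
  by (induction I rule: infinite_finite_induct) (auto simp: strip_bounded_const strip_bounded_add)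

lemma strip_bounded_exp: "strip_bounded (\<lambda>z. exp (a + of_real b * z))"
proof -
  have "cmod (exp (a + of_real b * z)) \<le> exp (Re a + \<bar>b\<bar>)" if "0 \<le> Re z" "Re z \<le> 1" for z
  proof -
    have "b * Re z \<le> \<bar>b\<bar> * Re z" using that by (intro mult_right_mono) auto
    also have "\<dots> \<le> \<bar>b\<bar> * 1" using that by (intro mult_left_mono) auto
    finally show ?thesis by (simp add: norm_exp_eq_Re)
  qed
  then have "\<exists>B. \<forall>z. 0 \<le> Re z \<longrightarrow> Re z \<le> 1 \<longrightarrow> cmod (exp (a + of_real b * z)) \<le> B" by blast
  then show ?thesis unfolding strip_bounded_def by (intro conjI holomorphic_intros)
qed

lemma strip_bounded_powr:
  assumes "0 \<le> x" shows "strip_bounded (\<lambda>z. complex_of_real x powr (a + of_real b * z))"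
proof (cases "x = 0")
  case False
  then have "complex_of_real x powr (a + of_real b * z)
      = exp (a * of_real (ln x) + of_real (b * ln x) * z)" for z
    using assms by (simp add: powr_def Ln_of_real algebra_simps)
  then show ?thesis by (simp only: strip_bounded_exp)
qed (simp add: strip_bounded_const)

lemma three_lines_pos:
  assumes f: "strip_bounded f" and pos: "0 < M0" "0 < M1"
    and left: "\<And>z. Re z = 0 \<Longrightarrow> cmod (f z) \<le> M0" and right: "\<And>z. Re z = 1 \<Longrightarrow> cmod (f z) \<le> M1"
    and \<theta>: "0 \<le> \<theta>" "\<theta> \<le> 1"
  shows "cmod (f (of_real \<theta>)) \<le> M0 powr (1 - \<theta>) * M1 powr \<theta>"
proof -
  define k where "k z = exp (complex_of_real (- ln M0) + of_real (ln M0 - ln M1) * z)" for z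
  define g where "g z = f z * k z" for z
  have g: "strip_bounded g" unfolding g_def k_def by (intro strip_bounded_mult f strip_bounded_exp)
  have norm_k: "cmod (k z) = M0 powr (Re z - 1) * M1 powr (- Re z)" for z
    using pos by (simp add: k_def norm_exp_eq_Re powr_def exp_add[symmetric] algebra_simps)
  obtain B where B: "\<And>z. 0 \<le> Re z \<Longrightarrow> Re z \<le> 1 \<Longrightarrow> cmod (g z) \<le> B"
    using g by (auto simp: strip_bounded_def)
  have "cmod (g (of_real \<theta>)) \<le> 1"
  proof (rule three_lines_normalised[OF _ B])
    show "g holomorphic_on UNIV" using g by (simp add: strip_bounded_def)
    show "cmod (g z) \<le> 1" if "Re z = 0" for z
      using left[OF that] that pos by (simp add: g_def norm_mult norm_k powr_minus field_simps)
    show "cmod (g z) \<le> 1" if "Re z = 1" for z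
      using right[OF that] that pos by (simp add: g_def norm_mult norm_k powr_minus field_simps)
  qed (use \<theta> in auto)
  then have "cmod (f (of_real \<theta>)) * (M0 powr (\<theta> - 1) * M1 powr (- \<theta>)) \<le> 1"
    by (simp add: g_def norm_mult norm_k)
  then show ?thesis using pos by (simp add: powr_diff powr_minus field_simps)
qed

theorem three_lines:
  assumes f: "strip_bounded f" and nonneg: "0 \<le> M0" "0 \<le> M1"
    and left: "\<And>z. Re z = 0 \<Longrightarrow> cmod (f z) \<le> M0" and right: "\<And>z. Re z = 1 \<Longrightarrow> cmod (f z) \<le> M1"
    and \<theta>: "0 < \<theta>" "\<theta> < 1"
  shows "cmod (f (of_real \<theta>)) \<le> M0 powr (1 - \<theta>) * M1 powr \<theta>"
proof (rule tendsto_lowerbound)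
  have powr_tendsto: "((\<lambda>e. (m + e) powr s) \<longlongrightarrow> m powr s) (at_right 0)"
    if "0 \<le> m" "0 < s" for m s :: real
  proof -
    have "((\<lambda>e. (m + e) powr s) \<longlongrightarrow> (m + 0) powr s) (at_right 0)"
      using that by (intro tendsto_powr2 tendsto_intros)
        (auto simp: eventually_at_right_field intro!: exI[of _ 1])
    then show ?thesis by simp
  qed
  show "((\<lambda>e. (M0 + e) powr (1 - \<theta>) * (M1 + e) powr \<theta>) \<longlongrightarrow> M0 powr (1 - \<theta>) * M1 powr \<theta>) (at_right 0)"
    using nonneg \<theta> by (intro tendsto_mult powr_tendsto) auto
  have "cmod (f (of_real \<theta>)) \<le> (M0 + e) powr (1 - \<theta>) * (M1 + e) powr \<theta>" if "0 < e" for e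
    using nonneg \<theta> that by (intro three_lines_pos[OF f] order_trans[OF left] order_trans[OF right])
      auto
  then show "\<forall>\<^sub>F e in at_right 0. cmod (f (of_real \<theta>)) \<le> (M0 + e) powr (1 - \<theta>) * (M1 + e) powr \<theta>"
    by (auto simp: eventually_at_right_field intro!: exI[of _ 1])
qed simp

context square_matrices
begin

definition mstrip :: "(complex \<Rightarrow> complex mat) \<Rightarrow> bool" where
  "mstrip G \<longleftrightarrow> (\<forall>z. G z \<in> M) \<and> (\<forall>i<n. \<forall>j<n. strip_bounded (\<lambda>z. G z $$ (i,j)))"

lemma mstrip_const: "A \<in> M \<Longrightarrow> mstrip (\<lambda>z. A)" by (simp add: mstrip_def strip_bounded_const)

lemma mstrip_mult: "mstrip G \<Longrightarrow> mstrip H \<Longrightarrow> mstrip (\<lambda>z. G z * H z)"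
  by (auto simp: mstrip_def index_mult intro!: strip_bounded_sum strip_bounded_mult)

lemma mstrip_tr: "mstrip G \<Longrightarrow> strip_bounded (\<lambda>z. tr (G z))"
  by (auto simp: mstrip_def tr_sum intro!: strip_bounded_sum)

lemma mstrip_mcpow: assumes "psd n A" shows "mstrip (\<lambda>z. mcpow (a + of_real b * z) A)"
proof -
  obtain U l where U: "unitary n U" "\<And>f. mcfun f A = unitary_diag U (\<lambda>i. f (l i))"
    and l: "\<And>i. i < n \<Longrightarrow> 0 \<le> l i"
    using psd_spectral[OF assms] by metis
  have "U \<in> M" using U by (simp add: unitaryD)
  then show ?thesis unfolding mstrip_def mcpow_def U(2)
    by (auto simp: index_unitary_diag
        intro!: strip_bounded_sum strip_bounded_mult strip_bounded_const strip_bounded_powr l)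
qed

definition mderiv :: "(complex \<Rightarrow> complex mat) \<Rightarrow> complex mat \<Rightarrow> complex \<Rightarrow> bool" where
  "mderiv G G' z \<longleftrightarrow> (\<forall>w. G w \<in> M) \<and> G' \<in> M \<and>
     (\<forall>i<n. \<forall>j<n. ((\<lambda>w. G w $$ (i,j)) has_field_derivative G' $$ (i,j)) (at z))"

lemma mderivD:
  assumes "mderiv G G' z"
  shows "G w \<in> M" "G' \<in> M"
    "i < n \<Longrightarrow> j < n \<Longrightarrow> ((\<lambda>w. G w $$ (i,j)) has_field_derivative G' $$ (i,j)) (at z)"
  using assms by (auto simp: mderiv_def)

lemma mderiv_mult:
  assumes G: "mderiv G G' z" and H: "mderiv H H' z"
  shows "mderiv (\<lambda>w. G w * H w) (G' * H z + G z * H') z"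
proof -
  note closed = mderivD(1,2)[OF G] mderivD(1,2)[OF H]
  have "((\<lambda>w. (G w * H w) $$ (i,j)) has_field_derivative (G' * H z + G z * H') $$ (i,j)) (at z)"
    if ij: "i < n" "j < n" for i j
  proof -
    have "((\<lambda>w. \<Sum>k<n. G w $$ (i,k) * H w $$ (k,j)) has_field_derivative
       (\<Sum>k<n. G' $$ (i,k) * H z $$ (k,j) + H' $$ (k,j) * G z $$ (i,k))) (at z)"
      using ij by (intro DERIV_sum DERIV_mult mderivD(3)[OF G] mderivD(3)[OF H]) auto
    then show ?thesis using closed ij by (simp add: index_mult index_add sum.distrib mult.commute)
  qed
  then show ?thesis using closed by (simp add: mderiv_def)
qed

lemma mderiv_tr:
  assumes G: "mderiv G G' z" shows "((\<lambda>w. tr (G w)) has_field_derivative tr G') (at z)"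
  unfolding tr_sum[OF mderivD(1)[OF G]] tr_sum[OF mderivD(2)[OF G]]
  by (intro DERIV_sum mderivD(3)[OF G]) auto

lemma mderiv_mcpow:
  assumes A: "pd n A"
  shows "mderiv (\<lambda>z. mcpow (a + of_real b * z) A)
      (of_real b \<cdot>\<^sub>m (mcpow (a + of_real b * z) A * mln A)) z"
proof -
  obtain U l where U: "unitary n U" "\<And>f. mcfun f A = unitary_diag U (\<lambda>i. f (l i))"
    and l: "\<And>i. i < n \<Longrightarrow> 0 < l i"
    using psd_spectral[OF pdD[OF A]] A by metis
  have AM: "A \<in> M" using A by (simp add: pdD psdD)
  have UM: "U \<in> M" using U by (simp add: unitaryD)
  define d where "d x = of_real b * (complex_of_real x powr (a + of_real b * z) * of_real (ln x))"
    for x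
  have "of_real b \<cdot>\<^sub>m (mcpow (a + of_real b * z) A * mln A) = unitary_diag U (\<lambda>i. d (l i))"
    using UM AM U(1)
    by (simp add: mcpow_def mln_def mfun_eq_mcfun U(2) unitary_diag_mult unitary_diag_smult d_def)
  moreover have powr_deriv: "((\<lambda>w. complex_of_real x powr (a + of_real b * w))
      has_field_derivative d x) (at z)" if "0 < x" for x
  proof -
    have "((\<lambda>w. exp ((a + of_real b * w) * of_real (ln x))) has_field_derivative
      exp ((a + of_real b * z) * of_real (ln x)) * (of_real b * of_real (ln x))) (at z)"
      by (auto intro!: derivative_eq_intros)
    then show ?thesis using that by (simp add: powr_def Ln_of_real d_def mult_ac)
  qed
  have "((\<lambda>w. unitary_diag U (\<lambda>i. complex_of_real (l i) powr (a + of_real b * w)) $$ (i,j))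
      has_field_derivative unitary_diag U (\<lambda>i. d (l i)) $$ (i,j)) (at z)" if ij: "i < n" "j < n" for i j
    unfolding index_unitary_diag[OF UM ij]
    by (intro DERIV_sum DERIV_cmult DERIV_cmult_right powr_deriv l) auto
  ultimately show ?thesis unfolding mderiv_def using UM by (simp add: mcpow_def U(2))
qed

subsection \<open>Complex time evolution\<close>

context
  fixes \<Phi> :: "complex mat \<Rightarrow> complex mat" and T :: real and X :: "complex mat"
  assumes \<Phi>: "lin_map n \<Phi>" and X: "X \<in> M"
begin

lemma mderiv_superop_exp:
  "mderiv (\<lambda>z. superop_exp \<Phi> (of_real T * z) X)
    (of_real T \<cdot>\<^sub>m superop_exp \<Phi> (of_real T * z) (\<Phi> X)) z"
proof -
  have "((\<lambda>z. of_real T * z) has_field_derivative of_real T) (at z)"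
    by (auto intro!: derivative_eq_intros)
  then have "((\<lambda>z. superop_exp \<Phi> (of_real T * z) X $$ (i,j)) has_field_derivative
      superop_exp \<Phi> (of_real T * z) (\<Phi> X) $$ (i,j) * of_real T) (at z)" if "i < n" "j < n" for i j
    by (intro DERIV_chain2[OF superop_exp_has_derivative[OF \<Phi> X that]])
  then show ?thesis by (simp add: mderiv_def index_smult mult.commute)
qed

(* A symmetric \<Phi> generates isometries in imaginary time, which leaves the compact segment [0,1]. *)
lemma mstrip_superop_exp:
  assumes sym: "\<And>A B. A \<in> M \<Longrightarrow> B \<in> M \<Longrightarrow> tr (adj A * \<Phi> B) = tr (adj (\<Phi> A) * B)"
  shows "mstrip (\<lambda>z. superop_exp \<Phi> (of_real T * z) X)"
proof -
  let ?V = "\<lambda>z. superop_exp \<Phi> (of_real T * z) X"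
  have hol: "(\<lambda>z. ?V z $$ (i,j)) holomorphic_on UNIV" if "i < n" "j < n" for i j
    using mderivD(3)[OF mderiv_superop_exp that] by (auto simp: holomorphic_on_open)
  have isometry: "hs_norm (?V z) = hs_norm (?V (of_real (Re z)))" for z
  proof -
    have "of_real T * z = of_real T * (\<i> * of_real (Im z)) + of_real T * of_real (Re z)"
      by (simp add: complex_eq_iff)
    then have "?V z = superop_exp \<Phi> (of_real T * (\<i> * of_real (Im z))) (?V (of_real (Re z)))"
      using superop_exp_add[OF \<Phi> X] by simp
    then show ?thesis using hs_norm_superop_exp_imaginary[OF \<Phi> sym superop_exp_closed] by simp
  qed
  have "continuous_on {0..1} (\<lambda>x. ?V (of_real x) $$ (i,j))" if "i < n" "j < n" for i j
    by (rule continuous_on_compose2[OF holomorphic_on_imp_continuous_on[OF hol[OF that]]])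
      (auto intro!: continuous_intros)
  then have "continuous_on {0..1} (\<lambda>x. hs_norm (?V (of_real x)))"
    unfolding hs_norm_def L2_set_def by (intro continuous_intros) auto
  then have "bounded ((\<lambda>x. hs_norm (?V (of_real x))) ` {0..1})"
    by (intro compact_imp_bounded compact_continuous_image) auto
  then obtain B where B: "\<forall>x\<in>{0..1}. hs_norm (?V (of_real x)) \<le> B" by (auto simp: bounded_iff)
  have "cmod (?V z $$ (i,j)) \<le> B" if "i < n" "j < n" "0 \<le> Re z" "Re z \<le> 1" for z i j
    using entry_le_hs_norm[OF that(1,2), of "?V z"] bspec[OF B, of "Re z"] that(3,4) isometry[of z]
    by simp
  then show ?thesis using hol unfolding mstrip_def strip_bounded_def by auto
qed

end

end

section \<open>Weighted norms\<close>

lemma one_minus_2_einv_pos: "2 < p \<Longrightarrow> 0 < 1 - 2 * einv p"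
  by (cases p) (auto simp: einv_def field_simps)

lemma pfac_eq_inverse: "2 < p \<Longrightarrow> pfac p = 1 / (1 - 2 * einv p)"
  by (cases p) (auto simp: einv_def pfac_def field_simps)

context square_matrices
begin

lemma mcpow_mcpow: assumes "psd n A" shows "mcpow z (mcpow (of_real s) A) = mcpow (of_real s * z) A"
proof -
  have power_eq: "mcpow (of_real s) A = mcfun (\<lambda>x. of_real (x powr s)) A"
    unfolding mcpow_def using assms by (auto intro!: mcfun_cong_psd simp: powr_of_real)
  show ?thesis unfolding power_eq unfolding mcpow_def
    using assms by (subst mcfun_cfun)
      (auto simp: psdD powr_def Ln_of_real ln_powr mult_ac intro!: mcfun_cong_psd)
qed

lemma mcpow_mult_left: "psd n A \<Longrightarrow> C \<in> M \<Longrightarrow> mcpow z A * (mcpow w A * C) = mcpow (z + w) A * C"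
  using mcpow_mult[of A z w] by (simp flip: M_assoc)

definition polar_pow :: "complex mat \<Rightarrow> complex \<Rightarrow> complex mat" where
  "polar_pow a u = a * mcpow u (adj a * a)"

lemma polar_pow_closed [simp]: "a \<in> M \<Longrightarrow> polar_pow a u \<in> M"
  by (simp add: polar_pow_def psd_gram)

lemma polar_pow_gram:
  assumes a: "a \<in> M" shows "adj (polar_pow a u) * polar_pow a u = mcpow (cnj u + 1 + u) (adj a * a)"
proof -
  have gram_psd: "psd n (adj a * a)" using a by (rule psd_gram)
  have "adj (polar_pow a u) * polar_pow a u
      = mcpow (cnj u) (adj a * a) * ((adj a * a) * mcpow u (adj a * a))"
    using a gram_psd by (simp add: polar_pow_def adj_mult mcpow_adj M_assoc)
  also have "(adj a * a) * mcpow u (adj a * a) = mcpow (1 + u) (adj a * a)"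
    using mcpow_mult[OF gram_psd, of 1 u] mcpow_1[OF gram_psd] by simp
  finally show ?thesis using gram_psd by (simp add: mcpow_mult add.assoc)
qed

lemma polar_pow_0: assumes a: "a \<in> M" shows "polar_pow a 0 = a"
proof (rule minus_eq_zeroD)
  have gram_psd: "psd n (adj a * a)" using a by (rule psd_gram)
  let ?S = "mcpow 0 (adj a * a)" and ?D = "polar_pow a 0 - a"
  have right: "(adj a * a) * ?S = adj a * a"
    using mcpow_mult[OF gram_psd, of 1 0] mcpow_1[OF gram_psd] by simp
  have left: "adj (polar_pow a 0) * a = adj a * a"
  proof -
    have "adj (polar_pow a 0) * a = ?S * (adj a * a)"
      using a gram_psd by (simp add: polar_pow_def adj_mult mcpow_adj M_assoc)
    also have "\<dots> = adj a * a" using mcpow_mult[OF gram_psd, of 0 1] mcpow_1[OF gram_psd] by simp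
    finally show ?thesis .
  qed
  have "adj ?D * ?D = (adj (polar_pow a 0) * polar_pow a 0 - adj a * polar_pow a 0)
      - (adj (polar_pow a 0) * a - adj a * a)"
    using a by (simp add: adj_minus M_distrib)
  also have "\<dots> = 0\<^sub>m n n"
    using a gram_psd right left polar_pow_gram[OF a, of 0] mcpow_1[OF gram_psd]
    by (simp add: polar_pow_def M_assoc[symmetric] minus_r_inv_mat)
  finally have "hs_norm ?D = 0" using a tr_gram[of ?D] by simp
  then show "?D = 0\<^sub>m n n" using a hs_norm_eq_0 by simp
qed (use a in simp_all)

lemma contraction_polar_pow: assumes "a \<in> M" "Re u = - 1 / 2" shows "contraction (polar_pow a u)"
proof (rule contractionI_gram[OF _ psd_gram[OF assms(1)]])
  have exponent: "cnj u + 1 + u = 0" using assms(2) by (simp add: complex_eq_iff)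
  show "adj (polar_pow a u) * polar_pow a u
      = mcfun (\<lambda>x. complex_of_real (if x = 0 then 0 else 1)) (adj a * a)"
    unfolding polar_pow_gram[OF assms(1)] exponent mcpow_def using psd_gram[OF assms(1)]
    by (auto simp: powr_def intro!: mcfun_cong_psd)
qed (use assms in auto)

lemma hs_norm_polar_pow:
  assumes "a \<in> M" shows "(hs_norm (polar_pow a u))\<^sup>2 = Re (tr (mcpow (cnj u + 1 + u) (adj a * a)))"
  using tr_gram[of "polar_pow a u"] assms by (simp add: polar_pow_gram flip: of_real_power)

lemma mstrip_polar_pow: "a \<in> M \<Longrightarrow> mstrip (\<lambda>z. polar_pow a (c + of_real b * z))"
  unfolding polar_pow_def by (intro mstrip_mult mstrip_const mstrip_mcpow psd_gram)

lemma balanced_factorization: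
  assumes a: "a \<in> M"
  obtains g h where "g \<in> M" "h \<in> M" "a = g * adj h"
    "hs_norm (g * adj g) = hs_norm a" "hs_norm (h * adj h) = hs_norm a"
proof
  have gram_psd: "psd n (adj a * a)" using a by (rule psd_gram)
  let ?g = "polar_pow a (- 1/4)" and ?h = "mcpow (1/4) (adj a * a)"
  show closed: "?g \<in> M" "?h \<in> M" using a gram_psd by auto
  have "?g * adj ?h = a * (mcpow (- 1/4) (adj a * a) * mcpow (1/4) (adj a * a))"
    using a gram_psd by (simp add: polar_pow_def mcpow_adj M_assoc)
  also have "\<dots> = polar_pow a 0" unfolding polar_pow_def mcpow_mult[OF gram_psd] by simp
  finally show "a = ?g * adj ?h" using a by (simp add: polar_pow_0)
  have half: "mcpow (1/2) (adj a * a) * mcpow (1/2) (adj a * a) = adj a * a"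
    unfolding mcpow_mult[OF gram_psd] using mcpow_1[OF gram_psd] by simp
  have h_gram: "?h * adj ?h = mcpow (1/2) (adj a * a)"
    using gram_psd by (simp add: mcpow_adj mcpow_mult)
  have g_gram: "adj ?g * ?g = mcpow (1/2) (adj a * a)" unfolding polar_pow_gram[OF a] by simp
  have norm_eqI: "hs_norm (x * adj x) = hs_norm a"
    if "x \<in> M" "tr (adj (x * adj x) * (x * adj x)) = tr (adj a * a)" for x
    using that a tr_gram[of "x * adj x"] tr_gram[OF a] by (simp flip: of_real_power)
  show "hs_norm (?h * adj ?h) = hs_norm a"
    using norm_eqI[OF closed(2)] gram_psd unfolding h_gram by (simp add: mcpow_adj half)
  have "tr (adj (?g * adj ?g) * (?g * adj ?g)) = tr (?g * (adj ?g * ?g * adj ?g))"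
    using closed by (simp add: adj_mult M_assoc)
  also have "\<dots> = tr (adj ?g * ?g * adj ?g * ?g)" using closed by (intro tr_mult_commute) auto
  also have "\<dots> = tr ((adj ?g * ?g) * (adj ?g * ?g))" using closed by (simp add: M_assoc)
  also have "\<dots> = tr (adj a * a)" unfolding g_gram half ..
  finally show "hs_norm (?g * adj ?g) = hs_norm a" by (rule norm_eqI[OF closed(1)])
qed

lemma schatten_eq_tr_mcpow:
  assumes Y: "Y \<in> M"
  shows "schatten (ereal r) Y = (Re (tr (mcpow (of_real (r / 2)) (adj Y * Y)))) powr (1 / r)"
  using psd_gram[OF Y] by (simp add: schatten_def mabs_def mpow_mpow) (simp add: mpow_eq_mcpow)

lemma schatten_2: "Y \<in> M \<Longrightarrow> schatten 2 Y = hs_norm Y"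
  using schatten_eq_tr_mcpow[of Y 2] mcpow_1[OF psd_gram[of Y]]
  by (simp add: tr_gram powr_half_sqrt flip: of_real_power)

lemma vnorm_L2: "v \<in> carrier_vec n \<Longrightarrow> vnorm v = L2_set (\<lambda>i. cmod (v $ i)) {..<n}"
  by (simp add: vnorm_def L2_set_def)

lemma hs_norm_square_cols: "B \<in> M \<Longrightarrow> (hs_norm B)\<^sup>2 = (\<Sum>k<n. (vnorm (col B k))\<^sup>2)"
  unfolding hs_norm_square by (subst sum.swap) (simp add: vnorm_L2 L2_set_def sum_nonneg)

lemma vnorm_mult_le:
  assumes Y: "Y \<in> M" and v: "v \<in> carrier_vec n" shows "vnorm (Y *\<^sub>v v) \<le> hs_norm Y * vnorm v"
proof (cases "n = 0")
  case True
  then show ?thesis using assms by (simp add: vnorm_def)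
next
  case False
  have "(hs_norm (first_column v))\<^sup>2 = (\<Sum>k<n. if k = 0 then (vnorm v)\<^sup>2 else 0)"
    unfolding hs_norm_square_cols[OF first_column_closed]
    by (intro sum.cong) (auto simp: col_first_column[OF v] vnorm_eq_0_iff)
  then have "(hs_norm (first_column v))\<^sup>2 = (vnorm v)\<^sup>2" using False by simp
  then have column_norm: "hs_norm (first_column v) = vnorm v" by simp
  have "(vnorm (Y *\<^sub>v v))\<^sup>2 \<le> (\<Sum>k<n. (vnorm (col (Y * first_column v) k))\<^sup>2)"
    using member_le_sum[of 0 "{..<n}" "\<lambda>k. (vnorm (col (Y * first_column v) k))\<^sup>2"] False
    by (simp add: col_mult2[OF Y first_column_closed] col_first_column[OF v])
  also have "\<dots> = (hs_norm (Y * first_column v))\<^sup>2" using Y by (simp add: hs_norm_square_cols)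
  also have "\<dots> \<le> (hs_norm Y * vnorm v)\<^sup>2"
    using hs_norm_submult[OF Y first_column_closed[of v]] unfolding column_norm
    by (intro power_mono) auto
  finally show ?thesis by (simp add: power2_le_iff_abs_le)
qed

lemma vnorm_smult_of_real: "vnorm (complex_of_real c \<cdot>\<^sub>v w) = \<bar>c\<bar> * vnorm w"
  by (simp add: vnorm_def norm_mult power_mult_distrib real_sqrt_mult flip: sum_distrib_left)

lemma vnorm_le_opnorm:
  assumes Y: "Y \<in> M" and v: "v \<in> carrier_vec n" "vnorm v \<le> 1"
  shows "vnorm (Y *\<^sub>v v) \<le> opnorm Y"
  unfolding opnorm_def
proof (rule cSup_upper)
  show "vnorm (Y *\<^sub>v v) \<in> {vnorm (Y *\<^sub>v v) | v. v \<in> carrier_vec (dim_col Y) \<and> vnorm v \<le> 1}"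
    using Y v by auto
  show "bdd_above {vnorm (Y *\<^sub>v v) | v. v \<in> carrier_vec (dim_col Y) \<and> vnorm v \<le> 1}"
  proof (rule bdd_aboveI)
    fix x assume "x \<in> {vnorm (Y *\<^sub>v v) | v. v \<in> carrier_vec (dim_col Y) \<and> vnorm v \<le> 1}"
    then obtain w where w: "x = vnorm (Y *\<^sub>v w)" "w \<in> carrier_vec n" "vnorm w \<le> 1" using Y by auto
    have "x \<le> hs_norm Y * vnorm w" using vnorm_mult_le[OF Y w(2)] w(1) by simp
    also have "\<dots> \<le> hs_norm Y * 1" using w(3) by (intro mult_left_mono) auto
    finally show "x \<le> hs_norm Y" by simp
  qed
qed

lemma vnorm_mult_le_opnorm:
  assumes Y: "Y \<in> M" and v: "v \<in> carrier_vec n"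
  shows "vnorm (Y *\<^sub>v v) \<le> opnorm Y * vnorm v"
proof (cases "vnorm v = 0")
  case True
  then show ?thesis using vnorm_mult_le[OF Y v] by simp
next
  case False
  then have pos: "0 < vnorm v" using vnorm_nonneg[of v] by linarith
  have unit: "vnorm (complex_of_real (1 / vnorm v) \<cdot>\<^sub>v v) \<le> 1"
    using pos unfolding vnorm_smult_of_real by simp
  have "1 / vnorm v * vnorm (Y *\<^sub>v v) = vnorm (complex_of_real (1 / vnorm v) \<cdot>\<^sub>v (Y *\<^sub>v v))"
    using pos unfolding vnorm_smult_of_real by simp
  also have "\<dots> = vnorm (Y *\<^sub>v (complex_of_real (1 / vnorm v) \<cdot>\<^sub>v v))"
    using Y v by (simp only: mult_mat_vec)
  also have "\<dots> \<le> opnorm Y" using v unit by (intro vnorm_le_opnorm[OF Y]) auto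
  finally show ?thesis using pos by (simp add: field_simps)
qed

lemma opnorm_nonneg: assumes Y: "Y \<in> M" shows "0 \<le> opnorm Y"
proof -
  have "vnorm (Y *\<^sub>v 0\<^sub>v n) \<le> opnorm Y" by (rule vnorm_le_opnorm[OF Y]) (simp_all add: vnorm_def)
  then show ?thesis using vnorm_nonneg order_trans by blast
qed

lemma hs_norm_mult_le_opnorm:
  assumes "Y \<in> M" "B \<in> M" shows "hs_norm (Y * B) \<le> opnorm Y * hs_norm B"
proof -
  have "(hs_norm (Y * B))\<^sup>2 = (\<Sum>k<n. (vnorm (Y *\<^sub>v col B k))\<^sup>2)"
    using assms by (simp add: hs_norm_square_cols mult_mat_vec_def)
  also have "\<dots> \<le> (\<Sum>k<n. (opnorm Y * vnorm (col B k))\<^sup>2)"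
    using vnorm_mult_le_opnorm[OF assms(1)] assms by (intro sum_mono power_mono) auto
  also have "\<dots> = (opnorm Y * hs_norm B)\<^sup>2"
    using assms by (simp add: power_mult_distrib hs_norm_square_cols sum_distrib_left)
  finally show ?thesis using opnorm_nonneg[OF assms(1)] by (simp add: power2_le_iff_abs_le)
qed

end

context decohering_qms
begin

abbreviation sigma_pow :: "complex \<Rightarrow> complex mat" where "sigma_pow z \<equiv> mcpow z \<sigma>"

lemma sigma_psd: "psd n \<sigma>" using sigma_pd pdD by blast

lemma sigma_pow_closed [simp]: "sigma_pow z \<in> M" using sigma_psd by simp
lemma sigma_pow_mult:
  "sigma_pow z * sigma_pow w = sigma_pow (z + w)" using sigma_psd by (rule mcpow_mult)
lemma sigma_pow_mult_left: "C \<in> M \<Longrightarrow> sigma_pow z * (sigma_pow w * C) = sigma_pow (z + w) * C"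
  using sigma_psd by (rule mcpow_mult_left)
lemma sigma_pow_0 [simp]: "sigma_pow 0 = 1\<^sub>m n" using sigma_pd by (rule mcpow_0)
lemma sigma_pow_1: "sigma_pow 1 = \<sigma>" using sigma_psd by (rule mcpow_1)
lemma sigma_pow_adj: "adj (sigma_pow z) = sigma_pow (cnj z)" using sigma_psd by (rule mcpow_adj)

lemma sigma_pow_dfa_commute: "A \<in> N \<Longrightarrow> sigma_pow z * A = A * sigma_pow z"
  using sigma_commute[of A] by (intro mcpow_commute sigma_psd) (auto simp: dfa_carrier)

lemma sigma_pow_dfa_commute_left: "A \<in> N \<Longrightarrow> C \<in> M \<Longrightarrow> sigma_pow z * (A * C) = A * (sigma_pow z * C)"
  using sigma_pow_dfa_commute[of A z] dfa_carrier[of A] by (simp flip: M_assoc)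

lemma Gam_eq_sigma_pow:
  "Gam n L s X = sigma_pow (of_real (s / 2)) * X * sigma_pow (of_real (s / 2))"
  using sigma_psd by (simp add: Gam_def mpow_eq_mcpow)

abbreviation \<Gamma> :: "complex mat \<Rightarrow> complex mat" where "\<Gamma> X \<equiv> sigma_pow (1/4) * X * sigma_pow (1/4)"
abbreviation \<Gamma>_inv :: "complex mat \<Rightarrow> complex mat" where
  "\<Gamma>_inv X \<equiv> sigma_pow (- (1/4)) * X * sigma_pow (- (1/4))"

lemma Gamma_Gamma_inv: "X \<in> M \<Longrightarrow> \<Gamma> (\<Gamma>_inv X) = X"
  by (simp add: M_assoc sigma_pow_mult sigma_pow_mult_left)

lemma Gamma_inv_Gamma: "X \<in> M \<Longrightarrow> \<Gamma>_inv (\<Gamma> X) = X"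
  by (simp add: M_assoc sigma_pow_mult sigma_pow_mult_left)

lemma wnorm_2_eq_hs_norm: "X \<in> M \<Longrightarrow> wnorm n L 2 X = hs_norm (\<Gamma> X)"
  using schatten_2[of "\<Gamma> X"] by (simp add: wnorm_def einv_def Gam_eq_sigma_pow)

definition sigma_moment :: "real \<Rightarrow> complex mat \<Rightarrow> real" where
  "sigma_moment \<kappa> a = Re (tr (\<sigma> * mcpow (of_real (2 / \<kappa>)) (adj a * a)))"

(* The factor a commutes with \<sigma>, so |a \<sigma>^(\<kappa>/4)|^(4/\<kappa>) = \<sigma> |a|^(4/\<kappa>). *)
lemma wnorm_dfa:
  assumes a: "a \<in> N" and \<kappa>: "0 < \<kappa>"
  shows "wnorm n L (ereal (4 / \<kappa>)) a = sigma_moment \<kappa> a powr (\<kappa> / 4)"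
proof -
  note closed = dfa_carrier[OF a] dfa_carrier[OF dfa_adj[OF a]]
  let ?A = "adj a * a" and ?S = "sigma_pow (of_real (\<kappa> / 2))" and ?s = "sigma_pow (of_real (\<kappa> / 4))"
  have A: "psd n ?A" "?A \<in> N" using closed(1) a by (auto intro: psd_gram dfa_mult dfa_adj)
  define b where "b = Gam n L (einv (ereal (4 / \<kappa>))) a"
  have b_eq: "b = a * ?s"
    using \<kappa> closed a
    by (simp add: b_def Gam_eq_sigma_pow einv_def sigma_pow_dfa_commute M_assoc sigma_pow_mult)
  then have b: "b \<in> M" using closed by simp
  have "adj b * b = ?s * (?A * ?s)" unfolding b_eq
    using closed by (simp add: adj_mult sigma_pow_adj M_assoc)
  also have "\<dots> = ?A * (?s * ?s)" using A closed by (subst sigma_pow_dfa_commute_left) auto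
  also have "\<dots> = ?A * ?S" by (simp add: sigma_pow_mult)
  finally have "mcpow (of_real (2 / \<kappa>)) (adj b * b) = mcpow (of_real (2 / \<kappa>)) (?A * ?S)" by simp
  also have "\<dots> = mcpow (of_real (2 / \<kappa>)) ?A * mcpow (of_real (2 / \<kappa>)) ?S"
    using sigma_pow_dfa_commute[OF A(2)]
    by (intro mcpow_mult_commuting A(1) mcpow_real_psd sigma_psd) simp
  also have "mcpow (of_real (2 / \<kappa>)) ?S = \<sigma>"
    using \<kappa> sigma_psd by (simp add: mcpow_mcpow sigma_pow_1 del: of_real_divide flip: of_real_mult)
  finally have "tr (mcpow (of_real (2 / \<kappa>)) (adj b * b)) = tr (\<sigma> * mcpow (of_real (2 / \<kappa>)) ?A)"
    using A(1) tr_mult_commute[of "mcpow (of_real (2 / \<kappa>)) ?A" \<sigma>] by simp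
  then show ?thesis using \<kappa> b
    by (simp add: wnorm_def schatten_eq_tr_mcpow sigma_moment_def flip: b_def)
qed

lemma dfa_polar_pow: assumes "a \<in> N" shows "polar_pow a u \<in> N"
  unfolding polar_pow_def using assms dfa_carrier[OF assms]
  by (intro dfa_mult dfa_mcpow psd_gram dfa_adj)

lemma hs_norm_sigma_half_dfa:
  assumes A: "A \<in> N" and adj_A: "adj A = A"
  shows "(hs_norm (sigma_pow (1/2) * A))\<^sup>2 = Re (tr (\<sigma> * (A * A)))"
proof -
  note A_closed = dfa_carrier[OF A]
  let ?B = "sigma_pow (1/2) * A"
  have "adj ?B * ?B = A * (sigma_pow 1 * A)"
    using A_closed adj_A by (simp add: adj_mult sigma_pow_adj M_assoc sigma_pow_mult_left)
  also have "\<dots> = sigma_pow 1 * (A * A)"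
    using A_closed by (simp add: sigma_pow_dfa_commute_left[OF A])
  finally have "adj ?B * ?B = \<sigma> * (A * A)" by (simp add: sigma_pow_1)
  then show ?thesis using tr_gram[of ?B] A_closed by (simp flip: of_real_power)
qed

lemma hs_norm_sigma_half_gram:
  assumes c: "c \<in> N"
  shows "(hs_norm (sigma_pow (1/2) * (c * adj c)))\<^sup>2 = Re (tr (\<sigma> * ((adj c * c) * (adj c * c))))"
proof -
  note c_closed = dfa_carrier[OF c]
  have "(hs_norm (sigma_pow (1/2) * (c * adj c)))\<^sup>2 = Re (tr (\<sigma> * ((c * adj c) * (c * adj c))))"
    using c c_closed by (intro hs_norm_sigma_half_dfa dfa_mult dfa_adj) (auto simp: adj_mult)
  also have "\<sigma> * ((c * adj c) * (c * adj c)) = sigma_pow 1 * (c * (adj c * (c * adj c)))"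
    using c_closed by (simp add: sigma_pow_1 M_assoc)
  also have "\<dots> = c * (sigma_pow 1 * (adj c * (c * adj c)))"
    using c_closed by (intro sigma_pow_dfa_commute_left[OF c]) auto
  also have "tr \<dots> = tr ((sigma_pow 1 * (adj c * (c * adj c))) * c)"
    using c_closed by (intro tr_mult_commute) auto
  also have "\<dots> = tr (\<sigma> * ((adj c * c) * (adj c * c)))"
    using c_closed by (simp add: M_assoc sigma_pow_1)
  finally show ?thesis .
qed

lemma sigma_moment_polar_pow:
  assumes a: "a \<in> N" and u: "cnj u + 1 + u = of_real (1 / \<kappa>)"
  shows "sqrt (hs_norm (sigma_pow (1/2) * (polar_pow a u * adj (polar_pow a u))))
      = sigma_moment \<kappa> a powr (1/4)"
    and "sqrt (hs_norm (sigma_pow (1/2) * (adj (polar_pow a u) * polar_pow a u)))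
        = sigma_moment \<kappa> a powr (1/4)"
proof -
  note a_closed = dfa_carrier[OF a] and gram_psd = psd_gram[OF dfa_carrier[OF a]]
  define c where "c = polar_pow a u"
  have c: "c \<in> N" "c \<in> M" using a a_closed dfa_polar_pow by (auto simp: c_def)
  have gram_square: "(adj c * c) * (adj c * c) = mcpow (of_real (2 / \<kappa>)) (adj a * a)"
    unfolding c_def polar_pow_gram[OF a_closed] u mcpow_mult[OF gram_psd]
    by (simp flip: of_real_add add: field_simps)
  have root: "sqrt x = sigma_moment \<kappa> a powr (1/4)" if "x\<^sup>2 = sigma_moment \<kappa> a" "0 \<le> x" for x
  proof -
    have "sigma_moment \<kappa> a powr (1/4) = (x powr 2) powr (1/4)"
      using that by (cases "x = 0") (auto simp: powr_numeral)
    also have "\<dots> = x powr (1/2)" by (simp add: powr_powr)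
    finally show ?thesis using that by (simp add: powr_half_sqrt)
  qed
  have "sqrt (hs_norm (sigma_pow (1/2) * (c * adj c))) = sigma_moment \<kappa> a powr (1/4)"
    using hs_norm_sigma_half_gram[OF c(1)] gram_square by (intro root) (auto simp: sigma_moment_def)
  moreover have "sqrt (hs_norm (sigma_pow (1/2) * (adj c * c))) = sigma_moment \<kappa> a powr (1/4)"
    using hs_norm_sigma_half_dfa[OF dfa_mult[OF dfa_adj[OF c(1)] c(1)]] gram_square c(2)
    by (intro root) (auto simp: sigma_moment_def adj_mult)
  ultimately show "sqrt (hs_norm (sigma_pow (1/2) * (polar_pow a u * adj (polar_pow a u))))
      = sigma_moment \<kappa> a powr (1/4)"
    "sqrt (hs_norm (sigma_pow (1/2) * (adj (polar_pow a u) * polar_pow a u)))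
        = sigma_moment \<kappa> a powr (1/4)"
    by (simp_all add: c_def)
qed

end

section \<open>The relative density of a positive matrix\<close>

locale relative_density = decohering_qms +
  fixes Z :: "complex mat"
  assumes Z: "pd n Z"
begin

definition R :: "complex mat" where "R = E (sigma_pow (- (1/2)) * (Z * Z) * sigma_pow (- (1/2)))"

lemma Z_psd: "psd n Z" using Z pdD by blast
lemma Z_M [simp]: "Z \<in> M" and Z_adj [simp]: "adj Z = Z" using Z_psd psdD by auto

lemma R_arg_pd: "pd n (sigma_pow (- (1/2)) * (Z * Z) * sigma_pow (- (1/2)))"
proof -
  have "pd n (adj (sigma_pow (- (1/2))) * mcpow (of_real 2) Z * sigma_pow (- (1/2)))"
    by (rule pd_conjugation[where C = "sigma_pow (1/2)"])
      (use Z in \<open>auto simp: sigma_pow_mult intro: mcpow_real_pd simp del: of_real_numeral\<close>)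
  then show ?thesis using mcpow_2[OF Z_psd] by (simp add: sigma_pow_adj)
qed

lemma R_pd: "pd n R" unfolding R_def by (rule E_pd[OF R_arg_pd])
lemma R_psd: "psd n R" using R_pd pdD by blast
lemma dfa_R: "R \<in> N" unfolding R_def by (rule E_dfa) simp
lemma R_M [simp]: "R \<in> M" using dfa_R dfa_carrier by blast

abbreviation R_pow :: "complex \<Rightarrow> complex mat" where "R_pow z \<equiv> mcpow z R"
definition D_pow :: "complex \<Rightarrow> complex mat" where "D_pow z = sigma_pow z * R_pow z"

lemma R_pow_closed [simp]: "R_pow z \<in> M" using R_psd by simp
lemma dfa_R_pow: "R_pow z \<in> N" using R_psd dfa_R by (rule dfa_mcpow)
lemma R_pow_mult: "R_pow z * R_pow w = R_pow (z + w)" using R_psd by (rule mcpow_mult)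
lemma R_pow_mult_left:
  "C \<in> M \<Longrightarrow> R_pow z * (R_pow w * C) = R_pow (z + w) * C" using R_psd by (rule mcpow_mult_left)
lemma R_pow_0: "R_pow 0 = 1\<^sub>m n" using R_pd by (rule mcpow_0)
lemma R_pow_adj: "adj (R_pow z) = R_pow (cnj z)" using R_psd by (rule mcpow_adj)
lemma sigma_pow_R_pow:
  "sigma_pow z * R_pow w = R_pow w * sigma_pow z" by (rule sigma_pow_dfa_commute[OF dfa_R_pow])
lemma D_pow_closed [simp]: "D_pow z \<in> M" by (simp add: D_pow_def)
lemma D_pow_0: "D_pow 0 = 1\<^sub>m n" by (simp add: D_pow_def R_pow_0)
lemma D_pow_adj: "adj (D_pow z) = D_pow (cnj z)"
  by (simp add: D_pow_def adj_mult sigma_pow_adj R_pow_adj sigma_pow_R_pow)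
lemma contraction_D_pow: "Re z = 0 \<Longrightarrow> contraction (D_pow z)"
  unfolding D_pow_def by (intro contraction_mult contraction_mcpow_imaginary sigma_psd R_psd)

lemma tr_square_dfa: assumes A: "A \<in> N" shows "tr (Z * Z * A) = tr (\<sigma> * R * A)"
proof -
  note A_closed = dfa_carrier[OF A]
  let ?Y = "sigma_pow (- (1/2)) * (Z * Z) * sigma_pow (- (1/2))"
  have "tr (\<sigma> * R * A) = tr (\<sigma> * E (1\<^sub>m n * ?Y * A))"
    using E_bimodule[OF dfa_one A, of ?Y] A_closed by (simp add: R_def M_assoc)
  also have "\<dots> = tr (\<sigma> * (?Y * A))" using A_closed by (subst tr_sigma_E) auto
  also have "\<dots> = tr (sigma_pow 1 * (sigma_pow (- (1/2)) * (Z * (Z * (sigma_pow (- (1/2)) * A)))))"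
    using A_closed by (simp add: sigma_pow_1 M_assoc)
  also have "\<dots> = tr (sigma_pow (1/2) * (Z * (Z * (A * sigma_pow (- (1/2))))))"
    using A_closed by (simp add: sigma_pow_mult_left sigma_pow_dfa_commute[OF A])
  also have "\<dots> = tr ((Z * (Z * (A * sigma_pow (- (1/2))))) * sigma_pow (1/2))"
    using A_closed by (intro tr_mult_commute) auto
  also have "\<dots> = tr (Z * Z * A)" using A_closed by (simp add: M_assoc sigma_pow_mult)
  finally show ?thesis by simp
qed

lemma hs_norm_sigma_R: "hs_norm (sigma_pow (1/2) * R_pow (1/2)) = hs_norm Z"
proof -
  let ?B = "sigma_pow (1/2) * R_pow (1/2)"
  have "tr (adj ?B * ?B) = tr (sigma_pow 1 * R_pow 1)"
  proof -
    have "adj ?B * ?B = R_pow (1/2) * (sigma_pow 1 * R_pow (1/2))"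
      by (simp add: adj_mult sigma_pow_adj R_pow_adj M_assoc sigma_pow_mult_left)
    also have "\<dots> = sigma_pow 1 * (R_pow (1/2) * R_pow (1/2))"
      by (simp add: sigma_pow_dfa_commute_left[OF dfa_R_pow])
    finally show ?thesis by (simp add: R_pow_mult)
  qed
  also have "\<dots> = tr (Z * Z * 1\<^sub>m n)"
    using tr_square_dfa[OF dfa_one] sigma_closed by (simp add: sigma_pow_1 mcpow_1[OF R_psd])
  finally have "(hs_norm ?B)\<^sup>2 = (hs_norm Z)\<^sup>2"
    using tr_gram[of ?B] tr_gram[of Z] by (simp flip: of_real_power)
  then show ?thesis by simp
qed

lemma boundary_gram:
  assumes c: "c \<in> N" and w: "Re w = - 1/4" and v: "Re v = 1/4"
  defines "Q \<equiv> Z * D_pow w * c * sigma_pow v"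
  shows "Q * adj Q = Z * ((R_pow w * (c * adj c) * R_pow (cnj w)) * Z)"
proof -
  note c_closed = dfa_carrier[OF c]
  have exponents: "v + cnj v = 1/2" "w + (1/2 + cnj w) = 0"
    using v w by (simp_all add: complex_eq_iff)
  have "Q * adj Q = Z * (sigma_pow w * (R_pow w
      * (c * (sigma_pow (v + cnj v) * (adj c * (sigma_pow (cnj w) * (R_pow (cnj w) * Z)))))))"
    unfolding Q_def using c_closed
    by (simp add: adj_mult D_pow_adj sigma_pow_adj sigma_pow_mult_left M_assoc)
      (simp add: D_pow_def M_assoc)
  also have "c * (sigma_pow (v + cnj v) * (adj c * (sigma_pow (cnj w) * (R_pow (cnj w) * Z))))
     = sigma_pow (1/2) * (c * (sigma_pow (cnj w) * (adj c * (R_pow (cnj w) * Z))))"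
    unfolding exponents using c_closed c dfa_adj[OF c] by (simp add: sigma_pow_dfa_commute_left)
  also have "\<dots> = sigma_pow (1/2 + cnj w) * (c * (adj c * (R_pow (cnj w) * Z)))"
    using c_closed c by (simp add: sigma_pow_mult_left flip: sigma_pow_dfa_commute_left[OF c])
  also have "Z * (sigma_pow w
      * (R_pow w * (sigma_pow (1/2 + cnj w) * (c * (adj c * (R_pow (cnj w) * Z))))))
    = Z * (sigma_pow (w + (1/2 + cnj w)) * (R_pow w * (c * (adj c * (R_pow (cnj w) * Z)))))"
    using c_closed by (simp add: sigma_pow_mult_left flip: sigma_pow_dfa_commute_left[OF dfa_R_pow])
  finally show ?thesis unfolding exponents using c_closed by (simp add: M_assoc)
qed

lemma boundary_hs_norm_eq_tr:
  assumes c: "c \<in> N" and w: "Re w = - 1/4" and v: "Re v = 1/4"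
  shows "complex_of_real ((hs_norm (Z * D_pow w * c * sigma_pow v))\<^sup>2)
      = tr (sigma_pow 1 * (R_pow (1/2) * (c * adj c)))"
proof -
  let ?Q = "Z * D_pow w * c * sigma_pow v" and ?C = "c * adj c"
  have Q: "?Q \<in> M" and C: "?C \<in> M" "?C \<in> N"
    using dfa_carrier[OF c] c by (auto intro: dfa_mult dfa_adj)
  have exponent: "cnj w + (1 + w) = 1/2" using w by (simp add: complex_eq_iff)
  have "complex_of_real ((hs_norm ?Q)\<^sup>2) = tr (?Q * adj ?Q)"
    using tr_gram[OF Q] tr_mult_commute[of "adj ?Q" ?Q] Q by simp
  also have "\<dots> = tr (Z * Z * (R_pow w * ?C * R_pow (cnj w)))"
    unfolding boundary_gram[OF assms]
    using C tr_mult_commute[of "Z * (R_pow w * ?C * R_pow (cnj w))" Z] by (simp add: M_assoc)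
  also have "\<dots> = tr (\<sigma> * R * (R_pow w * ?C * R_pow (cnj w)))"
    by (rule tr_square_dfa[OF dfa_mult[OF dfa_mult[OF dfa_R_pow C(2)] dfa_R_pow]])
  also have "\<dots> = tr (sigma_pow 1 * (R_pow 1 * (R_pow w * ?C)) * R_pow (cnj w))"
    using C by (simp add: sigma_pow_1 mcpow_1[OF R_psd] M_assoc)
  also have "\<dots> = tr (R_pow (cnj w) * (sigma_pow 1 * (R_pow 1 * (R_pow w * ?C))))"
    using C by (intro tr_mult_commute) auto
  also have "\<dots> = tr (sigma_pow 1 * (R_pow (1/2) * ?C))"
    using C
    by (simp add: R_pow_mult_left add.assoc exponent flip: sigma_pow_dfa_commute_left[OF dfa_R_pow])
  finally show ?thesis .
qed

lemma boundary_estimate: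
  assumes c: "c \<in> N" and w: "Re w = - 1/4" and v: "Re v = 1/4"
  shows "(hs_norm (Z * D_pow w * c * sigma_pow v))\<^sup>2
      \<le> hs_norm Z * hs_norm (sigma_pow (1/2) * (c * adj c))"
proof -
  let ?Q = "Z * D_pow w * c * sigma_pow v" and ?C = "c * adj c"
  have C: "?C \<in> M" using dfa_carrier[OF c] by simp
  note boundary_hs_norm_eq_tr[OF assms]
  also have "sigma_pow 1 * (R_pow (1/2) * ?C)
      = (sigma_pow (1/2) * R_pow (1/2)) * (sigma_pow (1/2) * ?C)"
  proof -
    have "sigma_pow (1/2) * (R_pow (1/2) * (sigma_pow (1/2) * ?C))
        = sigma_pow 1 * (R_pow (1/2) * ?C)"
      using C unfolding sigma_pow_dfa_commute_left[OF dfa_R_pow C, symmetric]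
      by (simp add: sigma_pow_mult_left)
    then show ?thesis using C by (simp add: M_assoc)
  qed
  finally have "(hs_norm ?Q)\<^sup>2
      = cmod (tr ((sigma_pow (1/2) * R_pow (1/2)) * (sigma_pow (1/2) * ?C)))"
    by (metis norm_of_real abs_of_nonneg zero_le_power2)
  also have "\<dots> \<le> hs_norm (sigma_pow (1/2) * R_pow (1/2)) * hs_norm (sigma_pow (1/2) * ?C)"
    using C by (intro tr_Cauchy_Schwarz) auto
  finally show ?thesis by (simp add: hs_norm_sigma_R)
qed

end

section \<open>Interpolation between the Hilbert--Schmidt and the operator norm\<close>

context relative_density
begin

lemma mstrip_D_pow: "mstrip (\<lambda>z. D_pow (c + of_real b * z))"
  unfolding D_pow_def by (intro mstrip_mult mstrip_mcpow sigma_psd R_psd)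

lemma mcpow_Z_eq: "mcpow (1 + w) Z = Z * mcpow w Z"
  using mcpow_mult[OF Z_psd, of 1 w] mcpow_1[OF Z_psd] by simp

lemma boundary_trace_eq:
  assumes c: "c \<in> N" "c' \<in> N" and Y: "Y \<in> M"
  shows "tr (mcpow (1 + w) Z * D_pow d * (c * sigma_pow s) * Y * (sigma_pow s * c') * D_pow d')
     = tr ((mcpow (w - 1) Z * (Z * D_pow d * c * sigma_pow s))
       * (Y * (sigma_pow s * c' * D_pow d' * Z)))"
proof -
  note closed = dfa_carrier[OF c(1)] dfa_carrier[OF c(2)]
  let ?Q = "Z * D_pow d * c * sigma_pow s" and ?V = "sigma_pow s * c' * D_pow d'"
  have "mcpow w Z = mcpow (w - 1) Z * Z"
    using mcpow_mult[OF Z_psd, of "w - 1" 1] mcpow_1[OF Z_psd] by simp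
  then have "tr (mcpow (1 + w) Z * D_pow d * (c * sigma_pow s) * Y * (sigma_pow s * c') * D_pow d')
     = tr (Z * (mcpow (w - 1) Z * ?Q * (Y * ?V)))"
    unfolding mcpow_Z_eq using closed Y Z_psd by (simp add: M_assoc)
  also have "\<dots> = tr ((mcpow (w - 1) Z * ?Q * (Y * ?V)) * Z)"
    using closed Y Z_psd by (intro tr_mult_commute) auto
  finally show ?thesis using closed Y Z_psd by (simp add: M_assoc)
qed

lemma boundary_trace_estimate:
  assumes w: "Re w = 1" and d: "Re d = - 1/4" "Re d' = - 1/4" and s: "Re s = 1/4"
    and c: "c \<in> N" "c' \<in> N"
    and Y: "Y \<in> M" "0 \<le> K" "\<And>B. B \<in> M \<Longrightarrow> hs_norm (Y * B) \<le> K * hs_norm B"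
  shows "cmod (tr (mcpow (1 + w) Z * D_pow d * (c * sigma_pow s) * Y * (sigma_pow s * c')
      * D_pow d'))
     \<le> K * (hs_norm Z * sqrt (hs_norm (sigma_pow (1/2) * (c * adj c)))
       * sqrt (hs_norm (sigma_pow (1/2) * (adj c' * c'))))"
proof -
  note closed = dfa_carrier[OF c(1)] dfa_carrier[OF c(2)]
  let ?Q = "Z * D_pow d * c * sigma_pow s" and ?Q' = "sigma_pow s * c' * D_pow d' * Z"
  have Q: "?Q \<in> M" "?Q' \<in> M" using closed by auto
  have "cmod (tr (mcpow (1 + w) Z * D_pow d * (c * sigma_pow s) * Y * (sigma_pow s * c')
      * D_pow d'))
      \<le> hs_norm (mcpow (w - 1) Z * ?Q) * hs_norm (Y * ?Q')"
    unfolding boundary_trace_eq[OF c Y(1)]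
    using tr_Cauchy_Schwarz[of "mcpow (w - 1) Z * ?Q" "Y * ?Q'"] closed Y Z_psd by simp
  also have "\<dots> \<le> hs_norm ?Q * (K * hs_norm ?Q')"
    using contractionD(2)[OF contraction_mcpow_imaginary[OF Z_psd, of "w - 1"] Q(1)] Y(3)[OF Q(2)] w
    by (intro mult_mono) auto
  also have "\<dots> \<le> sqrt (hs_norm Z * hs_norm (sigma_pow (1/2) * (c * adj c)))
      * (K * sqrt (hs_norm Z * hs_norm (sigma_pow (1/2) * (adj c' * c'))))"
  proof (intro mult_mono)
    show "hs_norm ?Q \<le> sqrt (hs_norm Z * hs_norm (sigma_pow (1/2) * (c * adj c)))"
      using boundary_estimate[OF c(1) d(1) s] by (rule real_le_rsqrt)
    have "adj ?Q' = Z * D_pow (cnj d') * adj c' * sigma_pow (cnj s)"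
      using closed by (simp add: adj_mult D_pow_adj sigma_pow_adj M_assoc)
    then have "hs_norm ?Q' = hs_norm (Z * D_pow (cnj d') * adj c' * sigma_pow (cnj s))"
      using hs_norm_adj[OF Q(2)] by simp
    then show "hs_norm ?Q' \<le> sqrt (hs_norm Z * hs_norm (sigma_pow (1/2) * (adj c' * c')))"
      using boundary_estimate[OF dfa_adj[OF c(2)], of "cnj d'" "cnj s"] d s
      by (intro real_le_rsqrt) simp
  qed (use Y in auto)
  also have "\<dots> = K * (hs_norm Z * sqrt (hs_norm (sigma_pow (1/2) * (c * adj c)))
      * sqrt (hs_norm (sigma_pow (1/2) * (adj c' * c'))))"
    by (simp add: real_sqrt_mult)
  finally show ?thesis .
qed

definition density_pairing :: "real \<Rightarrow> real \<Rightarrow> complex mat \<Rightarrow> complex" where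
  "density_pairing \<kappa> \<eta> W = tr (mcpow (1 + of_real \<kappa>) Z * D_pow (of_real (- \<kappa>/4) - \<i> * of_real \<eta>) * W
     * D_pow (of_real (- \<kappa>/4) + \<i> * of_real \<eta>))"

subsection \<open>Finite exponents\<close>

context
  fixes \<kappa> \<eta> :: real and a b Y :: "complex mat"
  assumes a: "a \<in> N" and b: "b \<in> N" and Y: "Y \<in> M" and \<kappa>: "0 < \<kappa>" "\<kappa> < 1"
begin

(* All exponents of a, b and Y vanish at w = \<kappa>, while those of a and b have real part -1/2 on
   Re w = 0, and that of Y on Re w = 1: there the polar powers are contractions. The summands 0 and
   factors 1 below put every exponent into the form c + of_real b * w. *)
definition exponent_N :: "complex \<Rightarrow> complex" where
  "exponent_N w = - 1/2 + of_real (1 / (2 * \<kappa>)) * w"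

definition exponent_Y :: "complex \<Rightarrow> complex" where
  "exponent_Y w = (- 1 + of_real (1 / (1 - \<kappa>)) * (1 - w)) / 2"

definition pairing_family :: "complex \<Rightarrow> complex" where
  "pairing_family w = tr (mcpow (1 + of_real 1 * w) Z
      * D_pow (- (\<i> * of_real \<eta>) + of_real (- 1/4) * w)
     * (polar_pow a (exponent_N w) * sigma_pow (0 + of_real (1/4) * w)) * polar_pow Y (exponent_Y w)
     * (sigma_pow (0 + of_real (1/4) * w) * polar_pow b (exponent_N w))
       * D_pow (\<i> * of_real \<eta> + of_real (- 1/4) * w))"

lemma exponent_N_gram: "cnj (exponent_N w) + 1 + exponent_N w = of_real (Re w / \<kappa>)"
  using \<kappa> by (simp add: exponent_N_def complex_eq_iff)

lemma exponent_Y_gram: "cnj (exponent_Y w) + 1 + exponent_Y w = of_real ((1 - Re w) / (1 - \<kappa>))"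
  using \<kappa> by (simp add: exponent_Y_def complex_eq_iff)

lemma exponent_N_kappa: "exponent_N (of_real \<kappa>) = 0"
  using \<kappa> by (simp add: exponent_N_def)

lemma exponent_Y_kappa: "exponent_Y (of_real \<kappa>) = 0"
  using \<kappa> by (simp add: exponent_Y_def complex_eq_iff)

lemma strip_bounded_pairing_family: "strip_bounded pairing_family"
proof -
  define c where "c = 1 / (1 - \<kappa>)"
  have "exponent_Y w = of_real ((c - 1)/2) + of_real (- c/2) * w" for w
    unfolding exponent_Y_def c_def[symmetric] by (simp add: field_simps)
  then have "mstrip (\<lambda>w. polar_pow Y (exponent_Y w))" by (simp only: mstrip_polar_pow[OF Y])
  then show ?thesis
    unfolding pairing_family_def exponent_N_def
    by (intro mstrip_tr mstrip_mult mstrip_D_pow mstrip_polar_pow mstrip_mcpow Z_psd sigma_psd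
        dfa_carrier[OF a] dfa_carrier[OF b])
qed

lemma pairing_family_left:
  assumes w: "Re w = 0"
  shows "cmod (pairing_family w)
      \<le> hs_norm Z * sqrt (Re (tr (mcpow (of_real (1 / (1 - \<kappa>))) (adj Y * Y))))"
proof -
  note closed = dfa_carrier[OF a] dfa_carrier[OF b] Y
  let ?u = "exponent_N w" and ?s = "sigma_pow (0 + of_real (1/4) * w)"
  let ?A = "mcpow w Z * (D_pow (- (\<i> * of_real \<eta>) + of_real (- 1/4) * w) * (polar_pow a ?u * ?s))"
    and ?B = "(?s * polar_pow b ?u) * D_pow (\<i> * of_real \<eta> + of_real (- 1/4) * w)"
  have Re_u: "Re ?u = - 1/2" using w by (simp add: exponent_N_def)
  have A: "contraction ?A" and B: "contraction ?B"
    using w Re_u closed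
    by (auto intro!: contraction_mult contraction_mcpow_imaginary contraction_D_pow
        contraction_polar_pow Z_psd sigma_psd)
  have AB: "?A \<in> M" "?B \<in> M" using contractionD(1)[OF A] contractionD(1)[OF B] .
  have "pairing_family w = tr ((Z * ?A) * (polar_pow Y (exponent_Y w) * ?B))"
    using closed Z_psd by (simp add: pairing_family_def mcpow_Z_eq M_assoc)
  then have "cmod (pairing_family w) \<le> hs_norm (Z * ?A) * hs_norm (polar_pow Y (exponent_Y w) * ?B)"
    using tr_Cauchy_Schwarz[of "Z * ?A" "polar_pow Y (exponent_Y w) * ?B"] AB Y by simp
  also have "\<dots> \<le> hs_norm Z * hs_norm (polar_pow Y (exponent_Y w))"
    using contraction_mult_right[OF A] contraction_mult_right[OF B] Y by (intro mult_mono) auto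
  also have "(hs_norm (polar_pow Y (exponent_Y w)))\<^sup>2
      = Re (tr (mcpow (of_real (1 / (1 - \<kappa>))) (adj Y * Y)))"
    unfolding hs_norm_polar_pow[OF Y] exponent_Y_gram w by simp
  then have "hs_norm (polar_pow Y (exponent_Y w))
      = sqrt (Re (tr (mcpow (of_real (1 / (1 - \<kappa>))) (adj Y * Y))))"
    by (metis hs_norm_nonneg real_sqrt_abs abs_of_nonneg)
  finally show ?thesis .
qed

lemma pairing_family_right:
  assumes w: "Re w = 1"
  shows "cmod (pairing_family w)
      \<le> hs_norm Z * sigma_moment \<kappa> a powr (1/4) * sigma_moment \<kappa> b powr (1/4)"
proof -
  have "contraction (polar_pow Y (exponent_Y w))"
    by (rule contraction_polar_pow[OF Y]) (use w in \<open>simp add: exponent_Y_def\<close>)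
  note Y_contraction = contractionD[OF this]
  have "cmod (pairing_family w) \<le> 1 * (hs_norm Z
      * sqrt (hs_norm (sigma_pow (1/2)
        * (polar_pow a (exponent_N w) * adj (polar_pow a (exponent_N w)))))
      * sqrt (hs_norm (sigma_pow (1/2)
        * (adj (polar_pow b (exponent_N w)) * polar_pow b (exponent_N w)))))"
    unfolding pairing_family_def
    by (rule boundary_trace_estimate) (use w a b Y_contraction in \<open>auto intro: dfa_polar_pow\<close>)
  also have "\<dots> = hs_norm Z * sigma_moment \<kappa> a powr (1/4) * sigma_moment \<kappa> b powr (1/4)"
    using sigma_moment_polar_pow(1)[OF a, of "exponent_N w" \<kappa>]
      sigma_moment_polar_pow(2)[OF b, of "exponent_N w" \<kappa>]
      exponent_N_gram[of w] w by simp
  finally show ?thesis .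
qed

lemma pairing_family_kappa:
  "pairing_family (of_real \<kappa>)
      = density_pairing \<kappa> \<eta> (a * sigma_pow (of_real (\<kappa>/4)) * Y * (sigma_pow (of_real (\<kappa>/4)) * b))"
proof -
  have exponents: "- (\<i> * of_real \<eta>) + of_real (- 1/4) * of_real \<kappa>
      = of_real (- \<kappa>/4) - \<i> * of_real \<eta>"
    "\<i> * of_real \<eta> + of_real (- 1/4) * of_real \<kappa> = of_real (- \<kappa>/4) + \<i> * of_real \<eta>"
    by (simp_all add: complex_eq_iff)
  show ?thesis
    unfolding pairing_family_def density_pairing_def exponents
    using dfa_carrier[OF a] dfa_carrier[OF b] Y Z_psd
    by (simp add: exponent_N_kappa exponent_Y_kappa polar_pow_0 M_assoc)
qed

lemma density_pairing_finite:
  "cmod (density_pairing \<kappa> \<eta> (a * sigma_pow (of_real (\<kappa>/4)) * Y * (sigma_pow (of_real (\<kappa>/4)) * b)))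
     \<le> hs_norm Z * (sigma_moment \<kappa> a powr (\<kappa>/4) * sigma_moment \<kappa> b powr (\<kappa>/4)
         * Re (tr (mcpow (of_real (1 / (1 - \<kappa>))) (adj Y * Y))) powr ((1 - \<kappa>)/2))"
proof -
  define h where "h = Re (tr (mcpow (of_real (1 / (1 - \<kappa>))) (adj Y * Y)))"
  have "h = (hs_norm (polar_pow Y (exponent_Y 0)))\<^sup>2"
    unfolding hs_norm_polar_pow[OF Y] exponent_Y_gram h_def by simp
  then have h: "0 \<le> h" by simp
  let ?M0 = "hs_norm Z * sqrt h"
    and ?M1 = "hs_norm Z * sigma_moment \<kappa> a powr (1/4) * sigma_moment \<kappa> b powr (1/4)"
  have "cmod (pairing_family (of_real \<kappa>)) \<le> ?M0 powr (1 - \<kappa>) * ?M1 powr \<kappa>"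
    using h \<kappa> pairing_family_left pairing_family_right
    by (intro three_lines[OF strip_bounded_pairing_family]) (auto simp: h_def)
  also have "\<dots> = (hs_norm Z powr (1 - \<kappa>) * hs_norm Z powr \<kappa>)
      * (sigma_moment \<kappa> a powr (\<kappa>/4) * sigma_moment \<kappa> b powr (\<kappa>/4) * h powr ((1 - \<kappa>)/2))"
  proof -
    have "sqrt h powr (1 - \<kappa>) = h powr ((1 - \<kappa>)/2)"
      using h by (simp add: powr_half_sqrt[symmetric] powr_powr)
    then show ?thesis using h by (simp add: powr_mult powr_powr mult_ac)
  qed
  also have "hs_norm Z powr (1 - \<kappa>) * hs_norm Z powr \<kappa> = hs_norm Z" by (simp flip: powr_add)
  finally show ?thesis by (simp add: pairing_family_kappa h_def)
qed

end

subsection \<open>The duality estimate for the (2,p) norm\<close>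

lemma Gamma_bimodule_split:
  assumes a: "a \<in> N" and b: "b \<in> N" and Y: "Y \<in> M"
  shows "\<Gamma> (a * Y * b) = a * sigma_pow (of_real ((1 - 2 * e)/4)) * Gam n L e Y
      * (sigma_pow (of_real ((1 - 2 * e)/4)) * b)"
proof -
  note closed = dfa_carrier[OF a] dfa_carrier[OF b]
  let ?k = "sigma_pow (of_real ((1 - 2 * e)/4))" and ?e = "sigma_pow (of_real (e / 2))"
  have "of_real ((1 - 2 * e)/4) + of_real (e / 2) = (1/4 :: complex)"
    "of_real (e / 2) + of_real ((1 - 2 * e)/4) = (1/4 :: complex)"
    by (simp_all add: field_simps)
  then have split: "?k * ?e = sigma_pow (1/4)" "?e * ?k = sigma_pow (1/4)"
    by (simp_all only: sigma_pow_mult)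
  have "\<Gamma> (a * Y * b) = a * (sigma_pow (1/4) * (Y * (sigma_pow (1/4) * b)))"
    using closed Y
    by (simp add: M_assoc sigma_pow_dfa_commute_left[OF a] sigma_pow_dfa_commute[OF b])
  also have "\<dots> = a * ((?k * ?e) * (Y * ((?e * ?k) * b)))" by (simp only: split)
  also have "\<dots> = a * ?k * Gam n L e Y * (?k * b)"
    unfolding Gam_eq_sigma_pow using closed Y by (simp only: M_assoc M_closed sigma_pow_closed)
  finally show ?thesis .
qed

lemma density_pairing_infinite:
  assumes a: "a \<in> N" and b: "b \<in> N" and Y: "Y \<in> M"
  shows "cmod (density_pairing 1 \<eta> (a * sigma_pow (of_real (1/4)) * Y
      * (sigma_pow (of_real (1/4)) * b)))
     \<le> hs_norm Z * (sigma_moment 1 a powr (1/4) * sigma_moment 1 b powr (1/4) * opnorm Y)"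
proof -
  have root: "sigma_moment 1 x powr (1/4) = sqrt (hs_norm (sigma_pow (1/2) * (x * adj x)))"
    "sigma_moment 1 x powr (1/4) = sqrt (hs_norm (sigma_pow (1/2) * (adj x * x)))" if "x \<in> N" for x
    using sigma_moment_polar_pow[OF that, of 0 1] dfa_carrier[OF that]
    by (simp_all add: polar_pow_0)
  have "cmod (tr (mcpow (1 + of_real 1) Z * D_pow (of_real (- 1/4) - \<i> * of_real \<eta>)
      * (a * sigma_pow (of_real (1/4))) * Y
      * (sigma_pow (of_real (1/4)) * b) * D_pow (of_real (- 1/4) + \<i> * of_real \<eta>)))
    \<le> opnorm Y * (hs_norm Z * sqrt (hs_norm (sigma_pow (1/2) * (a * adj a)))
      * sqrt (hs_norm (sigma_pow (1/2) * (adj b * b))))"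
    by (rule boundary_trace_estimate)
      (use a b Y in \<open>auto intro: hs_norm_mult_le_opnorm opnorm_nonneg\<close>)
  then show ?thesis
    unfolding density_pairing_def root(1)[OF a] root(2)[OF b]
    using dfa_carrier[OF a] dfa_carrier[OF b] Y Z_psd by (simp add: M_assoc mult_ac)
qed

lemma density_pairing_bimodule:
  fixes p :: ereal
  assumes a: "a \<in> N" and b: "b \<in> N" and Y: "Y \<in> M" and p: "2 < p" and \<kappa>: "\<kappa> = 1 - 2 * einv p"
  shows "cmod (density_pairing \<kappa> \<eta> (\<Gamma> (a * Y * b)))
     \<le> hs_norm Z * (wnorm n L (ereal (4 / \<kappa>)) a * wnorm n L (ereal (4 / \<kappa>)) b * wnorm n L p Y)"
proof -
  let ?Y = "Gam n L (einv p) Y"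
  have Y': "?Y \<in> M" using Y by (simp add: Gam_eq_sigma_pow)
  note pos = one_minus_2_einv_pos[OF p, folded \<kappa>]
  note split = Gamma_bimodule_split[OF a b Y, of "einv p", folded \<kappa>]
  note norms = wnorm_dfa[OF a pos] wnorm_dfa[OF b pos]
  show ?thesis
  proof (cases "p = \<infinity>")
    case True
    then have "\<kappa> = 1" by (simp add: \<kappa> einv_def)
    then show ?thesis
      unfolding split norms using density_pairing_infinite[OF a b Y', of \<eta>] True
      by (simp add: wnorm_def schatten_def)
  next
    case False
    then obtain r where r: "p = ereal r" "2 < r" using p by (cases p) auto
    have "\<kappa> < 1" "1 / (1 - \<kappa>) = r / 2" "(1 - \<kappa>) / 2 = 1 / r"
      using r unfolding \<kappa> by (auto simp: einv_def)
    moreover from this have "wnorm n L p Y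
        = Re (tr (mcpow (of_real (1 / (1 - \<kappa>))) (adj ?Y * ?Y))) powr ((1 - \<kappa>)/2)"
      using schatten_eq_tr_mcpow[OF Y', of r] r by (simp add: wnorm_def)
    ultimately show ?thesis
      unfolding split norms using density_pairing_finite[OF a b Y' pos, of \<eta>] by simp
  qed
qed

lemma density_pairing_le_abnorm:
  fixes p :: ereal
  assumes p: "2 < p" and \<kappa>: "\<kappa> = 1 - 2 * einv p" and X: "X \<in> M"
  shows "cmod (density_pairing \<kappa> \<eta> (\<Gamma> X)) \<le> hs_norm Z * abnorm n L 2 p X"
proof -
  let ?q = "ereal (4 / \<kappa>)"
  let ?S = "{wnorm n L ?q a * wnorm n L ?q b * wnorm n L p Y | a b Y.
      a \<in> N \<and> b \<in> N \<and> Y \<in> M \<and> X = a * Y * b}"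
  note pos = one_minus_2_einv_pos[OF p, folded \<kappa>]
  have conjugate: "einv 2 - einv p = \<kappa> / 2" unfolding \<kappa> by (simp add: einv_def)
  have abnorm: "abnorm n L 2 p X = Inf ?S" unfolding abnorm_def Let_def conjugate using pos by simp
  have "X = 1\<^sub>m n * X * 1\<^sub>m n" using X by simp
  then have nonempty: "?S \<noteq> {}" using dfa_one X by blast
  show ?thesis
  proof (cases "hs_norm Z = 0")
    case True
    then show ?thesis
      using density_pairing_bimodule[OF dfa_one dfa_one X p \<kappa>, of \<eta>] X by simp
  next
    case False
    then have Z_pos: "0 < hs_norm Z" using hs_norm_nonneg[of Z] by linarith
    have "cmod (density_pairing \<kappa> \<eta> (\<Gamma> X)) / hs_norm Z \<le> Inf ?S"
    proof (rule cInf_greatest[OF nonempty])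
      fix x assume "x \<in> ?S"
      then obtain a b Y where x: "x = wnorm n L ?q a * wnorm n L ?q b * wnorm n L p Y"
        "X = a * Y * b"
        and abY: "a \<in> N" "b \<in> N" "Y \<in> M" by blast
      show "cmod (density_pairing \<kappa> \<eta> (\<Gamma> X)) / hs_norm Z \<le> x"
        using density_pairing_bimodule[OF abY p \<kappa>, of \<eta>] Z_pos
        by (simp add: x pos_divide_le_eq mult.commute)
    qed
    then show ?thesis unfolding abnorm using Z_pos by (simp add: pos_divide_le_eq mult.commute)
  qed
qed

end

section \<open>Hypercontractivity and the logarithmic Sobolev inequality\<close>

locale reversible_qms = decohering_qms +
  assumes reversible: "reversible n L"
begin

lemma winner_Gamma_inv_left:
  assumes A: "A \<in> M" and Y: "Y \<in> M"
  shows "winner n L (\<Gamma>_inv A) Y = tr (adj A * \<Gamma> Y)"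
proof -
  have "winner n L (\<Gamma>_inv A) Y = tr (sigma_pow (1/4) * (adj A * (sigma_pow (1/4) * Y)))"
    using A Y sigma_psd
    by (simp add: winner_def mpow_eq_mcpow adj_mult sigma_pow_adj M_assoc sigma_pow_mult_left)
  also have "\<dots> = tr ((adj A * (sigma_pow (1/4) * Y)) * sigma_pow (1/4))"
    using A Y by (intro tr_mult_commute) auto
  finally show ?thesis using A Y by (simp add: M_assoc)
qed

lemma winner_Gamma_inv_right:
  assumes X: "X \<in> M" and B: "B \<in> M"
  shows "winner n L X (\<Gamma>_inv B) = tr (adj (\<Gamma> X) * B)"
proof -
  have "winner n L X (\<Gamma>_inv B)
      = tr ((sigma_pow (1/2) * (adj X * (sigma_pow (1/4) * B))) * sigma_pow (- (1/4)))"
    using X B sigma_psd by (simp add: winner_def mpow_eq_mcpow M_assoc sigma_pow_mult_left)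
  also have "\<dots> = tr (sigma_pow (- (1/4)) * (sigma_pow (1/2) * (adj X * (sigma_pow (1/4) * B))))"
    using X B by (intro tr_mult_commute) auto
  finally show ?thesis using X B by (simp add: M_assoc adj_mult sigma_pow_adj sigma_pow_mult_left)
qed

definition \<Lambda> :: "complex mat \<Rightarrow> complex mat" where "\<Lambda> Y = \<Gamma> (L (\<Gamma>_inv Y))"

lemma lin_map_Gamma: "lin_map n (\<lambda>X. \<Gamma> X)"
  by (auto simp: lin_map_def M_distrib M_smult)

lemma lin_map_Lambda: "lin_map n \<Lambda>"
  unfolding lin_map_def \<Lambda>_def
  by (auto simp: M_distrib M_smult lin_map_add[OF lin_map_L] lin_map_smult[OF lin_map_L]
      lin_map_closed[OF lin_map_L])

lemma Lambda_sym: assumes A: "A \<in> M" and B: "B \<in> M" shows "tr (adj A * \<Lambda> B) = tr (adj (\<Lambda> A) * B)"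
proof -
  have "winner n L (\<Gamma>_inv A) (L (\<Gamma>_inv B)) = winner n L (L (\<Gamma>_inv A)) (\<Gamma>_inv B)"
    using reversible A B by (simp add: reversible_def)
  then show ?thesis
    using A B
    by (simp add: winner_Gamma_inv_left winner_Gamma_inv_right \<Lambda>_def lin_map_closed[OF lin_map_L])
qed

lemma Gamma_P: assumes X: "X \<in> M" shows "\<Gamma> (P t X) = superop_exp \<Lambda> (of_real t) (\<Gamma> X)"
  unfolding sg_eq_superop_exp[OF X]
  by (rule superop_exp_intertwine[OF lin_map_L lin_map_Lambda lin_map_Gamma X])
    (simp add: \<Lambda>_def Gamma_inv_Gamma)

lemma dirichlet2_eq_tr:
  assumes X: "X \<in> M" shows "dirichlet2 n L X = - Re (tr (adj (\<Gamma> X) * \<Lambda> (\<Gamma> X)))"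
  using winner_Gamma_inv_left[of "\<Gamma> X" "L X"] X
  by (simp add: dirichlet2_def \<Lambda>_def Gamma_inv_Gamma lin_map_closed[OF lin_map_L])

end

context relative_density
begin

definition entropy_trace :: complex where
  "entropy_trace = tr (Z * Z * (mln Z - (1/2) \<cdot>\<^sub>m mln R - (1/2) \<cdot>\<^sub>m mln \<sigma>))"

lemma ent2_eq_entropy_trace:
  assumes Z_eq: "\<Gamma> X = Z" shows "ent2 n L X = Re entropy_trace"
  unfolding ent2_def Gam_eq_sigma_pow using Z_eq sigma_psd
  by (simp add: Let_def mpow_eq_mcpow entropy_trace_def R_def)

lemma mln_closed [simp]: "psd n A \<Longrightarrow> mln A \<in> M"
  by (simp add: mln_def mfun_eq_mcfun psdD)

lemma mderiv_D_pow: "mderiv (\<lambda>z. D_pow (of_real b * z)) (of_real b \<cdot>\<^sub>m (mln \<sigma> + mln R)) 0"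
proof -
  have "mderiv (\<lambda>z. sigma_pow (0 + of_real b * z)) (of_real b \<cdot>\<^sub>m mln \<sigma>) 0"
    "mderiv (\<lambda>z. R_pow (0 + of_real b * z)) (of_real b \<cdot>\<^sub>m mln R) 0"
    using mderiv_mcpow[OF sigma_pd, of 0 b 0] mderiv_mcpow[OF R_pd, of 0 b 0] sigma_psd R_psd
    by (simp_all add: R_pow_0)
  from mderiv_mult[OF this] show ?thesis
    unfolding D_pow_def using sigma_psd R_psd
    by (simp add: R_pow_0 add_smult_distrib_left_mat[of _ n n])
qed

definition pairing_factor :: "real \<Rightarrow> real \<Rightarrow> complex mat" where
  "pairing_factor \<kappa> \<eta> = sigma_pow (1/4) * D_pow (of_real (- \<kappa>/4) + \<i> * of_real \<eta>)
      * mcpow (of_real ((1 + \<kappa>)/2)) Z"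

lemma pairing_factor_closed [simp]: "pairing_factor \<kappa> \<eta> \<in> M"
  using Z_psd by (simp add: pairing_factor_def)

lemma adj_pairing_factor:
  "adj (pairing_factor \<kappa> \<eta>)
      = mcpow (of_real ((1 + \<kappa>)/2)) Z * D_pow (of_real (- \<kappa>/4) - \<i> * of_real \<eta>) * sigma_pow (1/4)"
proof -
  have "cnj (of_real (- \<kappa>/4) + \<i> * of_real \<eta>) = of_real (- \<kappa>/4) - \<i> * of_real \<eta>"
    by (simp add: complex_eq_iff)
  then have "adj (D_pow (of_real (- \<kappa>/4) + \<i> * of_real \<eta>))
      = D_pow (of_real (- \<kappa>/4) - \<i> * of_real \<eta>)"
    unfolding D_pow_adj by (rule arg_cong)
  then show ?thesis
    unfolding pairing_factor_def using Z_psd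
    by (simp add: adj_mult sigma_pow_adj mcpow_adj M_assoc del: of_real_divide of_real_minus)
qed

lemma mcpow_Z_half_square:
  "mcpow (of_real ((1 + \<kappa>)/2)) Z * mcpow (of_real ((1 + \<kappa>)/2)) Z = mcpow (1 + of_real \<kappa>) Z"
  unfolding mcpow_mult[OF Z_psd] by simp

lemma tr_pairing_factor:
  assumes X: "X \<in> M"
  shows "tr (adj (pairing_factor \<kappa> \<eta>) * X * pairing_factor \<kappa> \<eta>) = density_pairing \<kappa> \<eta> (\<Gamma> X)"
proof -
  let ?K = "mcpow (of_real ((1 + \<kappa>)/2)) Z"
  define Y where "Y = D_pow (of_real (- \<kappa>/4) - \<i> * of_real \<eta>) * \<Gamma> X
      * D_pow (of_real (- \<kappa>/4) + \<i> * of_real \<eta>)"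
  have closed: "?K \<in> M" "Y \<in> M" using X Z_psd by (simp_all add: Y_def)
  have "adj (pairing_factor \<kappa> \<eta>) * X * pairing_factor \<kappa> \<eta> = (?K * Y) * ?K"
    unfolding adj_pairing_factor unfolding pairing_factor_def Y_def using X closed(1)
    by (simp add: M_assoc)
  then have "tr (adj (pairing_factor \<kappa> \<eta>) * X * pairing_factor \<kappa> \<eta>) = tr (?K * (?K * Y))"
    using tr_mult_commute[of "?K * Y" ?K] closed by simp
  also have "\<dots> = density_pairing \<kappa> \<eta> (\<Gamma> X)"
    using X closed by (simp add: density_pairing_def Y_def M_assoc flip: mcpow_Z_half_square)
  finally show ?thesis .
qed

lemma tr_pairing_factor_unitary:
  assumes X: "X \<in> M" and U: "U \<in> M" "U * adj U = 1\<^sub>m n"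
  shows "tr (adj (pairing_factor \<kappa> \<eta> * U) * X * (pairing_factor \<kappa> \<eta> * U))
      = density_pairing \<kappa> \<eta> (\<Gamma> X)"
proof -
  let ?B = "adj (pairing_factor \<kappa> \<eta>) * X * pairing_factor \<kappa> \<eta>"
  have B: "?B \<in> M" using X by simp
  have "adj (pairing_factor \<kappa> \<eta> * U) * X * (pairing_factor \<kappa> \<eta> * U) = adj U * (?B * U)"
    using X U by (simp add: adj_mult M_assoc)
  then have "tr (adj (pairing_factor \<kappa> \<eta> * U) * X * (pairing_factor \<kappa> \<eta> * U)) = tr (?B * U * adj U)"
    using tr_mult_commute[of "adj U" "?B * U"] B U by simp
  also have "?B * U * adj U = ?B * (U * adj U)" using B U by (intro M_assoc) auto
  finally show ?thesis using B by (simp add: U(2) tr_pairing_factor[OF X])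
qed

end

locale hypercontractive_setting = reversible_qms n L \<rho> + relative_density n L \<rho> Z for n L \<rho> Z +
  fixes p :: ereal and \<kappa> T Mp :: real
  assumes p: "2 < p" and \<kappa>: "\<kappa> = 1 - 2 * einv p" and T: "0 \<le> T" and Mp: "0 < Mp"
    and hypercontractive: "\<And>X. psd n X \<Longrightarrow> abnorm n L 2 p (P T X) \<le> Mp * wnorm n L 2 X"
begin

definition evolved :: "complex \<Rightarrow> complex mat" where
  "evolved z = superop_exp \<Lambda> (of_real T * z) Z"

definition interpolant :: "complex \<Rightarrow> complex" where
  "interpolant z = tr (mcpow (1 + of_real \<kappa> * z) Z * D_pow (of_real (- \<kappa>/4) * z) * evolved z
      * D_pow (of_real (- \<kappa>/4) * z))"

lemma evolved_closed [simp]: "evolved z \<in> M" by (simp add: evolved_def)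

lemma evolved_0: "evolved 0 = Z" by (simp add: evolved_def superop_exp_0[OF lin_map_Lambda])

lemma hs_norm_evolved: "Re z = 0 \<Longrightarrow> hs_norm (evolved z) = hs_norm Z"
  unfolding evolved_def by (intro hs_norm_superop_exp_imaginary lin_map_Lambda Lambda_sym) auto

lemma evolved_step: "evolved (1 + z) = \<Gamma> (P T (\<Gamma>_inv (evolved z)))"
proof -
  have "\<Gamma> (P T (\<Gamma>_inv (evolved z))) = superop_exp \<Lambda> (of_real T) (evolved z)"
    using Gamma_P[of "\<Gamma>_inv (evolved z)" T] by (simp add: Gamma_Gamma_inv)
  also have "\<dots> = evolved (1 + z)"
    unfolding evolved_def by (simp add: superop_exp_add[OF lin_map_Lambda] distrib_left)
  finally show ?thesis by simp
qed

lemma strip_bounded_interpolant: "strip_bounded interpolant"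
proof -
  have "mstrip (\<lambda>z. D_pow (of_real b * z))" for b using mstrip_D_pow[of 0] by simp
  moreover have "mstrip evolved"
    unfolding evolved_def by (rule mstrip_superop_exp[OF lin_map_Lambda Z_M Lambda_sym])
  ultimately show ?thesis
    unfolding interpolant_def by (intro mstrip_tr mstrip_mult mstrip_mcpow Z_psd)
qed

lemma interpolant_line_zero: assumes z: "Re z = 0" shows "cmod (interpolant z) \<le> (hs_norm Z)\<^sup>2"
proof -
  let ?D = "D_pow (of_real (- \<kappa>/4) * z)" and ?K = "mcpow (of_real \<kappa> * z) Z"
  have contraction: "contraction ?D" "contraction ?K"
    using z by (auto intro!: contraction_D_pow contraction_mcpow_imaginary Z_psd)
  have "interpolant z = tr ((Z * ?K) * (?D * (evolved z * ?D)))"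
    unfolding interpolant_def mcpow_Z_eq using Z_psd by (simp add: M_assoc)
  then have "cmod (interpolant z) \<le> hs_norm (Z * ?K) * hs_norm (?D * (evolved z * ?D))"
    using tr_Cauchy_Schwarz[of "Z * ?K" "?D * (evolved z * ?D)"] Z_psd by simp
  also have "\<dots> \<le> hs_norm Z * hs_norm (evolved z)"
  proof (intro mult_mono)
    have "hs_norm (?D * (evolved z * ?D)) \<le> hs_norm (evolved z * ?D)"
      using contractionD(2)[OF contraction(1)] by simp
    also have "\<dots> \<le> hs_norm (evolved z)" using contraction_mult_right[OF contraction(1)] by simp
    finally show "hs_norm (?D * (evolved z * ?D)) \<le> hs_norm (evolved z)" .
  qed (use contraction_mult_right[OF contraction(2)] in auto)
  finally show ?thesis using hs_norm_evolved[OF z] by (simp add: power2_eq_square)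
qed

lemma density_pairing_psd:
  assumes A: "psd n A"
  shows "cmod (density_pairing \<kappa> \<eta> (\<Gamma> (P T (\<Gamma>_inv A)))) \<le> Mp * hs_norm Z * hs_norm A"
proof -
  have A_closed: "A \<in> M" using A psdD by blast
  have "psd n (\<Gamma>_inv A)" using psd_conjugation[OF A, of "sigma_pow (- (1/4))"]
    by (simp add: sigma_pow_adj)
  then have "abnorm n L 2 p (P T (\<Gamma>_inv A)) \<le> Mp * hs_norm A"
    using hypercontractive[of "\<Gamma>_inv A"] wnorm_2_eq_hs_norm[of "\<Gamma>_inv A"]
      Gamma_Gamma_inv[OF A_closed] A_closed by simp
  then have "hs_norm Z * abnorm n L 2 p (P T (\<Gamma>_inv A)) \<le> hs_norm Z * (Mp * hs_norm A)"
    by (intro mult_left_mono) auto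
  then show ?thesis
    using density_pairing_le_abnorm[OF p \<kappa>, of "P T (\<Gamma>_inv A)" \<eta>] A_closed by (simp add: mult_ac)
qed

lemma interpolant_eq_offdiagonal:
  assumes z: "Re z = 1"
  shows "interpolant z = tr (adj (pairing_factor \<kappa> (\<kappa> * Im z / 4)) * P T (\<Gamma>_inv (evolved (z - 1)))
    * (pairing_factor \<kappa> (- (\<kappa> * Im z / 4)) * mcpow (\<i> * of_real (\<kappa> * Im z)) Z))"
proof -
  let ?K = "mcpow (of_real ((1 + \<kappa>)/2)) Z" and ?U = "mcpow (\<i> * of_real (\<kappa> * Im z)) Z"
  let ?X = "P T (\<Gamma>_inv (evolved (z - 1)))"
  define d where "d = D_pow (of_real (- \<kappa>/4) * z)"
  have d_eq: "D_pow (of_real (- \<kappa>/4) - \<i> * of_real (\<kappa> * Im z / 4)) = d"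
    "D_pow (of_real (- \<kappa>/4) + \<i> * of_real (- (\<kappa> * Im z / 4))) = d"
    unfolding d_def by (rule arg_cong[of _ _ D_pow]; use z in \<open>simp add: complex_eq_iff\<close>)+
  have closed: "?K \<in> M" "?U \<in> M" "d \<in> M" "?X \<in> M" using Z_psd by (simp_all add: d_def)
  have "mcpow (1 + of_real \<kappa> * z) Z = ?K * ?U * ?K"
    unfolding mcpow_mult[OF Z_psd]
    by (rule arg_cong[of _ _ "\<lambda>w. mcpow w Z"]) (use z in \<open>simp add: complex_eq_iff field_simps\<close>)
  then have "interpolant z = tr ((?K * ?U) * (?K * (d * (\<Gamma> ?X * d))))"
    using evolved_step[of "z - 1"] closed by (simp add: interpolant_def d_def M_assoc)
  also have "\<dots> = tr ((?K * (d * (\<Gamma> ?X * d))) * (?K * ?U))"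
    using closed by (intro tr_mult_commute) auto
  also have "(?K * (d * (\<Gamma> ?X * d))) * (?K * ?U)
    = adj (pairing_factor \<kappa> (\<kappa> * Im z / 4)) * ?X * (pairing_factor \<kappa> (- (\<kappa> * Im z / 4)) * ?U)"
    unfolding adj_pairing_factor unfolding pairing_factor_def d_eq using closed
    by (simp add: M_assoc)
  finally show ?thesis .
qed

(* The hypothesis only concerns positive semidefinite matrices, while the evolved Z is not even
   self-adjoint at imaginary times. It is the corner of a positive block matrix, and complete
   positivity of P T controls the corner by the diagonal. *)
lemma interpolant_line_one:
  assumes z: "Re z = 1" shows "cmod (interpolant z) \<le> Mp * (hs_norm Z)\<^sup>2"
proof -
  define v where "v = evolved (z - 1)"
  have v: "v \<in> M" "hs_norm v = hs_norm Z" using hs_norm_evolved[of "z - 1"] z by (auto simp: v_def)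
  obtain g h where gh: "g \<in> M" "h \<in> M" "v = g * adj h"
    and norms: "hs_norm (g * adj g) = hs_norm v" "hs_norm (h * adj h) = hs_norm v"
    by (rule balanced_factorization[OF v(1)]) blast
  let ?g = "sigma_pow (- (1/4)) * g" and ?h = "sigma_pow (- (1/4)) * h"
  have \<Gamma>_inv_products: "?g * adj ?g = \<Gamma>_inv (g * adj g)" "?g * adj ?h = \<Gamma>_inv v"
    "?h * adj ?h = \<Gamma>_inv (h * adj h)"
    using gh by (simp_all add: adj_mult sigma_pow_adj M_assoc)
  define \<eta> where "\<eta> = \<kappa> * Im z / 4"
  let ?S = "pairing_factor \<kappa> \<eta>"
  let ?T = "pairing_factor \<kappa> (- \<eta>) * mcpow (\<i> * of_real (\<kappa> * Im z)) Z"
  have T_closed: "?T \<in> M" using Z_psd by simp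
  have upper: "tr (adj ?S * P T (\<Gamma>_inv (g * adj g)) * ?S)
      = density_pairing \<kappa> \<eta> (\<Gamma> (P T (\<Gamma>_inv (g * adj g))))"
    using gh by (intro tr_pairing_factor) simp
  have lower: "tr (adj ?T * P T (\<Gamma>_inv (h * adj h)) * ?T)
      = density_pairing \<kappa> (- \<eta>) (\<Gamma> (P T (\<Gamma>_inv (h * adj h))))"
    using gh Z_psd mcpow_0[OF Z]
    by (intro tr_pairing_factor_unitary) (simp_all add: mcpow_adj mcpow_mult)
  have "2 * cmod (interpolant z) = 2 * cmod (tr (adj ?S * P T (?g * adj ?h) * ?T))"
    unfolding \<Gamma>_inv_products by (simp add: interpolant_eq_offdiagonal[OF z] \<eta>_def v_def)
  also have "\<dots> \<le> Re (tr (adj ?S * P T (?g * adj ?g) * ?S))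
      + Re (tr (adj ?T * P T (?h * adj ?h) * ?T))"
    using gh T_closed by (intro ucp_offdiagonal_bound[OF P_ucp[OF T]]) auto
  also have "\<dots> \<le> cmod (density_pairing \<kappa> \<eta> (\<Gamma> (P T (\<Gamma>_inv (g * adj g)))))
      + cmod (density_pairing \<kappa> (- \<eta>) (\<Gamma> (P T (\<Gamma>_inv (h * adj h)))))"
    unfolding \<Gamma>_inv_products upper lower by (intro add_mono complex_Re_le_cmod)
  also have "\<dots> \<le> Mp * hs_norm Z * hs_norm Z + Mp * hs_norm Z * hs_norm Z"
    using density_pairing_psd[of "g * adj g" \<eta>] density_pairing_psd[of "h * adj h" "- \<eta>"]
      psd_gram[of "adj g"] psd_gram[of "adj h"] gh norms v(2)
    by (intro add_mono) auto
  finally show ?thesis by (simp add: power2_eq_square)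
qed

lemma interpolant_bound:
  assumes \<theta>: "0 < \<theta>" "\<theta> < 1" shows "cmod (interpolant (of_real \<theta>)) \<le> (hs_norm Z)\<^sup>2 * Mp powr \<theta>"
proof -
  have "cmod (interpolant (of_real \<theta>)) \<le> ((hs_norm Z)\<^sup>2) powr (1 - \<theta>) * (Mp * (hs_norm Z)\<^sup>2) powr \<theta>"
    by (rule three_lines[OF strip_bounded_interpolant _ _ interpolant_line_zero interpolant_line_one])
      (use Mp \<theta> in auto)
  also have "\<dots> = ((hs_norm Z)\<^sup>2 powr (1 - \<theta>) * (hs_norm Z)\<^sup>2 powr \<theta>) * Mp powr \<theta>"
    using Mp by (simp add: powr_mult mult_ac)
  also have "(hs_norm Z)\<^sup>2 powr (1 - \<theta>) * (hs_norm Z)\<^sup>2 powr \<theta> = (hs_norm Z)\<^sup>2"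
    by (simp flip: powr_add)
  finally show ?thesis .
qed

lemma interpolant_0: "interpolant 0 = of_real ((hs_norm Z)\<^sup>2)"
  using tr_gram[OF Z_M] Z_psd by (simp add: interpolant_def evolved_0 D_pow_0 mcpow_1)

lemma interpolant_has_derivative:
  "(interpolant has_field_derivative (of_real \<kappa> * entropy_trace + of_real T * tr (Z * \<Lambda> Z))) (at 0)"
proof -
  have closed: "mln Z \<in> M" "mln R \<in> M" "mln \<sigma> \<in> M" "\<Lambda> Z \<in> M"
    using Z_psd R_psd sigma_psd lin_map_closed[OF lin_map_Lambda Z_M] by auto
  let ?K = "of_real \<kappa> \<cdot>\<^sub>m (Z * mln Z)" and ?D = "of_real (- \<kappa>/4) \<cdot>\<^sub>m (mln \<sigma> + mln R)"
  have increments_closed: "?K \<in> M" "?D \<in> M" using closed by auto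
  have K: "mderiv (\<lambda>z. mcpow (1 + of_real \<kappa> * z) Z) ?K 0"
    using mderiv_mcpow[OF Z, of 1 \<kappa> 0] mcpow_1[OF Z_psd] by simp
  have V: "mderiv evolved (of_real T \<cdot>\<^sub>m \<Lambda> Z) 0"
    using mderiv_superop_exp[OF lin_map_Lambda Z_M, of T 0] closed(4)
    by (simp add: evolved_def[abs_def] superop_exp_0[OF lin_map_Lambda])
  have "(interpolant has_field_derivative
      tr (((?K * 1\<^sub>m n + Z * ?D) * Z + (Z * 1\<^sub>m n) * (of_real T \<cdot>\<^sub>m \<Lambda> Z)) * 1\<^sub>m n
      + ((Z * 1\<^sub>m n) * Z) * ?D)) (at 0)"
    using mderiv_tr[OF mderiv_mult[OF mderiv_mult[OF mderiv_mult[OF K mderiv_D_pow] V] mderiv_D_pow]]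
      mcpow_1[OF Z_psd] D_pow_0 evolved_0
    unfolding interpolant_def[abs_def] by (simp del: of_real_divide of_real_minus)
  also have "tr (((?K * 1\<^sub>m n + Z * ?D) * Z + (Z * 1\<^sub>m n) * (of_real T \<cdot>\<^sub>m \<Lambda> Z)) * 1\<^sub>m n
      + ((Z * 1\<^sub>m n) * Z) * ?D)
    = of_real \<kappa> * tr (Z * mln Z * Z) + tr (Z * ?D * Z) + of_real T * tr (Z * \<Lambda> Z) + tr (Z * Z * ?D)"
    using closed increments_closed by (simp add: M_distrib M_smult tr_add tr_smult M_assoc)
  also have "tr (Z * mln Z * Z) = tr (Z * Z * mln Z)"
    using closed tr_mult_commute[of "Z * mln Z" Z] by (simp add: M_assoc)
  also have "tr (Z * ?D * Z) = tr (Z * Z * ?D)"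
    using increments_closed tr_mult_commute[of "Z * ?D" Z] by (simp add: M_assoc)
  also have "of_real \<kappa> * tr (Z * Z * mln Z) + tr (Z * Z * ?D) + of_real T * tr (Z * \<Lambda> Z)
      + tr (Z * Z * ?D)
    = of_real \<kappa> * entropy_trace + of_real T * tr (Z * \<Lambda> Z)"
    unfolding entropy_trace_def using closed
    by (simp add: M_distrib M_smult tr_add tr_minus tr_smult algebra_simps)
  finally show ?thesis .
qed

lemma entropy_bound: "\<kappa> * Re entropy_trace + T * Re (tr (Z * \<Lambda> Z)) \<le> (hs_norm Z)\<^sup>2 * ln Mp"
proof -
  let ?D = "of_real \<kappa> * entropy_trace + of_real T * tr (Z * \<Lambda> Z)"
  define \<phi> where "\<phi> t = (hs_norm Z)\<^sup>2 * Mp powr t - Re (interpolant (of_real t))" for t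
  have "((\<lambda>t. interpolant (of_real t)) has_vector_derivative ?D) (at 0)"
    using interpolant_has_derivative by (intro has_vector_derivative_real_field) simp
  then have "((\<lambda>t. Re (interpolant (of_real t))) has_real_derivative Re ?D) (at 0)"
    unfolding has_real_derivative_iff_has_vector_derivative
    by (rule bounded_linear.has_vector_derivative[OF bounded_linear_Re])
  moreover have "((\<lambda>t. (hs_norm Z)\<^sup>2 * Mp powr t) has_real_derivative (hs_norm Z)\<^sup>2 * ln Mp) (at 0)"
    using Mp by (auto intro!: derivative_eq_intros)
  ultimately have deriv: "(\<phi> has_real_derivative (hs_norm Z)\<^sup>2 * ln Mp - Re ?D) (at 0)"
    unfolding \<phi>_def by (intro DERIV_diff)
  have min_0: "\<phi> 0 \<le> \<phi> t" if "0 < t" "t < 1" for t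
    using interpolant_bound[OF that] complex_Re_le_cmod[of "interpolant (of_real t)"] Mp
      interpolant_0
    by (simp add: \<phi>_def)
  have "\<not> (hs_norm Z)\<^sup>2 * ln Mp - Re ?D < 0"
  proof
    assume "(hs_norm Z)\<^sup>2 * ln Mp - Re ?D < 0"
    then obtain d where d: "0 < d" "\<And>t. 0 < t \<Longrightarrow> t < d \<Longrightarrow> \<phi> t < \<phi> 0"
      using DERIV_neg_dec_right[OF deriv] by auto
    obtain t where "0 < t" "t < min d 1" using dense[of 0 "min d 1"] d(1) by auto
    then show False using d(2)[of t] min_0[of t] by simp
  qed
  then show ?thesis by simp
qed

end

context reversible_qms
begin

theorem hypercontractivity_imp_LSI2:
  fixes p :: ereal and T Mp :: real
  assumes p: "2 < p" and T: "0 \<le> T" and Mp: "0 < Mp"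
    and hypercontractive: "\<And>X. psd n X \<Longrightarrow> abnorm n L 2 p (P T X) \<le> Mp * wnorm n L 2 X"
  shows "LSI2 n L (pfac p * T) (pfac p * ln Mp)"
  unfolding LSI2_def
proof (intro allI impI)
  fix X assume X: "pd n X"
  have XM: "X \<in> M" using X pdD psdD by blast
  define \<kappa> where "\<kappa> = 1 - 2 * einv p"
  note pos = one_minus_2_einv_pos[OF p, folded \<kappa>_def]
  define Z where "Z = \<Gamma> X"
  have "pd n (adj (sigma_pow (1/4)) * X * sigma_pow (1/4))"
    by (rule pd_conjugation[OF X, where C = "sigma_pow (- (1/4))"]) (auto simp: sigma_pow_mult)
  then have Z: "pd n Z" by (simp add: Z_def sigma_pow_adj)
  interpret hypercontractive_setting n L \<rho> Z p \<kappa> T Mp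
    by unfold_locales (use Z p T Mp \<kappa>_def hypercontractive in auto)
  have "\<kappa> * ent2 n L X - T * dirichlet2 n L X \<le> (wnorm n L 2 X)\<^sup>2 * ln Mp"
    using entropy_bound ent2_eq_entropy_trace[OF Z_def[symmetric]] dirichlet2_eq_tr[OF XM]
      wnorm_2_eq_hs_norm[OF XM]
    by (simp flip: Z_def)
  then have "ent2 n L X \<le> (T * dirichlet2 n L X + (wnorm n L 2 X)\<^sup>2 * ln Mp) / \<kappa>"
    using pos by (simp add: pos_le_divide_eq mult.commute)
  then show "ent2 n L X \<le> pfac p * T * dirichlet2 n L X + pfac p * ln Mp * (wnorm n L 2 X)\<^sup>2"
    unfolding pfac_eq_inverse[OF p, folded \<kappa>_def] by (simp add: add_divide_distrib mult_ac)
qed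

end

theorem theorem4p7:
  fixes n :: nat and L :: "complex mat \<Rightarrow> complex mat"
    and p :: ereal and tp Mp :: real
  assumes "0 < n"
    and "qms n L" and "decohering n L" and "reversible n L"
    and "2 < p" and "0 < tp" and "0 < Mp"
    and "\<forall>X. psd n X \<longrightarrow> abnorm n L 2 p (sg L tp X) \<le> Mp * wnorm n L 2 X"
  shows "LSI2 n L (pfac p * tp) (pfac p * ln Mp)"
proof -
  obtain \<rho> where \<rho>: "pd n \<rho>" "\<And>t X. 0 \<le> t \<Longrightarrow> X \<in> carrier_mat n n \<Longrightarrow> tr (\<rho> * sg L t X) = tr (\<rho> * X)"
    using \<open>decohering n L\<close> by (auto simp: decohering_def)
  interpret reversible_qms n L \<rho>
    by unfold_locales (use assms \<rho> in auto)
  show ?thesis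
    by (rule hypercontractivity_imp_LSI2) (use assms in auto)
qed

end
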